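(* Let $X$ be a local isometric immersion of $S^n$ in $S^{n+m}$ with flat and non-degenerate normal bundle, and $\{e_\alpha\}_{\alpha=n+1}^{n+m}$ a parallel normal frame. Then: (i) There exist a local coordinate system $(x_1,\dots,x_n)$, a smooth $\mathcal M^0_{m\times n}$-valued map $A_1=(a_{ij})$ and a smooth $\mathcal M_{n\times1}$-valued map $b=(b_1,\dots,b_n)^t$ such that the two fundamental forms of $X$ are given by $$I=\sum_i b_i^2\,dx_i^2,\qquad II=\sum_{i=1}^n\sum_{j=1}^m a_{ji}b_i\,dx_i^2\,e_{n+j}.$$ (ii) Let $f_{ij}=(b_i)_{x_j}/b_j$ if $i\ne j$, $f_{ii}=0$ for all $1\le i\le n$, and $F=(f_{ij})$. Then $(A_1,F,b)$ is a solution of the partial $G_{m,n+1}$-system I. (iii) Let $e_i=\frac1{b_i}X_{x_i}$ and $g=(e_{n+1},\dots,e_{n+m},e_1,\dots,e_n,X)$. Then $$g^{-1}dg=\sum_{i=1}^n\begin{pmatrix}0&-A_1C_i&0\\ C_iA_1^t&-F^tC_i+C_iF&C_ib\\0&-b^tC_i&0\end{pmatrix}dx_i,\qquad(\ast)$$ which is the Lax connection $\Theta^I_\lambda$ of the partial $G_{m,n+1}$-system I at $\lambda=1$. (iv) If $(A_1,F,b)$ is a solution of the partial $G_{m,n+1}$-system I, then system $(\ast)$ is solvable. Let $g$ be a solution of $(\ast)$, and let $X$ denote the last column of $g$. Then $X$ is a local isometric immersion of $S^n$ in $S^{n+m}$.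
   Context: $S^n$, $S^{n+m}\subset\mathbb R^{n+m+1}$ are unit spheres. $\mathcal M_{p\times q}$: real $p\times q$ matrices; $\mathcal M^0_{m\times n}=\{A_1\in\mathcal M_{m\times n}:A_1^tA_1=I\}$; $gl_*(n)$: real $n\times n$ matrices with zero diagonal; $C_i$: the $n\times n$ matrix whose only non-zero entry is a $1$ at $(i,i)$. The partial $G_{m,n+1}$-system I is the PDE for $(A_1,F,b)=((a_{ij}),(f_{ij}),(b_i)):\mathbb R^n\to\mathcal M^0_{m\times n}\times gl_*(n)\times\mathcal M_{n\times1}$: $(f_{ij})_{x_j}+(f_{ji})_{x_i}+\sum_{k=1}^nf_{ik}f_{jk}+b_ib_j=0$ for $i\ne j$; $(f_{ij})_{x_k}=f_{ik}f_{kj}$ for $i,j,k$ distinct; $(b_i)_{x_j}=f_{ij}b_j$ for $i\ne j$; $(a_{ki})_{x_j}=f_{ij}a_{kj}$ for $i\ne j$. It is equivalent to the flatness, for all $\lambda\in\mathbb C$, of its Lax connection $\Theta^I_\lambda=\sum_i\begin{pmatrix}0&-A_1C_i\lambda&0\\ C_iA_1^t\lambda&-F^tC_i+C_iF&C_ib\\0&-b^tC_i&0\end{pmatrix}dx_i$. Solutions $g$ of $(\ast)$ are understood to be $O(n+m+1)$-valued. Conventions: with $\omega_i=\langle dX,e_i\rangle$ and $\omega_{i\alpha}=\langle e_i,de_\alpha\rangle$, $I=\sum_i\omega_i^2$ and $II=\sum_{i,\alpha}\omega_{i\alpha}\omega_ie_\alpha$, where $e_\alpha$ runs over the normal frame of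 $X$ in $S^{n+m}$. The normal bundle is non-degenerate if at each point the space of shape operators $\{A_v:v\text{ normal}\}$ has dimension $n$.
   Formalization: In (iv), X is asserted to be a local isometric immersion of S^n only on the open set where all b_i are non-zero; where some b_i = 0 one has X_{x_i} = 0, so the claim fails (e.g. b = 0, F = 0, A_1 constant gives constant X). *)

theory Defs
  imports "HOL-Analysis.Analysis"
begin

abbreviation dif :: "('a::real_normed_vector \<Rightarrow> 'b::real_normed_vector) \<Rightarrow> 'a \<Rightarrow> 'a \<Rightarrow> 'b"
  where "dif f x \<equiv> frechet_derivative f (at x)"

definition pd :: "'n::finite \<Rightarrow> (real^'n \<Rightarrow> 'b::real_normed_vector) \<Rightarrow> real^'n \<Rightarrow> 'b"
  where "pd i f x = dif f x (axis i 1)"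

fun Ck_on :: "nat \<Rightarrow> 'a::real_normed_vector set \<Rightarrow> ('a \<Rightarrow> 'b::real_normed_vector) \<Rightarrow> bool"
  where
    "Ck_on 0 S f \<longleftrightarrow> continuous_on S f"
  | "Ck_on (Suc k) S f \<longleftrightarrow>
       (\<forall>x\<in>S. f differentiable (at x)) \<and> (\<forall>v. Ck_on k S (\<lambda>x. dif f x v))"

text \<open>Only used for open \<open>S\<close>, where this is \<open>C\<^sup>\<infinity>\<close>.\<close>

definition smooth_on :: "'a::real_normed_vector set \<Rightarrow> ('a \<Rightarrow> 'b::real_normed_vector) \<Rightarrow> bool"
  where "smooth_on S f \<longleftrightarrow> (\<forall>k. Ck_on k S f)"


text \<open>
  The sphere \<open>S\<^sup>n\<close> is \<open>sphere 0 1\<close> in \<open>real ^ ('n + 1)\<close>, and \<open>S\<^bsup>n+m\<^esup>\<close> is \<open>sphere 0 1\<close> in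
  \<open>real ^ ('m + 'n + 1)\<close>; the order of the summands is that of the blocks of the matrices below.
  A local coordinate system of \<open>S\<^sup>n\<close> is given by its inverse, the parametrization \<open>\<phi>\<close>: an injective
  immersion between manifolds of the same dimension is a diffeomorphism onto an open subset.
\<close>

definition sphere_chart :: "(real^'n::finite) set \<Rightarrow> (real^'n \<Rightarrow> real^('n + 1)) \<Rightarrow> bool"
  where "sphere_chart W \<phi> \<longleftrightarrow>
    open W \<and> smooth_on W \<phi> \<and> \<phi> ` W \<subseteq> sphere 0 1 \<and> inj_on \<phi> W \<and> (\<forall>x\<in>W. inj (dif \<phi> x))"

definition chart_in :: "(real^('n::finite + 1)) set \<Rightarrow> (real^'n) set \<Rightarrow> (real^'n \<Rightarrow> real^('n + 1)) \<Rightarrow> bool"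
  where "chart_in M W \<phi> \<longleftrightarrow> sphere_chart W \<phi> \<and> \<phi> ` W \<subseteq> M"

definition first_ff :: "(real^'n::finite \<Rightarrow> 'e::euclidean_space) \<Rightarrow> real^'n \<Rightarrow> real^'n \<Rightarrow> real^'n \<Rightarrow> real"
  where "first_ff X x u w = dif X x u \<bullet> dif X x w"

text \<open>
  Isometric immersion into \<open>S\<^bsup>n+m\<^esup>\<close> of an open subset \<open>M\<close> of \<open>S\<^sup>n\<close> with its standard metric,
  which in a chart \<open>\<phi>\<close> is \<open>first_ff \<phi>\<close>.  Smoothness and isometry are expressed in all charts.
\<close>

definition isometric_immersion ::
    "(real^('n::finite + 1)) set \<Rightarrow> (real^('n + 1) \<Rightarrow> real^('m::finite + 'n + 1)) \<Rightarrow> bool"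
  where "isometric_immersion M X \<longleftrightarrow>
    openin (top_of_set (sphere 0 1)) M \<and> X ` M \<subseteq> sphere 0 1 \<and>
    (\<forall>W \<phi>. chart_in M W \<phi> \<longrightarrow>
       smooth_on W (X \<circ> \<phi>) \<and>
       (\<forall>x\<in>W. \<forall>u w. first_ff (X \<circ> \<phi>) x u w = first_ff \<phi> x u w))"

text \<open>
  A map \<open>X\<close> on an open subset of \<open>real ^ 'n\<close> is a local isometric immersion of \<open>S\<^sup>n\<close> if near each
  point it is an isometric immersion of an open subset of \<open>S\<^sup>n\<close>, written in a chart of \<open>S\<^sup>n\<close>.
\<close>

definition local_isometric_immersion_of_sphere ::
    "(real^'n::finite) set \<Rightarrow> (real^'n \<Rightarrow> real^('m::finite + 'n + 1)) \<Rightarrow> bool"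
  where "local_isometric_immersion_of_sphere V X \<longleftrightarrow>
    open V \<and>
    (\<forall>p\<in>V. \<exists>V' \<phi> Y. p \<in> V' \<and> V' \<subseteq> V \<and> sphere_chart V' \<phi> \<and>
       isometric_immersion (\<phi> ` V') Y \<and> (\<forall>x\<in>V'. X x = Y (\<phi> x)))"


text \<open>
  The normal bundle in \<open>S\<^bsup>n+m\<^esup>\<close> of a parametrized immersion \<open>X\<close>, and its normal connection:
  \<open>closest_point\<close> of a linear subspace is the orthogonal projection onto it.
\<close>

definition normal_space ::
    "(real^'n::finite \<Rightarrow> 'e::euclidean_space) \<Rightarrow> real^'n \<Rightarrow> 'e set"
  where "normal_space X x = {v. v \<bullet> X x = 0 \<and> (\<forall>u. v \<bullet> dif X x u = 0)}"

definition normal_derivative ::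
    "(real^'n::finite \<Rightarrow> 'e::euclidean_space) \<Rightarrow> 'n \<Rightarrow> (real^'n \<Rightarrow> 'e) \<Rightarrow> real^'n \<Rightarrow> 'e"
  where "normal_derivative X i \<xi> x = closest_point (normal_space X x) (pd i \<xi> x)"

definition normal_curvature ::
    "(real^'n::finite \<Rightarrow> 'e::euclidean_space) \<Rightarrow> 'n \<Rightarrow> 'n \<Rightarrow> (real^'n \<Rightarrow> 'e) \<Rightarrow> real^'n \<Rightarrow> 'e"
  where "normal_curvature X i j \<xi> x =
    normal_derivative X i (normal_derivative X j \<xi>) x
    - normal_derivative X j (normal_derivative X i \<xi>) x"

definition flat_normal_bundle ::
    "(real^('n::finite + 1)) set \<Rightarrow> (real^('n + 1) \<Rightarrow> real^('m::finite + 'n + 1)) \<Rightarrow> bool"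
  where "flat_normal_bundle M X \<longleftrightarrow>
    (\<forall>W \<phi> \<xi>. chart_in M W \<phi> \<and> smooth_on W \<xi> \<and> (\<forall>x\<in>W. \<xi> x \<in> normal_space (X \<circ> \<phi>) x) \<longrightarrow>
       (\<forall>x\<in>W. \<forall>i j. normal_curvature (X \<circ> \<phi>) i j \<xi> x = 0))"

text \<open>
  Matrix of the shape operator \<open>A\<^sub>v\<close>, i.e. of the map sending \<open>u\<close> to the tangential part of minus the
  derivative along \<open>u\<close> of a normal field extending \<open>v\<close>, in the coordinate basis of the tangent space
  (Weingarten: the inverse of the metric times the Hessian of \<open>X\<close> in direction \<open>v\<close>).
\<close>

definition shape_operator ::
    "(real^'n::finite \<Rightarrow> 'e::euclidean_space) \<Rightarrow> real^'n \<Rightarrow> 'e \<Rightarrow> real^'n^'n"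
  where "shape_operator X x v =
    matrix_inv (\<chi> i j. pd i X x \<bullet> pd j X x) ** (\<chi> i j. pd i (pd j X) x \<bullet> v)"

definition nondegenerate_normal_bundle ::
    "(real^('n::finite + 1)) set \<Rightarrow> (real^('n + 1) \<Rightarrow> real^('m::finite + 'n + 1)) \<Rightarrow> bool"
  where "nondegenerate_normal_bundle M X \<longleftrightarrow>
    (\<forall>W \<phi>. chart_in M W \<phi> \<longrightarrow>
       (\<forall>x\<in>W. dim (shape_operator (X \<circ> \<phi>) x ` normal_space (X \<circ> \<phi>) x) = CARD('n)))"

text \<open>Orthonormal; \<open>e k\<close> for \<open>k :: 'm\<close> is the normal field \<open>e\<^bsub>n+k\<^esub>\<close>.\<close>

definition parallel_normal_frame ::
    "(real^('n::finite + 1)) set \<Rightarrow> (real^('n + 1) \<Rightarrow> real^('m::finite + 'n + 1)) \<Rightarrow>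
     ('m \<Rightarrow> real^('n + 1) \<Rightarrow> real^('m + 'n + 1)) \<Rightarrow> bool"
  where "parallel_normal_frame M X e \<longleftrightarrow>
    (\<forall>W \<phi>. chart_in M W \<phi> \<longrightarrow>
       (\<forall>k. smooth_on W (e k \<circ> \<phi>)) \<and>
       (\<forall>x\<in>W.
          (\<forall>k. e k (\<phi> x) \<in> normal_space (X \<circ> \<phi>) x) \<and>
          (\<forall>k l. e k (\<phi> x) \<bullet> e l (\<phi> x) = (if k = l then 1 else 0)) \<and>
          (\<forall>k i. normal_derivative (X \<circ> \<phi>) i (e k \<circ> \<phi>) x = 0)))"

text \<open>
  Let \<open>e\<^sub>i\<close> be an orthonormal tangent frame, \<open>\<omega>\<^sub>i = \<langle>dX, e\<^sub>i\<rangle>\<close> and \<open>\<omega>\<^bsub>i\<alpha>\<^esub> = \<langle>e\<^sub>i, de\<^sub>\<alpha>\<rangle>\<close>.  As \<open>dX\<close> is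
  tangent, \<open>\<Sum>\<^sub>i \<omega>\<^sub>i(u) \<omega>\<^bsub>i\<alpha>\<^esub>(w) = \<langle>dX(u), de\<^sub>\<alpha>(w)\<rangle>\<close> independently of the choice of that frame, so the
  following is \<open>II = \<Sum>\<^bsub>i,\<alpha>\<^esub> \<omega>\<^bsub>i\<alpha>\<^esub> \<omega>\<^sub>i e\<^sub>\<alpha>\<close>.  With this convention \<open>\<langle>II(u,w), v\<rangle>\<close> is minus the Hessian
  of \<open>X\<close> in direction \<open>v\<close>.
\<close>

definition second_ff ::
    "(real^'n::finite \<Rightarrow> 'e::euclidean_space) \<Rightarrow> ('m::finite \<Rightarrow> real^'n \<Rightarrow> 'e) \<Rightarrow>
     real^'n \<Rightarrow> real^'n \<Rightarrow> real^'n \<Rightarrow> 'e"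
  where "second_ff X E x u w = (\<Sum>k\<in>UNIV. (dif X x u \<bullet> dif (E k) x w) *\<^sub>R E k x)"

text \<open>
  \<open>M\<^sup>0\<^bsub>m\<times>n\<^esub>\<close>-valued \<open>A\<^sub>1\<close> and \<open>b\<close> that express the fundamental forms of \<open>X\<close> in the coordinates \<open>x\<close>
  on \<open>W\<close>; \<open>dx\<^sub>i\<^sup>2\<close> is the symmetric bilinear form \<open>(u, w) \<mapsto> u\<^sub>i w\<^sub>i\<close>.
\<close>

definition stiefel :: "(real^'n::finite^'m::finite) set"
  where "stiefel = {A. transpose A ** A = mat 1}"

definition forms_in_coordinates ::
    "(real^('n::finite + 1)) set \<Rightarrow> (real^('n + 1) \<Rightarrow> real^('m::finite + 'n + 1)) \<Rightarrow>
     ('m \<Rightarrow> real^('n + 1) \<Rightarrow> real^('m + 'n + 1)) \<Rightarrow>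
     (real^'n) set \<Rightarrow> (real^'n \<Rightarrow> real^('n + 1)) \<Rightarrow>
     (real^'n \<Rightarrow> real^'n^'m) \<Rightarrow> (real^'n \<Rightarrow> real^'n) \<Rightarrow> bool"
  where "forms_in_coordinates M X e W \<phi> A b \<longleftrightarrow>
    chart_in M W \<phi> \<and> smooth_on W A \<and> A ` W \<subseteq> stiefel \<and> smooth_on W b \<and>
    (\<forall>x\<in>W. \<forall>u w.
       first_ff (X \<circ> \<phi>) x u w = (\<Sum>i\<in>UNIV. (b x $ i)\<^sup>2 * (u $ i * w $ i)) \<and>
       second_ff (X \<circ> \<phi>) (\<lambda>k. e k \<circ> \<phi>) x u w =
         (\<Sum>i\<in>UNIV. \<Sum>j\<in>UNIV. (A x $ j $ i * b x $ i * (u $ i * w $ i)) *\<^sub>R e j (\<phi> x)))"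


definition partial_G_system_I ::
    "(real^'n::finite) set \<Rightarrow> (real^'n \<Rightarrow> real^'n^'m::finite) \<Rightarrow> (real^'n \<Rightarrow> real^'n^'n) \<Rightarrow>
     (real^'n \<Rightarrow> real^'n) \<Rightarrow> bool"
  where "partial_G_system_I W A F b \<longleftrightarrow>
    smooth_on W A \<and> smooth_on W F \<and> smooth_on W b \<and>
    A ` W \<subseteq> stiefel \<and> (\<forall>x\<in>W. \<forall>i. F x $ i $ i = 0) \<and>
    (\<forall>x\<in>W.
       (\<forall>i j. i \<noteq> j \<longrightarrow>
          pd j (\<lambda>y. F y $ i $ j) x + pd i (\<lambda>y. F y $ j $ i) x
          + (\<Sum>k\<in>UNIV. F x $ i $ k * F x $ j $ k) + b x $ i * b x $ j = 0) \<and>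
       (\<forall>i j k. i \<noteq> j \<and> j \<noteq> k \<and> i \<noteq> k \<longrightarrow>
          pd k (\<lambda>y. F y $ i $ j) x = F x $ i $ k * F x $ k $ j) \<and>
       (\<forall>i j. i \<noteq> j \<longrightarrow> pd j (\<lambda>y. b y $ i) x = F x $ i $ j * b x $ j) \<and>
       (\<forall>k i j. i \<noteq> j \<longrightarrow> pd j (\<lambda>y. A y $ k $ i) x = F x $ i $ j * A x $ k $ j))"

definition F_of :: "(real^'n::finite \<Rightarrow> real^'n) \<Rightarrow> real^'n \<Rightarrow> real^'n^'n"
  where "F_of b x = (\<chi> i j. if i = j then 0 else pd j (\<lambda>y. b y $ i) x / b x $ j)"


definition block3 ::
    "'a^'m^'m \<Rightarrow> 'a^'n^'m \<Rightarrow> 'a^1^'m \<Rightarrow>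
     'a^'m^'n \<Rightarrow> 'a^'n^'n \<Rightarrow> 'a^1^'n \<Rightarrow>
     'a^'m^1 \<Rightarrow> 'a^'n^1 \<Rightarrow> 'a^1^1 \<Rightarrow> 'a^('m::finite + 'n::finite + 1)^('m + 'n + 1)"
  where "block3 B11 B12 B13 B21 B22 B23 B31 B32 B33 = (\<chi> p q.
    case p of
      Inl k \<Rightarrow> (case q of Inl l \<Rightarrow> B11 $ k $ l | Inr (Inl j) \<Rightarrow> B12 $ k $ j | Inr (Inr o') \<Rightarrow> B13 $ k $ o')
    | Inr (Inl i) \<Rightarrow> (case q of Inl l \<Rightarrow> B21 $ i $ l | Inr (Inl j) \<Rightarrow> B22 $ i $ j | Inr (Inr o') \<Rightarrow> B23 $ i $ o')
    | Inr (Inr o'') \<Rightarrow> (case q of Inl l \<Rightarrow> B31 $ o'' $ l | Inr (Inl j) \<Rightarrow> B32 $ o'' $ j | Inr (Inr o') \<Rightarrow> B33 $ o'' $ o'))"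

definition Cmat :: "'n::finite \<Rightarrow> 'a::zero_neq_one^'n^'n"
  where "Cmat i = (\<chi> k l. if k = i \<and> l = i then 1 else 0)"

text \<open>Coefficients of \<open>dx\<^sub>i\<close>, at a point, in the right-hand side of the system \<open>(\<ast>)\<close> and in the Lax
  connection \<open>\<Theta>\<^sup>I\<^sub>\<lambda>\<close>; \<open>mat lam\<close> is scalar multiplication by \<open>\<lambda> = lam\<close>.\<close>

definition star_coeff ::
    "real^'n::finite^'m::finite \<Rightarrow> real^'n^'n \<Rightarrow> real^'n \<Rightarrow> 'n \<Rightarrow> real^('m + 'n + 1)^('m + 'n + 1)"
  where "star_coeff A F b i = block3
    0                      (- (A ** Cmat i))                          0
    (Cmat i ** transpose A)  (- (transpose F ** Cmat i) + Cmat i ** F)  (Cmat i ** columnvector b)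
    0                      (- (rowvector b ** Cmat i))                0"

definition lax_coeff ::
    "complex \<Rightarrow> real^'n::finite^'m::finite \<Rightarrow> real^'n^'n \<Rightarrow> real^'n \<Rightarrow> 'n \<Rightarrow>
     complex^('m + 'n + 1)^('m + 'n + 1)"
  where "lax_coeff lam A F b i =
    (let A' = map_matrix complex_of_real A; F' = map_matrix complex_of_real F;
         b' = (\<chi> k. complex_of_real (b $ k))
     in block3
       0                                  (- (A' ** Cmat i ** mat lam))                    0
       (Cmat i ** transpose A' ** mat lam)  (- (transpose F' ** Cmat i) + Cmat i ** F')  (Cmat i ** columnvector b')
       0                                  (- (rowvector b' ** Cmat i))                   0)"

definition solves_star ::
    "(real^'n::finite) set \<Rightarrow> (real^'n \<Rightarrow> real^'n^'m::finite) \<Rightarrow> (real^'n \<Rightarrow> real^'n^'n) \<Rightarrow>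
     (real^'n \<Rightarrow> real^'n) \<Rightarrow> (real^'n \<Rightarrow> real^('m + 'n + 1)^('m + 'n + 1)) \<Rightarrow> bool"
  where "solves_star W A F b g \<longleftrightarrow>
    smooth_on W g \<and>
    (\<forall>x\<in>W. orthogonal_matrix (g x) \<and>
       (\<forall>u. matrix_inv (g x) ** dif g x u = (\<Sum>i\<in>UNIV. u $ i *\<^sub>R star_coeff (A x) (F x) (b x) i)))"

text \<open>The matrix with columns \<open>e\<^bsub>n+1\<^esub>, \<dots>, e\<^bsub>n+m\<^esub>, e\<^sub>1, \<dots>, e\<^sub>n, X\<close>, where \<open>e\<^sub>i = X\<^bsub>x\<^sub>i\<^esub> / b\<^sub>i\<close>.\<close>

definition adapted_frame ::
    "(real^'n::finite \<Rightarrow> real^('m::finite + 'n + 1)) \<Rightarrow> ('m \<Rightarrow> real^'n \<Rightarrow> real^('m + 'n + 1)) \<Rightarrow>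
     (real^'n \<Rightarrow> real^'n) \<Rightarrow> real^'n \<Rightarrow> real^('m + 'n + 1)^('m + 'n + 1)"
  where "adapted_frame X E b x = (\<chi> p q.
    (case q of Inl k \<Rightarrow> E k x
             | Inr (Inl i) \<Rightarrow> (1 / b x $ i) *\<^sub>R pd i X x
             | Inr (Inr o') \<Rightarrow> X x) $ p)"

definition last_column :: "real^('m::finite + 'n::finite + 1)^('m + 'n + 1) \<Rightarrow> real^('m + 'n + 1)"
  where "last_column g = column (Inr (Inr 1)) g"

end

theory Submission
  imports Defs
begin

text \<open>
  The analytic core is a Frobenius theorem for flat \<open>so(k)\<close>-valued connections on starlike sets: the
  linear equation is solved along rays, and comparing the solutions on two neighbouring rays shows
  that the transport is differentiable with the prescribed derivative.

  From a solution of the system to an immersion: the entries of the curvature of \<open>(\<ast>)\<close> are exactly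
  the equations of the system, so \<open>(\<ast>)\<close> has a solution \<open>g\<close>. The same holds at \<open>\<lambda> = 0\<close>, where the
  tangential block alone yields a map into \<open>S\<^sup>n\<close> with the first fundamental form
  \<open>\<Sum>\<^sub>i b\<^sub>i\<^sup>2 dx\<^sub>i\<^sup>2\<close> of the last column of \<open>g\<close>; this map is a chart in which that column is isometric.

  From an immersion to a solution: by the Ricci equation the shape operators commute, and by
  non-degeneracy some combination of them has simple spectrum, so its eigenvectors are smooth and
  diagonalize all of them. As domain and target have equal curvature, the Gauss equation says that
  the curvature normals are orthogonal. Normalizing them gives \<open>A\<^sub>1\<close>, and the Codazzi equation
  then says that the principal coframe divided by \<open>b\<close> is closed, that is, of the form \<open>dx\<^sub>i\<close>. In such
  coordinates the adapted frame satisfies \<open>(\<ast>)\<close>, whose integrability conditions are the system.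
\<close>

section \<open>Calculus of smooth maps\<close>

text \<open>No growth estimate enters the Frobenius theorem: skewness keeps all frames orthogonal,
  hence of one constant norm, so the error of an approximate solution is bounded directly by its
  defect.

  The origin of \<open>b\<close>: let \<omega>_i be the principal coframe, \<eta>_i the vector of
  the i-th principal curvatures with respect to the parallel frame, r_i its length and a_i =
  \<eta>_i / r_i. Then \<omega>_{i\<alpha>} = a_{\<alpha>i} r_i \<omega>_i. The Codazzi equation
  expresses d\<omega>_{i\<alpha>} through the products \<omega>_{ij} \<and> \<omega>_{j\<alpha>};
  pairing it with a_i removes all of them, because the a_i are orthonormal, and leaves d(r_i
  \<omega>_i) = 0. So dx_i = r_i \<omega>_i, and b_i = 1/r_i because I is the sum of the squares of
  the \<omega>_i.

  This needs \<eta>_i \<noteq> 0, which is why the chosen combination of shape operators gets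
  eigenvalues that are nonzero as well as distinct. Away from the base point its eigenvectors solve
  a generalized problem with the metric as second matrix; a chart that is orthonormal at the base
  point makes the algebra there that of symmetric matrices.\<close>

lemma dif_eq: "(f has_derivative f') (at x) \<Longrightarrow> dif f x = f'"
  using frechet_derivative_at by metis

lemma has_derivative_cong_open:
  assumes "open S" "x \<in> S" "\<And>y. y \<in> S \<Longrightarrow> f y = g y"
  shows "(f has_derivative f') (at x) \<longleftrightarrow> (g has_derivative f') (at x)"
proof
  show "(g has_derivative f') (at x)" if "(f has_derivative f') (at x)"
    by (rule has_derivative_transform_within_open[OF that assms(1,2)]) (rule assms(3))
  show "(f has_derivative f') (at x)" if "(g has_derivative f') (at x)"
    by (rule has_derivative_transform_within_open[OF that assms(1,2)]) (simp add: assms(3))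
qed

text \<open>\<open>frechet_derivative\<close> is a choice from the set of all derivatives. Maps that
  agree near \<open>x\<close> have the same set, so the choice is the same, differentiable or
  not.\<close>

lemma dif_cong_open:
  assumes "open S" "x \<in> S" "\<And>y. y \<in> S \<Longrightarrow> f y = g y"
  shows "dif f x = dif g x"
proof -
  have "(f has_derivative f') (at x) \<longleftrightarrow> (g has_derivative f') (at x)" for f'
    by (rule has_derivative_cong_open[OF assms])
  then show ?thesis
    unfolding frechet_derivative_def by presburger
qed

lemma differentiable_cong_open:
  assumes "open S" "x \<in> S" "\<And>y. y \<in> S \<Longrightarrow> f y = g y" "f differentiable (at x)"
  shows "g differentiable (at x)"
proof -
  have "(f has_derivative f') (at x) \<longleftrightarrow> (g has_derivative f') (at x)" for f'
    by (rule has_derivative_cong_open[OF assms(1-3)])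
  then show ?thesis
    using assms(4) unfolding differentiable_def by presburger
qed

lemma Ck_on_cong:
  assumes "open S" "\<And>x. x \<in> S \<Longrightarrow> f x = g x" "Ck_on k S f"
  shows "Ck_on k S g"
  using assms(2,3)
proof (induction k arbitrary: f g)
  case 0
  then show ?case
    using continuous_on_cong[OF refl, of S f g] by simp
next
  case (Suc k)
  have "Ck_on k S (\<lambda>x. dif g x v)" for v
  proof (rule Suc.IH)
    show "dif f x v = dif g x v" if "x \<in> S" for x
    proof -
      have "dif f x = dif g x"
        by (rule dif_cong_open[OF assms(1) that]) (rule Suc.prems(1))
      then show ?thesis by simp
    qed
    show "Ck_on k S (\<lambda>x. dif f x v)"
      using Suc.prems(2) by simp
  qed
  moreover have "g differentiable (at x)" if "x \<in> S" for x
    by (rule differentiable_cong_open[OF assms(1) that, of f]) (use Suc.prems that in simp_all)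
  ultimately show ?case
    by simp
qed

text \<open>Admits a formula for the derivative in place of the chosen \<open>dif\<close>; the
  regularity inductions below go through it.\<close>

lemma Ck_on_SucI:
  assumes "open S" "\<And>x. x \<in> S \<Longrightarrow> (f has_derivative f' x) (at x)"
    "\<And>v. Ck_on k S (\<lambda>x. f' x v)"
  shows "Ck_on (Suc k) S f"
proof -
  have "Ck_on k S (\<lambda>x. dif f x v)" for v
    by (rule Ck_on_cong[OF assms(1) _ assms(3)[of v]]) (simp add: dif_eq[OF assms(2)])
  then show ?thesis
    using assms(2) by (auto simp: differentiable_def)
qed

lemma Ck_on_SucD: "Ck_on (Suc k) S f \<Longrightarrow> Ck_on k S f"
proof (induction k arbitrary: f)
  case 0
  then have "f differentiable_on S"
    unfolding differentiable_on_def by (auto intro: differentiable_at_withinI)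
  then show ?case
    by (simp add: differentiable_imp_continuous_on)
next
  case (Suc k)
  have "Ck_on k S (\<lambda>x. dif f x v)" for v
    by (rule Suc.IH) (use Suc.prems in \<open>simp only: Ck_on.simps(2)[of "Suc k"]\<close>)
  then show ?case
    using Suc.prems by simp
qed

lemma Ck_on_subset: "Ck_on k S f \<Longrightarrow> T \<subseteq> S \<Longrightarrow> Ck_on k T f"
proof (induction k arbitrary: f)
  case 0
  then show ?case using continuous_on_subset by simp blast
qed auto

lemma Ck_on_local:
  assumes "\<And>x. x \<in> S \<Longrightarrow> \<exists>T. open T \<and> x \<in> T \<and> Ck_on k T f"
  shows "Ck_on k S f"
  using assms
proof (induction k arbitrary: f)
  case 0
  have "continuous (at x) f" if x: "x \<in> S" for x
    using 0[OF x] continuous_on_eq_continuous_at by auto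
  then show ?case
    by (simp add: continuous_at_imp_continuous_on)
next
  case (Suc k)
  show ?case
    unfolding Ck_on.simps
  proof (intro conjI ballI allI)
    show "f differentiable at x" if "x \<in> S" for x
      using Suc.prems[OF that] by auto
    show "Ck_on k S (\<lambda>x. dif f x v)" for v
    proof (rule Suc.IH)
      fix x assume "x \<in> S"
      from Suc.prems[OF this] obtain T where "open T" "x \<in> T" "Ck_on (Suc k) T f" by blast
      then show "\<exists>T. open T \<and> x \<in> T \<and> Ck_on k T (\<lambda>x. dif f x v)"
        by auto
    qed
  qed
qed

lemma Ck_on_const: "Ck_on k S (\<lambda>x. c)"
  by (induction k arbitrary: c) auto

lemma Ck_on_add:
  assumes "open S" shows "Ck_on k S f \<Longrightarrow> Ck_on k S g \<Longrightarrow> Ck_on k S (\<lambda>x. f x + g x)"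
proof (induction k arbitrary: f g)
  case 0
  then show ?case by (auto intro: continuous_intros)
next
  case (Suc k)
  show ?case
  proof (rule Ck_on_SucI[OF assms])
    show "((\<lambda>x. f x + g x) has_derivative (\<lambda>v. dif f x v + dif g x v)) (at x)" if "x \<in> S" for x
      using Suc.prems that
      by (intro has_derivative_add) (auto simp: frechet_derivative_works[symmetric])
    show "Ck_on k S (\<lambda>x. dif f x v + dif g x v)" for v
      using Suc by simp
  qed
qed

lemma Ck_on_sum:
  assumes "open S" "\<And>i. i \<in> I \<Longrightarrow> Ck_on k S (f i)"
  shows "Ck_on k S (\<lambda>x. \<Sum>i\<in>I. f i x)"
  using assms(2)
  by (induction I rule: infinite_finite_induct) (auto intro: Ck_on_add[OF assms(1)] Ck_on_const)

lemma Ck_on_bounded_linear: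
  assumes "bounded_linear L" "open S"
  shows "Ck_on k S f \<Longrightarrow> Ck_on k S (\<lambda>x. L (f x))"
proof (induction k arbitrary: f)
  case 0
  then show ?case using assms(1) by (simp add: bounded_linear.continuous_on)
next
  case (Suc k)
  show ?case
  proof (rule Ck_on_SucI[OF assms(2)])
    show "((\<lambda>x. L (f x)) has_derivative (\<lambda>v. L (dif f x v))) (at x)" if "x \<in> S" for x
      using Suc.prems that
      by (intro bounded_linear.has_derivative[OF assms(1)]) (auto simp: frechet_derivative_works[symmetric])
    show "Ck_on k S (\<lambda>x. L (dif f x v))" for v
      using Suc by simp
  qed
qed

lemma Ck_on_bounded_bilinear:
  assumes "bounded_bilinear B" "open S"
  shows "Ck_on k S f \<Longrightarrow> Ck_on k S g \<Longrightarrow> Ck_on k S (\<lambda>x. B (f x) (g x))"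
proof (induction k arbitrary: f g)
  case 0
  then show ?case using assms(1) by (simp add: bounded_bilinear.continuous_on)
next
  case (Suc k)
  show ?case
  proof (rule Ck_on_SucI[OF assms(2)])
    show "((\<lambda>x. B (f x) (g x)) has_derivative (\<lambda>v. B (f x) (dif g x v) + B (dif f x v) (g x))) (at x)"
      if "x \<in> S" for x
      using Suc.prems that
      by (intro bounded_bilinear.FDERIV[OF assms(1)]) (auto simp: frechet_derivative_works[symmetric])
    show "Ck_on k S (\<lambda>x. B (f x) (dif g x v) + B (dif f x v) (g x))" for v
      using Suc.prems Ck_on_SucD[OF Suc.prems(1)] Ck_on_SucD[OF Suc.prems(2)]
      by (intro Ck_on_add Suc.IH assms) auto
  qed
qed

lemma Ck_on_id: "open S \<Longrightarrow> Ck_on k S (\<lambda>x. x)"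
proof (cases k)
  case 0
  then show ?thesis by simp
next
  case (Suc l)
  assume "open S"
  then show ?thesis
    unfolding Suc by (rule Ck_on_SucI[where f' = "\<lambda>x v. v"]) (auto intro: Ck_on_const)
qed

lemma euclidean_expansion_linear:
  fixes L :: "'a::euclidean_space \<Rightarrow> 'b::real_vector"
  assumes "linear L"
  shows "L v = (\<Sum>b\<in>Basis. (v \<bullet> b) *\<^sub>R L b)"
proof -
  have "L v = L (\<Sum>b\<in>Basis. (v \<bullet> b) *\<^sub>R b)"
    by (simp add: euclidean_representation)
  then show ?thesis
    by (simp add: linear_sum[OF assms] linear_scale[OF assms])
qed

lemma linear_dif: "f differentiable (at x) \<Longrightarrow> linear (dif f x)"
  using frechet_derivative_works has_derivative_linear by blast

text \<open>In the chain rule the direction \<open>dif f x v\<close> moves with \<open>x\<close>,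
  while \<open>Ck_on\<close> speaks of fixed directions only. Expanding it in a basis, possible as
  the middle space is Euclidean, leaves fixed directions with coefficients that depend on
  \<open>x\<close>.\<close>

lemma Ck_on_compose:
  fixes g :: "'b::euclidean_space \<Rightarrow> 'c::real_normed_vector"
  assumes "open S" "open T" "f ` S \<subseteq> T"
  shows "Ck_on k T g \<Longrightarrow> Ck_on k S f \<Longrightarrow> Ck_on k S (\<lambda>x. g (f x))"
proof (induction k arbitrary: g)
  case 0
  then have "continuous_on T g" "continuous_on S f"
    by simp_all
  then show ?case
    using assms(3) by (simp add: continuous_on_compose2)
next
  case (Suc k)
  have f: "Ck_on k S f" "f differentiable (at x)" "Ck_on k S (\<lambda>x. dif f x v)" if "x \<in> S" for x v
    using Ck_on_SucD[OF Suc.prems(2)] Suc.prems(2) that by simp_all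
  have g: "g differentiable (at (f x))" if "x \<in> S" for x
    using Suc.prems(1) that assms(3) by auto
  show ?case
  proof (rule Ck_on_SucI[OF assms(1)])
    fix x assume x: "x \<in> S"
    have "((\<lambda>x. g (f x)) has_derivative (\<lambda>v. dif g (f x) (dif f x v))) (at x)"
      by (rule has_derivative_compose[OF f(2)[OF x, unfolded frechet_derivative_works]
            g[OF x, unfolded frechet_derivative_works]])
    moreover have "dif g (f x) (dif f x v) = (\<Sum>b\<in>Basis. (dif f x v \<bullet> b) *\<^sub>R dif g (f x) b)" for v
      by (rule euclidean_expansion_linear[OF linear_dif[OF g[OF x]]])
    ultimately show "((\<lambda>x. g (f x)) has_derivative
        (\<lambda>v. \<Sum>b\<in>Basis. (dif f x v \<bullet> b) *\<^sub>R dif g (f x) b)) (at x)"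
      by simp
  next
    fix v
    have "Ck_on k S (\<lambda>x. dif g (f x) b)" for b
      by (rule Suc.IH[of "\<lambda>y. dif g y b"]) (use Suc.prems(1) Ck_on_SucD[OF Suc.prems(2)] in simp_all)
    moreover have "Ck_on k S (\<lambda>x. dif f x v \<bullet> b)" for b
      by (rule Ck_on_bounded_bilinear[OF bounded_bilinear_inner assms(1) _ Ck_on_const])
        (use Suc.prems(2) in simp)
    ultimately show "Ck_on k S (\<lambda>x. \<Sum>b\<in>Basis. (dif f x v \<bullet> b) *\<^sub>R dif g (f x) b)"
      by (simp add: Ck_on_sum[OF assms(1)] Ck_on_bounded_bilinear[OF bounded_bilinear_scaleR assms(1)])
  qed
qed

text \<open>The derivative is a polynomial in \<open>inverse\<close> itself, so the induction
  hypothesis covers it. For \<open>sqrt\<close> below, the derivative is a multiple of the inverse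
  of \<open>sqrt\<close>.\<close>

lemma Ck_on_inverse: "Ck_on k (- {0}) (inverse :: real \<Rightarrow> real)"
proof (induction k)
  case 0
  then show ?case by (auto intro: continuous_intros)
next
  case (Suc k)
  show ?case
  proof (rule Ck_on_SucI)
    show "(inverse has_derivative (\<lambda>v. - (inverse x * v * inverse x))) (at x)" if "x \<in> - {0}" for x::real
      by (rule has_derivative_inverse') (use that in auto)
    have "Ck_on k (- {0}) (\<lambda>x::real. (inverse x * inverse x) *\<^sub>R (-v))" for v :: real
      by (intro Ck_on_bounded_bilinear[OF bounded_bilinear_scaleR]
          Ck_on_bounded_bilinear[OF bounded_bilinear_mult] Ck_on_const Suc) auto
    moreover have "(\<lambda>x. (inverse x * inverse x) *\<^sub>R (-v)) = (\<lambda>x. - (inverse x * v * inverse x))" for v :: real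
      by (simp add: fun_eq_iff)
    ultimately show "Ck_on k (- {0}) (\<lambda>x. - (inverse x * v * inverse x))" for v :: real
      by metis
  qed auto
qed

lemma Ck_on_sqrt: "Ck_on k {0<..} sqrt"
proof (induction k)
  case 0
  then show ?case by (auto intro: continuous_intros)
next
  case (Suc k)
  show ?case
  proof (rule Ck_on_SucI)
    show "(sqrt has_derivative (\<lambda>v. inverse (sqrt x) * (v / 2))) (at x)" if "x \<in> {0<..}" for x::real
      using that DERIV_real_sqrt[of x]
      by (auto simp: has_field_derivative_def field_simps elim!: has_derivative_eq_rhs)
    show "Ck_on k {0<..} (\<lambda>x. inverse (sqrt x) * (v / 2))" for v :: real
      by (rule Ck_on_bounded_bilinear[OF bounded_bilinear_mult _ Ck_on_compose[OF _ _ _ Ck_on_inverse Suc] Ck_on_const])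
        auto
  qed auto
qed

section \<open>Closure properties of smooth maps\<close>

named_theorems smooth_intros

lemma smooth_on_const[smooth_intros]: "smooth_on S (\<lambda>x. c)"
  by (simp add: smooth_on_def Ck_on_const)

lemma smooth_on_id[smooth_intros]: "open S \<Longrightarrow> smooth_on S (\<lambda>x. x)"
  by (simp add: smooth_on_def Ck_on_id)

lemma smooth_on_add[smooth_intros]:
  "smooth_on S f \<Longrightarrow> smooth_on S g \<Longrightarrow> open S \<Longrightarrow> smooth_on S (\<lambda>x. f x + g x)"
  by (simp add: smooth_on_def Ck_on_add)

lemma smooth_on_sum[smooth_intros]:
  "(\<And>i. i \<in> I \<Longrightarrow> smooth_on S (f i)) \<Longrightarrow> open S \<Longrightarrow> smooth_on S (\<lambda>x. \<Sum>i\<in>I. f i x)"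
  by (simp add: smooth_on_def Ck_on_sum)

lemma smooth_on_bounded_linear:
  "bounded_linear L \<Longrightarrow> smooth_on S f \<Longrightarrow> open S \<Longrightarrow> smooth_on S (\<lambda>x. L (f x))"
  by (simp add: smooth_on_def Ck_on_bounded_linear)

lemma smooth_on_bounded_bilinear:
  "bounded_bilinear B \<Longrightarrow> smooth_on S f \<Longrightarrow> smooth_on S g \<Longrightarrow> open S \<Longrightarrow> smooth_on S (\<lambda>x. B (f x) (g x))"
  by (simp add: smooth_on_def Ck_on_bounded_bilinear)

lemmas smooth_on_scaleR[smooth_intros] = smooth_on_bounded_bilinear[OF bounded_bilinear_scaleR]
lemmas smooth_on_mult[smooth_intros] =
  smooth_on_bounded_bilinear[OF bounded_bilinear_mult]
lemmas smooth_on_inner[smooth_intros] = smooth_on_bounded_bilinear[OF bounded_bilinear_inner]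
lemmas smooth_on_minus[smooth_intros] =
  smooth_on_bounded_linear[OF bounded_linear_minus[OF bounded_linear_ident]]
lemmas smooth_on_vec_nth[smooth_intros] = smooth_on_bounded_linear[OF bounded_linear_vec_nth]

lemma smooth_on_diff[smooth_intros]:
  "smooth_on S f \<Longrightarrow> smooth_on S g \<Longrightarrow> open S \<Longrightarrow> smooth_on S (\<lambda>x. f x - g x)"
  using smooth_on_add[OF _ smooth_on_minus, of S f g] by simp

lemma smooth_on_prod[smooth_intros]:
  fixes f :: "'i \<Rightarrow> 'a::real_normed_vector \<Rightarrow> real"
  shows "(\<And>i. i \<in> I \<Longrightarrow> smooth_on S (f i)) \<Longrightarrow> open S \<Longrightarrow> smooth_on S (\<lambda>x. \<Prod>i\<in>I. f i x)"
  by (induction I rule: infinite_finite_induct) (auto intro: smooth_intros)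

lemma smooth_on_compose:
  fixes g :: "'b::euclidean_space \<Rightarrow> 'c::real_normed_vector"
  shows "smooth_on T g \<Longrightarrow> smooth_on S f \<Longrightarrow> open S \<Longrightarrow> open T \<Longrightarrow> f ` S \<subseteq> T \<Longrightarrow> smooth_on S (\<lambda>x. g (f x))"
  by (simp add: smooth_on_def Ck_on_compose)

lemma smooth_on_divide[smooth_intros]:
  fixes f g :: "'a::real_normed_vector \<Rightarrow> real"
  assumes "smooth_on S f" "smooth_on S g" "open S" "\<And>x. x \<in> S \<Longrightarrow> g x \<noteq> 0"
  shows "smooth_on S (\<lambda>x. f x / g x)"
proof -
  have "smooth_on (- {0}) (inverse :: real \<Rightarrow> real)"
    by (simp add: smooth_on_def Ck_on_inverse)
  then have "smooth_on S (\<lambda>x. inverse (g x))"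
    by (rule smooth_on_compose) (use assms in auto)
  then show ?thesis
    unfolding divide_inverse by (rule smooth_on_mult[OF assms(1) _ assms(3)])
qed

lemma smooth_on_sqrt[smooth_intros]:
  assumes "smooth_on S f" "open S" "\<And>x. x \<in> S \<Longrightarrow> f x > 0"
  shows "smooth_on S (\<lambda>x. sqrt (f x))"
  by (rule smooth_on_compose[where g = sqrt and T = "{0<..}"])
    (use assms in \<open>auto simp: smooth_on_def Ck_on_sqrt\<close>)

lemma smooth_on_subset: "smooth_on S f \<Longrightarrow> T \<subseteq> S \<Longrightarrow> smooth_on T f"
  unfolding smooth_on_def using Ck_on_subset by blast

lemma smooth_on_cong:
  "smooth_on S f \<Longrightarrow> open S \<Longrightarrow> (\<And>x. x \<in> S \<Longrightarrow> f x = g x) \<Longrightarrow> smooth_on S g"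
  unfolding smooth_on_def using Ck_on_cong by metis

lemma smooth_on_local:
  "(\<And>x. x \<in> S \<Longrightarrow> \<exists>T. open T \<and> x \<in> T \<and> smooth_on T f) \<Longrightarrow> smooth_on S f"
  unfolding smooth_on_def using Ck_on_local by metis

lemma smooth_on_dif[smooth_intros]: "smooth_on S f \<Longrightarrow> smooth_on S (\<lambda>x. dif f x v)"
  unfolding smooth_on_def by (metis Ck_on.simps(2))

lemma smooth_on_differentiable: "smooth_on S f \<Longrightarrow> x \<in> S \<Longrightarrow> f differentiable (at x)"
  unfolding smooth_on_def by (metis Ck_on.simps(2))

lemma smooth_on_has_derivative: "smooth_on S f \<Longrightarrow> x \<in> S \<Longrightarrow> (f has_derivative dif f x) (at x)"
  using smooth_on_differentiable frechet_derivative_works by blast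

lemma smooth_on_continuous_on: "smooth_on S f \<Longrightarrow> continuous_on S f"
  unfolding smooth_on_def by (metis Ck_on.simps(1))

lemma smooth_on_linear_dif: "smooth_on S f \<Longrightarrow> x \<in> S \<Longrightarrow> linear (dif f x)"
  by (intro linear_dif smooth_on_differentiable)

lemma bounded_linear_axis: "bounded_linear (axis i :: 'a::real_normed_vector \<Rightarrow> 'a^'n::finite)"
proof
  show "axis i (x + y) = axis i x + (axis i y :: 'a^'n)" for x y :: 'a
    by (simp add: vec_eq_iff axis_def)
  show "axis i (r *\<^sub>R x) = r *\<^sub>R (axis i x :: 'a^'n)" for r and x :: 'a
    by (simp add: vec_eq_iff axis_def)
  show "\<exists>K. \<forall>x. norm (axis i x :: 'a^'n) \<le> norm x * K"
  proof (intro exI[of _ 1] allI)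
    fix x :: 'a
    have "norm (axis i x :: 'a^'n) \<le> (\<Sum>j\<in>UNIV. norm ((axis i x :: 'a^'n) $ j))"
      unfolding norm_vec_def by (rule L2_set_le_sum) simp
    also have "\<dots> = norm x"
      by (simp add: axis_def if_distrib cong: if_cong)
    finally show "norm (axis i x :: 'a^'n) \<le> norm x * 1" by simp
  qed
qed

lemma vec_lambda_sum_axis: "(\<chi> i. f i) = (\<Sum>i\<in>UNIV. axis i (f i :: 'a::real_normed_vector))"
  by (simp add: vec_eq_iff axis_def if_distrib cong: if_cong)

lemma smooth_on_vec_lambda[smooth_intros]:
  "(\<And>i. smooth_on S (\<lambda>x. f x i)) \<Longrightarrow> open S \<Longrightarrow> smooth_on S (\<lambda>x. \<chi> i. f x i)"
  unfolding vec_lambda_sum_axis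
  by (intro smooth_on_sum smooth_on_bounded_linear[OF bounded_linear_axis])

lemma smooth_on_vecI:
  "(\<And>i. smooth_on S (\<lambda>x. f x $ i)) \<Longrightarrow> open S \<Longrightarrow> smooth_on S f"
  using smooth_on_vec_lambda[of S "\<lambda>x i. f x $ i"] by simp

lemma smooth_on_det[smooth_intros]:
  fixes f :: "'a::real_normed_vector \<Rightarrow> real^'n^'n"
  shows "smooth_on S f \<Longrightarrow> open S \<Longrightarrow> smooth_on S (\<lambda>x. det (f x))"
  unfolding det_def by (intro smooth_intros)

lemma smooth_on_pd[smooth_intros]: "smooth_on S f \<Longrightarrow> smooth_on S (pd i f)"
  unfolding pd_def[abs_def] by (intro smooth_intros)

text \<open>For solutions of differential equations: a derivative that is expressed through
  \<open>f\<close> and smooth data is as regular as \<open>f\<close>, so \<open>f\<close> gains one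
  order at each step.\<close>

lemma smooth_on_bootstrap:
  assumes "open S" "\<And>x. x \<in> S \<Longrightarrow> (f has_derivative f' x) (at x)"
    "\<And>k v. Ck_on k S f \<Longrightarrow> Ck_on k S (\<lambda>x. f' x v)"
  shows "smooth_on S f"
  unfolding smooth_on_def
proof
  fix k show "Ck_on k S f"
  proof (induction k)
    case 0
    have "f differentiable_on S"
      using assms(2) differentiable_on_def differentiable_def differentiable_at_withinI by blast
    then show ?case
      by (simp add: differentiable_imp_continuous_on)
  next
    case (Suc k)
    show ?case
      by (rule Ck_on_SucI[OF assms(1,2)]) (use assms(3) Suc in auto)
  qed
qed

lemma has_vector_derivative_line:
  assumes "f differentiable (at (p + t *\<^sub>R u))"
  shows "((\<lambda>t. f (p + t *\<^sub>R u)) has_vector_derivative dif f (p + t *\<^sub>R u) u) (at t within T)"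
proof -
  have "((\<lambda>t. f (p + t *\<^sub>R u)) has_derivative (\<lambda>s. dif f (p + t *\<^sub>R u) (s *\<^sub>R u))) (at t within T)"
    by (rule has_derivative_compose[where f = "\<lambda>t. p + t *\<^sub>R u" and g = f])
      (use assms in \<open>auto intro!: derivative_eq_intros simp: frechet_derivative_works\<close>)
  then show ?thesis
    unfolding has_vector_derivative_def
    by (simp add: linear_scale[OF linear_dif[OF assms]])
qed

section \<open>Rules for computing derivatives\<close>

lemma dif_bounded_linear:
  "bounded_linear L \<Longrightarrow> f differentiable (at x) \<Longrightarrow> dif (\<lambda>y. L (f y)) x v = L (dif f x v)"
  by (subst dif_eq[OF bounded_linear.has_derivative[of L f "dif f x"]]) (auto simp: frechet_derivative_works)

lemma dif_bounded_bilinear: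
  assumes "bounded_bilinear B" "f differentiable (at x)" "g differentiable (at x)"
  shows "dif (\<lambda>y. B (f y) (g y)) x v = B (f x) (dif g x v) + B (dif f x v) (g x)"
  by (subst dif_eq[OF bounded_bilinear.FDERIV[OF assms(1), of f "dif f x" _ _ g "dif g x"]])
    (use assms in \<open>auto simp: frechet_derivative_works\<close>)

lemma dif_compose:
  assumes "f differentiable (at x)" "g differentiable (at (f x))"
  shows "dif (\<lambda>y. g (f y)) x v = dif g (f x) (dif f x v)"
  by (subst dif_eq[OF has_derivative_compose[of f "dif f x" _ _ g "dif g (f x)"]])
    (use assms in \<open>auto simp: frechet_derivative_works\<close>)

lemmas dif_inner = dif_bounded_bilinear[OF bounded_bilinear_inner]
lemmas dif_mult = dif_bounded_bilinear[OF bounded_bilinear_mult]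
lemmas dif_scaleR = dif_bounded_bilinear[OF bounded_bilinear_scaleR]
lemmas dif_vec_nth = dif_bounded_linear[OF bounded_linear_vec_nth]

lemma dif_inner_const:
  "f differentiable (at x) \<Longrightarrow> dif (\<lambda>y. f y \<bullet> c) x v = dif f x v \<bullet> c"
  by (rule dif_bounded_linear[OF bounded_linear_inner_left])

section \<open>Symmetry of second derivatives\<close>

lemma second_difference_quotient:
  fixes f :: "'a::real_normed_vector \<Rightarrow> real"
  assumes S: "open S" "smooth_on S f" "x \<in> S" and "e > 0"
  shows "\<exists>d>0. \<forall>s. 0 < s \<and> s < d \<longrightarrow>
    \<bar>(f (x + s *\<^sub>R u + s *\<^sub>R w) - f (x + s *\<^sub>R u) - f (x + s *\<^sub>R w) + f x) / (s * s)
      - dif (\<lambda>y. dif f y u) x w\<bar> < e"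
proof -
  define H where "H = (\<lambda>z. dif (\<lambda>y. dif f y u) z w)"
  have sm: "smooth_on S (\<lambda>y. dif f y u)" "smooth_on S H"
    unfolding H_def using S by (auto intro!: smooth_intros)
  have "isCont H x"
    using smooth_on_continuous_on[OF sm(2)] S continuous_on_eq_continuous_at by blast
  then obtain r1 where r1: "r1 > 0" "\<And>y. dist y x < r1 \<Longrightarrow> dist (H y) (H x) < e"
    using \<open>e > 0\<close> unfolding continuous_at_eps_delta by metis
  obtain r2 where r2: "r2 > 0" "ball x r2 \<subseteq> S"
    using S openE by blast
  define r where "r = min r1 r2"
  \<comment> \<open>For \<open>a\<close>, \<open>c\<close> at most \<open>s < d\<close> the point
    \<open>x + a *\<^sub>R u + c *\<^sub>R w\<close> stays within \<open>r\<close> of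
    \<open>x\<close>; the added 1 keeps the denominator positive if both directions vanish.\<close>
  define d where "d = r / (norm u + norm w + 1)"
  have pos: "norm u + norm w + 1 > 0" by (smt (verit) norm_ge_zero)
  have d: "d > 0" using r1 r2 pos by (simp add: d_def r_def)
  have near: "dist (x + a *\<^sub>R u + c *\<^sub>R w) x < r" if "0 \<le> a" "a \<le> s" "0 \<le> c" "c \<le> s" "s < d" for a c s
  proof -
    have "dist (x + a *\<^sub>R u + c *\<^sub>R w) x = norm (a *\<^sub>R u + c *\<^sub>R w)"
      by (simp add: dist_norm algebra_simps)
    also have "\<dots> \<le> norm (a *\<^sub>R u) + norm (c *\<^sub>R w)"
      by (rule norm_triangle_ineq)
    also have "\<dots> = a * norm u + c * norm w"
      using that by simp
    also have "\<dots> \<le> s * norm u + s * norm w"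
      using that by (intro add_mono mult_right_mono) auto
    also have "\<dots> \<le> s * (norm u + norm w + 1)"
      using that by (simp add: algebra_simps)
    also have "\<dots> < d * (norm u + norm w + 1)"
      using that pos by (intro mult_strict_right_mono) auto
    also have "\<dots> = r"
      using pos by (simp add: d_def)
    finally show ?thesis .
  qed
  have inS: "x + a *\<^sub>R u + c *\<^sub>R w \<in> S" if "0 \<le> a" "a \<le> s" "0 \<le> c" "c \<le> s" "s < d" for a c s
    using near[OF that] r2 by (auto simp: r_def dist_commute)
  show ?thesis
  proof (intro exI conjI allI impI)
    show "d > 0" by fact
    fix s assume s: "0 < s \<and> s < d"
    \<comment> \<open>The second difference is the increment of \<phi> over [0, s]. The mean value
      theorem along \<open>u\<close> and then, for \<psi> below, along \<open>w\<close> turns it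
      into \<open>s * s\<close> times the mixed derivative at one nearby point.\<close>
    define \<phi> where "\<phi> = (\<lambda>a. f ((x + s *\<^sub>R w) + a *\<^sub>R u) - f (x + a *\<^sub>R u))"
    define \<phi>' where "\<phi>' = (\<lambda>a. dif f ((x + s *\<^sub>R w) + a *\<^sub>R u) u - dif f (x + a *\<^sub>R u) u)"
    have der: "(\<phi> has_real_derivative \<phi>' a) (at a)" if "0 \<le> a" "a \<le> s" for a
    proof -
      have "f differentiable (at ((x + s *\<^sub>R w) + a *\<^sub>R u))" "f differentiable (at (x + a *\<^sub>R u))"
        using inS[of a s s] inS[of a s 0] that s
        by (auto intro!: smooth_on_differentiable[OF S(2)] simp: algebra_simps)
      from has_vector_derivative_diff[OF this[THEN has_vector_derivative_line]]
      show ?thesis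
        unfolding \<phi>_def \<phi>'_def has_real_derivative_iff_has_vector_derivative .
    qed
    obtain a where a: "0 < a" "a < s" "\<phi> s - \<phi> 0 = (s - 0) * \<phi>' a"
      using MVT2[of 0 s \<phi> \<phi>'] der s by auto
    define \<psi> where "\<psi> = (\<lambda>c. dif f ((x + a *\<^sub>R u) + c *\<^sub>R w) u)"
    have der2: "(\<psi> has_real_derivative H ((x + a *\<^sub>R u) + c *\<^sub>R w)) (at c)" if "0 \<le> c" "c \<le> s" for c
    proof -
      have "(\<lambda>y. dif f y u) differentiable (at ((x + a *\<^sub>R u) + c *\<^sub>R w))"
        using inS[of a s c] that s a by (auto intro!: smooth_on_differentiable[OF sm(1)])
      from has_vector_derivative_line[OF this]
      show ?thesis
        unfolding \<psi>_def H_def has_real_derivative_iff_has_vector_derivative .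
    qed
    obtain c where c: "0 < c" "c < s" "\<psi> s - \<psi> 0 = (s - 0) * H ((x + a *\<^sub>R u) + c *\<^sub>R w)"
      using MVT2[of 0 s \<psi> "\<lambda>c. H ((x + a *\<^sub>R u) + c *\<^sub>R w)"] der2 s by auto
    have "\<phi>' a = \<psi> s - \<psi> 0"
      by (simp add: \<phi>'_def \<psi>_def algebra_simps)
    then have "f (x + s *\<^sub>R u + s *\<^sub>R w) - f (x + s *\<^sub>R u) - f (x + s *\<^sub>R w) + f x
        = s * s * H (x + a *\<^sub>R u + c *\<^sub>R w)"
      using a(3) c(3) by (simp add: \<phi>_def algebra_simps)
    moreover have "\<bar>H (x + a *\<^sub>R u + c *\<^sub>R w) - H x\<bar> < e"
      using r1(2)[of "x + a *\<^sub>R u + c *\<^sub>R w"] near[of a s c] a c s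
      by (auto simp: dist_real_def r_def)
    ultimately show "\<bar>(f (x + s *\<^sub>R u + s *\<^sub>R w) - f (x + s *\<^sub>R u) - f (x + s *\<^sub>R w) + f x) / (s * s)
      - dif (\<lambda>y. dif f y u) x w\<bar> < e"
      using s unfolding H_def by simp
  qed
qed

lemma second_dif_commute_real:
  fixes f :: "'a::real_normed_vector \<Rightarrow> real"
  assumes S: "open S" "smooth_on S f" "x \<in> S"
  shows "dif (\<lambda>y. dif f y u) x w = dif (\<lambda>y. dif f y w) x u"
proof (rule ccontr)
  \<comment> \<open>Half the discrepancy: the second difference is symmetric in \<open>u\<close> and
    \<open>w\<close>, so one and the same quotient would lie within \<open>e\<close> of both
    values.\<close>
  define e where "e = \<bar>dif (\<lambda>y. dif f y u) x w - dif (\<lambda>y. dif f y w) x u\<bar> / 2"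
  assume "dif (\<lambda>y. dif f y u) x w \<noteq> dif (\<lambda>y. dif f y w) x u"
  then have e: "e > 0" by (simp add: e_def)
  obtain d1 where d1: "d1 > 0" "\<And>s. 0 < s \<Longrightarrow> s < d1 \<Longrightarrow>
    \<bar>(f (x + s *\<^sub>R u + s *\<^sub>R w) - f (x + s *\<^sub>R u) - f (x + s *\<^sub>R w) + f x) / (s * s)
      - dif (\<lambda>y. dif f y u) x w\<bar> < e"
    using second_difference_quotient[OF S e, of u w] by blast
  obtain d2 where d2: "d2 > 0" "\<And>s. 0 < s \<Longrightarrow> s < d2 \<Longrightarrow>
    \<bar>(f (x + s *\<^sub>R w + s *\<^sub>R u) - f (x + s *\<^sub>R w) - f (x + s *\<^sub>R u) + f x) / (s * s)
      - dif (\<lambda>y. dif f y w) x u\<bar> < e"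
    using second_difference_quotient[OF S e, of w u] by blast
  define s where "s = min d1 d2 / 2"
  have s: "0 < s" "s < d1" "s < d2" using d1 d2 by (auto simp: s_def)
  have "f (x + s *\<^sub>R w + s *\<^sub>R u) - f (x + s *\<^sub>R w) - f (x + s *\<^sub>R u) + f x
    = f (x + s *\<^sub>R u + s *\<^sub>R w) - f (x + s *\<^sub>R u) - f (x + s *\<^sub>R w) + f x"
    by (simp add: algebra_simps)
  then obtain q where "\<bar>q - dif (\<lambda>y. dif f y u) x w\<bar> < e" "\<bar>q - dif (\<lambda>y. dif f y w) x u\<bar> < e"
    using d1(2)[OF s(1,2)] d2(2)[OF s(1,3)] by metis
  then have "\<bar>dif (\<lambda>y. dif f y u) x w - dif (\<lambda>y. dif f y w) x u\<bar> < 2 * e"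
    by arith
  then show False
    by (simp add: e_def)
qed

lemma second_dif_commute:
  fixes f :: "'a::real_normed_vector \<Rightarrow> 'b::euclidean_space"
  assumes S: "open S" "smooth_on S f" "x \<in> S"
  shows "dif (\<lambda>y. dif f y u) x w = dif (\<lambda>y. dif f y w) x u"
proof (rule euclidean_eqI)
  fix b :: 'b assume "b \<in> Basis"
  have *: "dif (\<lambda>y. dif f y u) x w \<bullet> b = dif (\<lambda>y. dif (\<lambda>z. f z \<bullet> b) y u) x w" for u w
  proof -
    have "dif (\<lambda>y. dif (\<lambda>z. f z \<bullet> b) y u) x = dif (\<lambda>y. dif f y u \<bullet> b) x"
      by (rule dif_cong_open[OF S(1,3)], rule dif_inner_const, rule smooth_on_differentiable[OF S(2)])
    moreover have "dif (\<lambda>y. dif f y u \<bullet> b) x w = dif (\<lambda>y. dif f y u) x w \<bullet> b"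
      by (rule dif_inner_const, rule smooth_on_differentiable[OF smooth_on_dif[OF S(2)] S(3)])
    ultimately show ?thesis by simp
  qed
  show "dif (\<lambda>y. dif f y u) x w \<bullet> b = dif (\<lambda>y. dif f y w) x u \<bullet> b"
    unfolding * by (rule second_dif_commute_real[OF S(1) _ S(3)])
      (intro smooth_on_inner smooth_on_const S)
qed



text \<open>The inverse function theorem provides an inverse whose derivative is the inverse of
  \<open>dif f (g y)\<close>. Cramer's rule writes this as a smooth function of \<open>g y\<close>,
  so that \<open>smooth_on_bootstrap\<close> applies.\<close>

lemma smooth_inverse_function:
  fixes f :: "real^'n \<Rightarrow> real^'n"
  assumes U: "open U" "smooth_on U f" "x0 \<in> U" and inj: "inj (dif f x0)"
  obtains U' V g where "open U'" "U' \<subseteq> U" "x0 \<in> U'" "open V" "homeomorphism U' V f g" "smooth_on V g"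
    "\<And>x. x \<in> U' \<Longrightarrow> inj (dif f x)"
proof -
  define f' where "f' = (\<lambda>x. Blinfun (dif f x))"
  have f': "blinfun_apply (f' x) = dif f x" if "x \<in> U" for x
    unfolding f'_def using bounded_linear_Blinfun_apply
      has_derivative_bounded_linear[OF smooth_on_has_derivative[OF U(2) that]] by blast
  obtain L where L: "linear L" "L \<circ> dif f x0 = id"
    using linear_injective_left_inverse[OF smooth_on_linear_dif[OF U(2,3)] inj] by blast
  have "continuous_on U f'"
  proof (rule continuous_on_blinfun_componentwise)
    fix i :: "real^'n"
    show "continuous_on U (\<lambda>x. blinfun_apply (f' x) i)"
      using smooth_on_continuous_on[OF smooth_on_dif[OF U(2)], of i] f' by simp
  qed
  moreover have "Blinfun L o\<^sub>L f' x0 = id_blinfun"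
    using L f'[OF U(3)]
    by (intro blinfun_eqI) (simp add: bounded_linear_Blinfun_apply linear_conv_bounded_linear o_def fun_eq_iff)
  moreover have "(f has_derivative blinfun_apply (f' x)) (at x)" if "x \<in> U" for x
    using smooth_on_has_derivative[OF U(2) that] f'[OF that] by simp
  ultimately obtain U' V g g' where *: "open U'" "U' \<subseteq> U" "x0 \<in> U'" "open V" "homeomorphism U' V f g"
    and g: "\<And>y. y \<in> V \<Longrightarrow> (g has_derivative (g' y)) (at y)"
      "\<And>y. y \<in> V \<Longrightarrow> g' y = inv (blinfun_apply (f'(g y)))"
      "\<And>y. y \<in> V \<Longrightarrow> bij (blinfun_apply (f'(g y)))"
    using inverse_function_theorem[OF U(1) _ _ U(3)] by metis
  define J where "J = (\<lambda>x. \<chi> i j. dif f x (axis j 1) $ i)"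
  have J: "J x = matrix (dif f x)" for x
    by (simp add: J_def matrix_def)
  have smJ: "smooth_on U (\<lambda>x. J x $ i $ j)" for i j
    using U unfolding J_def by (auto intro!: smooth_on_vec_nth smooth_on_dif)
  define T where "T = {x \<in> U. det (J x) \<noteq> 0}"
  have smdet: "smooth_on U (\<lambda>x. det (J x))"
    using smJ U by (intro smooth_on_det smooth_on_vecI)
  have "open T"
  proof -
    have "T = U \<inter> (\<lambda>x. det (J x)) -` (- {0})"
      by (auto simp: T_def)
    then show ?thesis
      using continuous_open_preimage[OF smooth_on_continuous_on[OF smdet] U(1), of "- {0}"] by (simp add: open_Compl)
  qed
  \<comment> \<open>Cramer's solution \<open>k\<close> of \<open>J x *v k = v\<close>, smooth where
    the determinant does not vanish.\<close>
  define h where "h = (\<lambda>v x. \<chi> k. det (\<chi> i j. if j = k then v $ i else J x $ i $ j) / det (J x))"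
  have smh: "smooth_on T (h v)" for v
  proof -
    have "smooth_on T (\<lambda>x. (if j = k then v $ i else J x $ i $ j))" for i j k
      using smooth_on_subset[OF smJ, of T] by (cases "j = k") (auto simp: T_def smooth_on_const)
    then have "smooth_on T (\<lambda>x. det (\<chi> i j. if j = k then v $ i else J x $ i $ j))" for k
      using \<open>open T\<close> by (intro smooth_on_det smooth_on_vec_lambda)
    moreover have "smooth_on T (\<lambda>x. det (J x))"
      using smooth_on_subset[OF smdet, of T] by (auto simp: T_def)
    ultimately show ?thesis
      unfolding h_def using \<open>open T\<close>
      by (intro smooth_on_vec_lambda[where f = "\<lambda>x k. det (F k x) / D x" for F D] smooth_on_divide)
        (auto simp: T_def)
  qed
  have gV: "g ` V = U'" "\<And>y. y \<in> V \<Longrightarrow> g y \<in> U'"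
    using *(5) by (auto simp: homeomorphism_def)
  have gT: "g y \<in> T" if "y \<in> V" for y
  proof -
    have gU: "g y \<in> U" using gV(2)[OF that] *(2) by auto
    then have "inj (dif f (g y))"
      using g(3)[OF that] f'[OF gU] by (simp add: bij_def)
    then show ?thesis
      using gU by (simp add: T_def J det_nz_iff_inj smooth_on_linear_dif[OF U(2) gU])
  qed
  have h: "g' y v = h v (g y)" if "y \<in> V" for y v
  proof -
    have lin: "linear (dif f (g y))"
      using gV(2)[OF that] *(2) U(2) by (auto intro: smooth_on_linear_dif)
    have "dif f (g y) (g' y v) = v"
      using g(2,3)[OF that] f'[of "g y"] gV(2)[OF that] *(2) by (auto simp: bij_def surj_f_inv_f)
    then have "J (g y) *v g' y v = v"
      by (simp add: J matrix_works lin)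
    then show ?thesis
      using gT[OF that] cramer[of "J (g y)"] by (auto simp: T_def h_def)
  qed
  have "smooth_on V g"
  proof (rule smooth_on_bootstrap[OF *(4)])
    show "(g has_derivative (\<lambda>v. h v (g y))) (at y)" if "y \<in> V" for y
      using g(1)[OF that] h[OF that] by (metis (no_types, lifting) ext)
    show "Ck_on k V (\<lambda>y. h v (g y))" if "Ck_on k V g" for k v
      by (rule Ck_on_compose[OF *(4) \<open>open T\<close> _ _ that])
        (use smh gT in \<open>auto simp: smooth_on_def\<close>)
  qed
  moreover have "inj (dif f x)" if x: "x \<in> U'" for x
  proof -
    obtain y where "y \<in> V" "x = g y" using gV(1) x by auto
    then show ?thesis using g(3)[of y] f'[of x] x *(2) by (auto simp: bij_def)
  qed
  ultimately show ?thesis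
    using that * by blast
qed

section \<open>Flat orthogonal connections\<close>

lemma bounded_bilinear_matrix_mult:
  "bounded_bilinear ((**) :: real^'n^'m \<Rightarrow> real^'p^'n \<Rightarrow> real^'p^'m)"
  unfolding bilinear_conv_bounded_bilinear[symmetric] bilinear_def
  by (auto simp: linear_iff matrix_add_ldistrib matrix_matrix_mult_def vec_eq_iff
      distrib_left distrib_right sum.distrib sum_distrib_left algebra_simps)

lemmas smooth_on_matrix_mult[smooth_intros] = smooth_on_bounded_bilinear[OF bounded_bilinear_matrix_mult]

lemma bounded_linear_transpose: "bounded_linear (transpose :: real^'n^'m \<Rightarrow> real^'m^'n)"
  unfolding linear_conv_bounded_linear[symmetric]
  by (auto simp: linear_iff transpose_def vec_eq_iff)

text \<open>The norm is the Frobenius norm; each entry of the product is an inner product of a row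
  and a column, to which Cauchy-Schwarz applies.\<close>

lemma norm_matrix_mult_le: "norm (A ** B) \<le> norm A * norm (B :: real^'p^'n)" for A :: "real^'n^'m"
proof -
  have sq: "(norm C)\<^sup>2 = (\<Sum>i\<in>UNIV. (norm (row i C))\<^sup>2)" for C :: "real^'a^'b"
    by (simp add: power2_norm_eq_inner inner_vec_def row_def)
  have sqt: "(norm C)\<^sup>2 = (\<Sum>i\<in>UNIV. (norm (column i C))\<^sup>2)" for C :: "real^'a^'b"
    by (simp add: power2_norm_eq_inner inner_vec_def column_def) (rule sum.swap)
  have entry: "(A ** B) $ i $ j = row i A \<bullet> column j B" for i j
    by (simp add: matrix_matrix_mult_def inner_vec_def row_def column_def)
  have "(norm (A ** B))\<^sup>2 = (\<Sum>i\<in>UNIV. \<Sum>j\<in>UNIV. (row i A \<bullet> column j B)\<^sup>2)"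
    unfolding entry[symmetric] power2_norm_eq_inner by (simp add: inner_vec_def power2_eq_square)
  also have "\<dots> \<le> (\<Sum>i\<in>UNIV. \<Sum>j\<in>UNIV. (norm (row i A))\<^sup>2 * (norm (column j B))\<^sup>2)"
    by (intro sum_mono) (metis Cauchy_Schwarz_ineq power2_norm_eq_inner)
  also have "\<dots> = (norm A * norm B)\<^sup>2"
    by (simp add: power_mult_distrib sq[of A] sqt[of B] sum_product)
  finally show ?thesis
    by (rule power2_le_imp_le) simp
qed

lemma norm_orthogonal_matrix:
  fixes Q :: "real^'n^'n"
  assumes "orthogonal_matrix Q"
  shows "norm Q = sqrt CARD('n)"
proof -
  have "norm (Q $ i) = 1" for i
    using assms unfolding orthogonal_matrix_orthonormal_rows by (simp add: row_def)
  then show ?thesis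
    by (simp add: norm_vec_def L2_set_def)
qed

text \<open>Picard iteration, written as a series: \<open>u n\<close> is the n-th correction, and
  its bound by a multiple of \<open>(C * t) ^ n / fact n\<close> gives convergence on the whole
  interval, however large the coefficient is.\<close>

lemma linear_ode_exists:
  fixes B :: "'e::euclidean_space \<Rightarrow> 'a::real_normed_vector \<Rightarrow> 'e"
  assumes B: "bounded_bilinear B" and a: "continuous_on {0..1} a"
  shows "\<exists>y. y 0 = y0 \<and> (\<forall>t\<in>{0..1}. (y has_vector_derivative B (y t) (a t)) (at t within {0..1::real}))"
proof -
  define u where "u = rec_nat (\<lambda>t::real. y0) (\<lambda>n v t. integral {0..t} (\<lambda>s. B (v s) (a s)))"
  have u0: "u 0 = (\<lambda>t. y0)" and uSuc: "u (Suc n) = (\<lambda>t. integral {0..t} (\<lambda>s. B (u n s) (a s)))" for n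
    by (simp_all add: u_def)
  have contB: "continuous_on {0..1} (\<lambda>s. B (f s) (a s))" if "continuous_on {0..1} f" for f
    by (rule bounded_bilinear.continuous_on[OF B that a])
  have cont: "continuous_on {0..1} (u n)" for n
  proof (induction n)
    case (Suc n)
    then show ?case
      unfolding uSuc by (intro indefinite_integral_continuous_1 integrable_continuous_real contB)
  qed (simp add: u0)
  have der: "(u (Suc n) has_vector_derivative B (u n t) (a t)) (at t within {0..1})" if "t \<in> {0..1}" for n t
    unfolding uSuc by (rule integral_has_vector_derivative[OF contB[OF cont] that])
  obtain K where K: "K > 0" "\<And>x y. norm (B x y) \<le> norm x * norm y * K"
    using bounded_bilinear.pos_bounded[OF B] by blast
  obtain A where A: "\<And>t. t \<in> {0..1} \<Longrightarrow> norm (a t) \<le> A"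
    using compact_continuous_image[OF a compact_Icc] compact_imp_bounded bounded_iff by (metis imageI)
  have A0: "A \<ge> 0" using order_trans[OF norm_ge_zero A[of 0]] by simp
  define C where "C = A * K"
  have C0: "C \<ge> 0" using A0 K by (simp add: C_def)
  have C: "norm (B x (a t)) \<le> C * norm x" if "t \<in> {0..1}" for x t
  proof -
    have "norm (B x (a t)) \<le> norm x * norm (a t) * K" by (rule K(2))
    also have "\<dots> \<le> norm x * A * K"
      using A[OF that] K(1) by (intro mult_right_mono mult_left_mono) auto
    finally show ?thesis by (simp add: C_def algebra_simps)
  qed
  have bound: "norm (u n t) \<le> norm y0 * (C * t) ^ n / fact n" if "t \<in> {0..1}" for n t
    using that
  proof (induction n arbitrary: t)
    case 0
    then show ?case by (simp add: u0)
  next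
    case (Suc n)
    have int: "((\<lambda>s. norm y0 * C * (C * s) ^ n / fact n) has_integral
        (norm y0 * (C * t) ^ Suc n / fact (Suc n) - norm y0 * (C * 0) ^ Suc n / fact (Suc n))) {0..t}"
    proof (rule fundamental_theorem_of_calculus)
      fix s
      have "((\<lambda>s. norm y0 * (C * s) ^ Suc n / fact (Suc n)) has_real_derivative
         norm y0 * (real (Suc n) * (C * s) ^ n * C) / fact (Suc n)) (at s within {0..t})"
        by (auto intro!: derivative_eq_intros simp del: power_Suc fact_Suc)
      also have "norm y0 * (real (Suc n) * (C * s) ^ n * C) / fact (Suc n) = norm y0 * C * (C * s) ^ n / fact n"
        by (simp add: field_simps del: of_nat_Suc)
      finally show "((\<lambda>s. norm y0 * (C * s) ^ Suc n / fact (Suc n)) has_vector_derivative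
         norm y0 * C * (C * s) ^ n / fact n) (at s within {0..t})"
        by (simp add: has_real_derivative_iff_has_vector_derivative)
    qed (use Suc.prems in auto)
    have "norm (u (Suc n) t) \<le> integral {0..t} (\<lambda>s. norm y0 * C * (C * s) ^ n / fact n)"
      unfolding uSuc
    proof (rule integral_norm_bound_integral)
      show "(\<lambda>s. B (u n s) (a s)) integrable_on {0..t}"
        using Suc.prems by (intro integrable_continuous_real continuous_on_subset[OF contB[OF cont]]) auto
      show "(\<lambda>s. norm y0 * C * (C * s) ^ n / fact n) integrable_on {0..t}"
        using int by blast
      fix s assume s: "s \<in> {0..t}"
      then have s1: "s \<in> {0..1}" using Suc.prems by auto
      have "norm (B (u n s) (a s)) \<le> C * norm (u n s)" by (rule C[OF s1])
      also have "\<dots> \<le> C * (norm y0 * (C * s) ^ n / fact n)"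
        by (rule mult_left_mono[OF Suc.IH[OF s1] C0])
      finally show "norm (B (u n s) (a s)) \<le> norm y0 * C * (C * s) ^ n / fact n"
        by (simp add: algebra_simps)
    qed
    then show ?case
      using integral_unique[OF int] by simp
  qed
  define M where "M = (\<lambda>n. norm y0 * (C ^ n / fact n))"
  have boundM: "norm (u n t) \<le> M n" if "t \<in> {0..1}" for n t
  proof -
    have "norm (u n t) \<le> norm y0 * (C * t) ^ n / fact n" by (rule bound[OF that])
    also have "\<dots> \<le> norm y0 * (C * 1) ^ n / fact n"
      using that C0 by (intro divide_right_mono mult_left_mono power_mono) auto
    finally show ?thesis by (simp add: M_def)
  qed
  have "summable M"
    unfolding M_def using summable_exp[of C] by (intro summable_mult) (simp add: divide_inverse mult.commute)
  define Y where "Y = (\<lambda>t. \<Sum>n. u n t)"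
  have unif: "uniform_limit {0..1} (\<lambda>n t. \<Sum>i<n. u i t) Y sequentially"
    unfolding Y_def by (rule Weierstrass_m_test[OF boundM \<open>summable M\<close>])
  have sums: "(\<lambda>n. u n t) sums Y t" if "t \<in> {0..1}" for t
    unfolding Y_def by (intro summable_sums summable_comparison_test'[OF \<open>summable M\<close>, of 0] boundM[OF that])
  \<comment> \<open>Derivatives of the corrections. The initial term is constant, which shifts the
    index by one: the derivatives of the first n + 1 corrections involve only the first n
    corrections.\<close>
  define d where "d = case_nat (\<lambda>t. 0) (\<lambda>n t. B (u n t) (a t))"
  have dlim: "\<forall>\<^sub>F n in sequentially. \<forall>t\<in>{0..1}. \<forall>h::real.
     norm ((\<Sum>i<n. h *\<^sub>R d i t) - h *\<^sub>R B (Y t) (a t)) \<le> e * norm h" if "e > 0" for e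
  proof -
    have "\<forall>\<^sub>F n in sequentially. \<forall>t\<in>{0..1}. dist (\<Sum>i<n. u i t) (Y t) < e / (C + 1)"
      using unif that C0 unfolding uniform_limit_iff by auto
    then have "\<forall>\<^sub>F n in sequentially. \<forall>t\<in>{0..1}. \<forall>h::real.
     norm ((\<Sum>i<Suc n. h *\<^sub>R d i t) - h *\<^sub>R B (Y t) (a t)) \<le> e * norm h"
    proof (rule eventually_mono, intro ballI allI)
      fix n t and h :: real
      assume *: "\<forall>t\<in>{0..1}. dist (\<Sum>i<n. u i t) (Y t) < e / (C + 1)" and t: "t \<in> {0..1::real}"
      have "(\<Sum>i<Suc n. h *\<^sub>R d i t) = h *\<^sub>R (\<Sum>i<n. B (u i t) (a t))"
        unfolding sum.lessThan_Suc_shift by (simp add: d_def scaleR_sum_right)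
      also have "(\<Sum>i<n. B (u i t) (a t)) = B (\<Sum>i<n. u i t) (a t)"
        by (simp add: bounded_bilinear.sum_left[OF B])
      finally have "norm ((\<Sum>i<Suc n. h *\<^sub>R d i t) - h *\<^sub>R B (Y t) (a t))
          = norm (B ((\<Sum>i<n. u i t) - Y t) (a t)) * norm h"
        by (simp add: bounded_bilinear.diff_left[OF B] scaleR_diff_right[symmetric])
      also have "\<dots> \<le> (C * norm ((\<Sum>i<n. u i t) - Y t)) * norm h"
        by (rule mult_right_mono[OF C[OF t]]) simp
      also have "\<dots> \<le> (C * (e / (C + 1))) * norm h"
        using * t C0 by (intro mult_right_mono mult_left_mono) (auto simp: dist_norm less_imp_le)
      also have "\<dots> \<le> e * norm h"
        using C0 that by (intro mult_right_mono) (auto simp: field_simps)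
      finally show "norm ((\<Sum>i<Suc n. h *\<^sub>R d i t) - h *\<^sub>R B (Y t) (a t)) \<le> e * norm h" .
    qed
    then show ?thesis
      using eventually_sequentially_Suc[of "\<lambda>n. \<forall>t\<in>{0..1}. \<forall>h::real.
        norm ((\<Sum>i<n. h *\<^sub>R d i t) - h *\<^sub>R B (Y t) (a t)) \<le> e * norm h"] by simp
  qed
  have "\<exists>g. \<forall>x\<in>{0..1}. (\<lambda>n. u n x) sums g x \<and> (g has_derivative (\<lambda>h. h *\<^sub>R B (Y x) (a x))) (at x within {0..1})"
  proof (rule has_derivative_series[where f' = "\<lambda>n t h. h *\<^sub>R d n t" and x = 0 and l = "Y 0"])
    show "(u n has_derivative (\<lambda>h. h *\<^sub>R d n x)) (at x within {0..1})" if "x \<in> {0..1}" for n x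
    proof (cases n)
      case 0
      then show ?thesis by (simp add: u0 d_def)
    next
      case (Suc k)
      then show ?thesis
        using der[OF that, of k] by (simp add: d_def has_vector_derivative_def)
    qed
  qed (use dlim sums in auto)
  then obtain g where g: "\<And>x. x \<in> {0..1} \<Longrightarrow> (\<lambda>n. u n x) sums g x"
    "\<And>x. x \<in> {0..1} \<Longrightarrow> (g has_vector_derivative B (Y x) (a x)) (at x within {0..1})"
    unfolding has_vector_derivative_def by blast
  have gY: "g x = Y x" if "x \<in> {0..1}" for x
    using sums_unique2[OF g(1)[OF that] sums[OF that]] .
  have "g 0 = y0"
  proof -
    have "(\<lambda>n. u n 0) = (\<lambda>n. if n = 0 then y0 else 0)"
    proof
      show "u n 0 = (if n = 0 then y0 else 0)" for n
        by (cases n) (simp_all add: u0 uSuc)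
    qed
    then show ?thesis
      using g(1)[of 0] sums_single[of 0 "\<lambda>_. y0"] sums_unique2 by fastforce
  qed
  then show ?thesis
    using g(2) gY by (intro exI[of _ g]) simp
qed

section \<open>Estimates uniform on compact sets\<close>

lemma smooth_on_Blinfun_dif:
  fixes f :: "'a::euclidean_space \<Rightarrow> 'b::real_normed_vector"
  assumes "smooth_on U f"
  shows "x \<in> U \<Longrightarrow> blinfun_apply (Blinfun (dif f x)) = dif f x"
    and "continuous_on U (\<lambda>x. Blinfun (dif f x))"
proof -
  show *: "blinfun_apply (Blinfun (dif f x)) = dif f x" if "x \<in> U" for x
    using has_derivative_bounded_linear[OF smooth_on_has_derivative[OF assms that]]
    by (rule bounded_linear_Blinfun_apply)
  show "continuous_on U (\<lambda>x. Blinfun (dif f x))"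
  proof (rule continuous_on_blinfun_componentwise)
    show "continuous_on U (\<lambda>x. blinfun_apply (Blinfun (dif f x)) i)" for i
      using smooth_on_continuous_on[OF smooth_on_dif[OF assms], of i] * by simp
  qed
qed

text \<open>Mean value estimate for \<open>f\<close> minus its linear part at \<open>y\<close>, by
  uniform continuity of the derivative. That continuity is needed on a compact neighbourhood
  \<open>K'\<close>, since the segments from \<open>y\<close> to \<open>y + h\<close> may leave
  \<open>K\<close>.\<close>

lemma uniform_linearization:
  fixes f :: "'a::euclidean_space \<Rightarrow> 'b::real_normed_vector"
  assumes V: "open V" "smooth_on V f" and K: "compact K" "K \<subseteq> V" and "e > 0"
  shows "\<forall>\<^sub>F h in nhds 0. \<forall>y\<in>K. norm (f (y + h) - f y - dif f y h) \<le> e * norm h"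
proof (cases "K = {}")
  case False
  obtain r where r: "r > 0" "{x. infdist x K \<le> r} \<subseteq> V"
    using compact_in_open_separated[OF False K(1) V(1) K(2)] by metis
  define K' where "K' = {x. infdist x K \<le> r}"
  have "compact K'" unfolding K'_def by (rule compact_infdist_le[OF False K(1) r(1)])
  then have "uniformly_continuous_on K' (\<lambda>x. Blinfun (dif f x))"
    using smooth_on_Blinfun_dif(2)[OF V(2)] r continuous_on_subset unfolding K'_def
    by (intro compact_uniformly_continuous) auto
  then obtain d where d: "d > 0" "\<And>x y. x \<in> K' \<Longrightarrow> y \<in> K' \<Longrightarrow> dist y x < d \<Longrightarrow>
      dist (Blinfun (dif f y)) (Blinfun (dif f x)) < e"
    unfolding uniformly_continuous_on_def using \<open>e > 0\<close> by metis
  have "norm (f (y + h) - f y - dif f y h) \<le> e * norm h" if h: "norm h < min d r" and y: "y \<in> K" for y h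
  proof -
    let ?S = "ball y (min d r)"
    have S: "?S \<subseteq> K'" unfolding K'_def
    proof
      fix z assume "z \<in> ?S"
      then have "dist z y \<le> r" by (simp add: dist_commute)
      then show "z \<in> {x. infdist x K \<le> r}" using infdist_le[OF y, of z] by simp
    qed
    have yS: "y \<in> ?S" using d(1) r(1) by simp
    have blin: "blinfun_apply (Blinfun (dif f z)) = dif f z" if "z \<in> ?S" for z
      using smooth_on_Blinfun_dif(1)[OF V(2)] that S r(2) unfolding K'_def by blast
    have "norm (f (y + h) - f y - dif f y (y + h - y)) \<le> norm (y + h - y) * e"
    proof (rule differentiable_bound_linearization[where S = ?S])
      show "y + t *\<^sub>R (y + h - y) \<in> ?S" if "t \<in> {0..1}" for t
      proof -
        have "norm (t *\<^sub>R h) \<le> norm h" using that by (simp add: mult_left_le_one_le)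
        then show ?thesis using h by (simp add: dist_norm)
      qed
      show "(f has_derivative dif f z) (at z within ?S)" if "z \<in> ?S" for z
        using smooth_on_has_derivative[OF V(2), of z] that S r(2) has_derivative_at_withinI
        unfolding K'_def by blast
      show "onorm (dif f z - dif f y) \<le> e" if "z \<in> ?S" for z
      proof -
        have "norm (Blinfun (dif f z) - Blinfun (dif f y)) \<le> e"
          using d(2)[of y z] that S yS by (auto simp: dist_norm dist_commute[of y] norm_minus_commute less_imp_le subset_iff)
        then show ?thesis
          using blin[OF that] blin[OF yS] by (simp add: norm_blinfun.rep_eq minus_blinfun.rep_eq fun_diff_def)
      qed
    qed (rule yS)
    then show ?thesis by (simp add: mult.commute)
  qed
  then show ?thesis
    unfolding eventually_nhds_metric using d(1) r(1) by (intro exI[of _ "min d r"]) auto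
qed simp

lemma vector_mean_value_bound:
  fixes f :: "real \<Rightarrow> 'b::real_normed_vector"
  assumes "\<And>t. t \<in> {0..1} \<Longrightarrow> (f has_vector_derivative f' t) (at t within {0..1})"
    "\<And>t. t \<in> {0..1} \<Longrightarrow> norm (f' t) \<le> B"
  shows "norm (f 1 - f 0) \<le> B"
proof -
  have "norm (f 1 - f 0) \<le> B * norm (1 - 0 :: real)"
  proof (rule differentiable_bound[where S = "{0..1}"])
    show "(f has_derivative (\<lambda>h. h *\<^sub>R f' t)) (at t within {0..1})" if "t \<in> {0..1}" for t
      using assms(1)[OF that] by (simp add: has_vector_derivative_def)
    show "onorm (\<lambda>h. h *\<^sub>R f' t) \<le> B" if "t \<in> {0..1}" for t
    proof (rule onorm_le)
      show "norm (h *\<^sub>R f' t) \<le> B * norm h" for h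
        using mult_left_mono[OF assms(2)[OF that] abs_ge_zero[of h]] by (simp add: mult.commute)
    qed
  qed auto
  then show ?thesis by simp
qed

lemma linear_compact_bound:
  fixes f :: "'a::euclidean_space \<Rightarrow> 'b::euclidean_space \<Rightarrow> 'c::real_normed_vector"
  assumes "compact K" "\<And>x. x \<in> K \<Longrightarrow> linear (f x)" "\<And>u. continuous_on K (\<lambda>x. f x u)"
  shows "\<exists>M\<ge>0. \<forall>x\<in>K. \<forall>u. norm (f x u) \<le> M * norm u"
proof -
  have "\<exists>M. \<forall>x\<in>K. norm (f x b) \<le> M" for b
    using compact_continuous_image[OF assms(3) assms(1), of b] compact_imp_bounded bounded_iff
    by (metis imageI)
  then obtain M where M: "\<And>b x. x \<in> K \<Longrightarrow> norm (f x b) \<le> M b"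
    by metis
  have "norm (f x u) \<le> (\<Sum>b\<in>Basis. \<bar>M b\<bar>) * norm u" if "x \<in> K" for x u
  proof -
    have "norm (f x u) = norm (\<Sum>b\<in>Basis. (u \<bullet> b) *\<^sub>R f x b)"
      using euclidean_expansion_linear[OF assms(2)[OF that], of u] by simp
    also have "\<dots> \<le> (\<Sum>b\<in>Basis. \<bar>u \<bullet> b\<bar> * norm (f x b))"
      by (rule order_trans[OF norm_sum]) simp
    also have "\<dots> \<le> (\<Sum>b\<in>Basis. norm u * \<bar>M b\<bar>)"
    proof (intro sum_mono mult_mono)
      show "norm (f x b) \<le> \<bar>M b\<bar>" for b
        using M[OF that, of b] by arith
    qed (auto simp: Basis_le_norm)
    finally show ?thesis by (simp add: sum_distrib_left mult.commute)
  qed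
  then show ?thesis
    by (intro exI[of _ "\<Sum>b\<in>Basis. \<bar>M b\<bar>"]) (auto simp: sum_nonneg)
qed

section \<open>Matrix equations with skew coefficients\<close>

lemma matrix_mult_minus_left: "(- A) ** B = - (A ** B)" for A :: "real^'n^'m"
  by (rule bounded_bilinear.minus_left[OF bounded_bilinear_matrix_mult])

lemma matrix_mult_minus_right: "A ** (- B) = - (A ** B)" for A :: "real^'n^'m"
  by (rule bounded_bilinear.minus_right[OF bounded_bilinear_matrix_mult])

lemma matrix_mult_scaleR_left: "(c *\<^sub>R A) ** B = c *\<^sub>R (A ** B)" for A :: "real^'n^'m"
  by (rule bounded_bilinear.scaleR_left[OF bounded_bilinear_matrix_mult])

lemma matrix_mult_scaleR_right: "A ** (c *\<^sub>R B) = c *\<^sub>R (A ** B)" for A :: "real^'n^'m"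
  by (rule bounded_bilinear.scaleR_right[OF bounded_bilinear_matrix_mult])

lemmas matrix_add_rdistrib = bounded_bilinear.add_left[OF bounded_bilinear_matrix_mult]
lemmas matrix_diff_ldistrib = bounded_bilinear.diff_right[OF bounded_bilinear_matrix_mult]
lemmas matrix_diff_rdistrib = bounded_bilinear.diff_left[OF bounded_bilinear_matrix_mult]

lemma orthogonal_matrix_mult_transpose: "orthogonal_matrix Q \<Longrightarrow> Q ** transpose Q = mat 1"
  by (simp add: orthogonal_matrix_def)

text \<open>In this order the product of \<open>Y t\<close> and its transpose has derivative
  \<open>Y t ** (a t + transpose (a t)) ** transpose (Y t)\<close>, which is 0 at once; in the other
  order it would only satisfy a linear equation of its own.\<close>

lemma skew_ode_orthogonal:
  fixes Y :: "real \<Rightarrow> real^'k^'k"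
  assumes Y: "\<And>t. t \<in> {0..1} \<Longrightarrow> (Y has_vector_derivative Y t ** a t) (at t within {0..1})"
    and a: "\<And>t. t \<in> {0..1} \<Longrightarrow> transpose (a t) = - a t"
    and Y0: "Y 0 = mat 1" and t: "t \<in> {0..1}"
  shows "orthogonal_matrix (Y t)"
proof -
  have "((\<lambda>t. Y t ** transpose (Y t)) has_vector_derivative 0) (at t within {0..1})" if "t \<in> {0..1}" for t
  proof -
    have "((\<lambda>t. transpose (Y t)) has_vector_derivative transpose (Y t ** a t)) (at t within {0..1})"
      by (rule bounded_linear.has_vector_derivative[OF bounded_linear_transpose Y[OF that]])
    from bounded_bilinear.has_vector_derivative[OF bounded_bilinear_matrix_mult Y[OF that] this]
    show ?thesis
      by (simp add: matrix_transpose_mul a[OF that] matrix_mult_minus_left matrix_mult_minus_right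
          matrix_mul_assoc)
  qed
  then obtain c where "\<And>t. t \<in> {0..1} \<Longrightarrow> Y t ** transpose (Y t) = c"
    using has_vector_derivative_zero_constant[of "{0..1}" "\<lambda>t. Y t ** transpose (Y t)"] by auto
  from this[OF t] this[of 0] have "Y t ** transpose (Y t) = mat 1"
    by (simp add: Y0)
  then show ?thesis
    by (metis orthogonal_matrix orthogonal_matrix_transpose transpose_transpose)
qed

text \<open>\<open>flat\<close> is d\<Theta> + \<Theta> \<and> \<Theta> = 0 evaluated on constant
  fields. It is what symmetry of second derivatives demands of an invertible solution of dg = g
  \<Theta>.\<close>

locale flat_orthogonal_connection =
  fixes V :: "'a::euclidean_space set" and \<Theta> :: "'a \<Rightarrow> 'a \<Rightarrow> real^'k::finite^'k"
  assumes V: "open V"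
    and lin: "\<And>x. x \<in> V \<Longrightarrow> linear (\<Theta> x)"
    and sm: "\<And>u. smooth_on V (\<lambda>x. \<Theta> x u)"
    and skew: "\<And>x u. x \<in> V \<Longrightarrow> transpose (\<Theta> x u) = - \<Theta> x u"
    and flat: "\<And>x u w. x \<in> V \<Longrightarrow>
      dif (\<lambda>y. \<Theta> y w) x u - dif (\<lambda>y. \<Theta> y u) x w + \<Theta> x u ** \<Theta> x w - \<Theta> x w ** \<Theta> x u = 0"
begin

lemma ray_solution:
  assumes "closed_segment c x \<subseteq> V"
  shows "\<exists>Y. Y 0 = mat 1 \<and>
    (\<forall>t\<in>{0..1}. (Y has_vector_derivative Y t ** \<Theta> (c + t *\<^sub>R (x - c)) (x - c)) (at t within {0..1}) \<and>
       orthogonal_matrix (Y t))"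
proof -
  have seg: "c + t *\<^sub>R (x - c) \<in> V" if "t \<in> {0..1}" for t
  proof -
    have "c + t *\<^sub>R (x - c) = (1 - t) *\<^sub>R c + t *\<^sub>R x" by (simp add: algebra_simps)
    then have "c + t *\<^sub>R (x - c) \<in> closed_segment c x"
      using that unfolding closed_segment_def by auto
    then show ?thesis using assms by blast
  qed
  have "continuous_on {0..1} (\<lambda>t. \<Theta> (c + t *\<^sub>R (x - c)) (x - c))"
    by (rule continuous_on_compose2[OF smooth_on_continuous_on[OF sm]])
      (use seg in \<open>auto intro!: continuous_intros\<close>)
  from linear_ode_exists[OF bounded_bilinear_matrix_mult this] obtain Y where
    "Y 0 = mat 1" and Y: "\<And>t. t \<in> {0..1} \<Longrightarrow>
      (Y has_vector_derivative Y t ** \<Theta> (c + t *\<^sub>R (x - c)) (x - c)) (at t within {0..1})"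
    by blast
  moreover have "orthogonal_matrix (Y t)" if "t \<in> {0..1}" for t
    by (rule skew_ode_orthogonal[OF Y _ _ that]) (use seg skew \<open>Y 0 = mat 1\<close> in auto)
  ultimately show ?thesis by blast
qed

text \<open>The derivative of the error made by transporting along the ray to \<open>x + h\<close> the first-order
  guess \<open>H t = Y t ** (1 + t \<Theta>(h))\<close> built from the transport \<open>Y\<close> along the ray to \<open>x\<close>;
  flatness is what makes the terms of first order in \<open>h\<close> cancel.\<close>

lemma transport_comparison:
  assumes Y: "\<And>t. t \<in> {0..1} \<Longrightarrow> (Y has_vector_derivative Y t ** \<Theta> (c + t *\<^sub>R w) w) (at t within {0..1})"
      "\<And>t. t \<in> {0..1} \<Longrightarrow> orthogonal_matrix (Y t)" "Y 0 = mat 1"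
    and Z: "\<And>t. t \<in> {0..1} \<Longrightarrow> (Z has_vector_derivative Z t ** \<Theta> (c + t *\<^sub>R (w + h)) (w + h)) (at t within {0..1})"
      "\<And>t. t \<in> {0..1} \<Longrightarrow> orthogonal_matrix (Z t)" "Z 0 = mat 1"
    and seg: "\<And>t. t \<in> {0..1} \<Longrightarrow> c + t *\<^sub>R w \<in> V" "\<And>t. t \<in> {0..1} \<Longrightarrow> c + t *\<^sub>R (w + h) \<in> V"
    and M: "M \<ge> 0" "\<And>t u. t \<in> {0..1} \<Longrightarrow> norm (\<Theta> (c + t *\<^sub>R w) u) \<le> M * norm u"
      "\<And>t u v. t \<in> {0..1} \<Longrightarrow> norm (dif (\<lambda>y. \<Theta> y u) (c + t *\<^sub>R w) v) \<le> M * norm u * norm v"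
    and R: "\<And>t. t \<in> {0..1} \<Longrightarrow> norm (\<Theta> (c + t *\<^sub>R (w + h)) (w + h) - \<Theta> (c + t *\<^sub>R w) (w + h)
        - dif (\<lambda>y. \<Theta> y (w + h)) (c + t *\<^sub>R w) (t *\<^sub>R h)) \<le> r"
  shows "norm (Z 1 - Y 1 - Y 1 ** \<Theta> (c + w) h) \<le>
    (sqrt CARD('k)) ^ 3 * (r + M * norm h ^ 2 + M * norm h * (r + M * norm h + M * norm h * norm w + M * norm h ^ 2))"
proof -
  define N where "N = sqrt CARD('k)"
  define B where "B = r + M * norm h ^ 2 + M * norm h * (r + M * norm h + M * norm h * norm w + M * norm h ^ 2)"
  define \<gamma> where "\<gamma> = (\<lambda>t. c + t *\<^sub>R w)"
  define D where "D = (\<lambda>t u v. dif (\<lambda>y. \<Theta> y u) (\<gamma> t) v)"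
  define H where "H = (\<lambda>t. Y t ** (mat 1 + t *\<^sub>R \<Theta> (\<gamma> t) h))"
  define \<Theta>' where "\<Theta>' = (\<lambda>t. \<Theta> (c + t *\<^sub>R (w + h)) (w + h))"
  \<comment> \<open>Remainder of the first-order expansion of the connection between corresponding
    points of the two rays.\<close>
  define S where "S = (\<lambda>t. \<Theta>' t - \<Theta> (\<gamma> t) (w + h) - t *\<^sub>R D t (w + h) h)"
  have g: "\<gamma> t \<in> V" if "t \<in> {0..1}" for t using seg(1)[OF that] by (simp add: \<gamma>_def)
  note linT = lin[OF g]
  have diffT: "(\<lambda>y. \<Theta> y u) differentiable (at (\<gamma> t))" if "t \<in> {0..1}" for t u
    by (rule smooth_on_differentiable[OF sm g[OF that]])
  have linD: "linear (D t u)" if "t \<in> {0..1}" for t u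
    unfolding D_def by (rule linear_dif[OF diffT[OF that]])
  have Dadd: "D t (u + u') v = D t u v + D t u' v" if t: "t \<in> {0..1}" for t u u' v
  proof -
    have "dif (\<lambda>y. \<Theta> y (u + u')) (\<gamma> t) = dif (\<lambda>y. \<Theta> y u + \<Theta> y u') (\<gamma> t)"
      by (rule dif_cong_open[OF V g[OF t]]) (use lin linear_add in blast)
    moreover have "dif (\<lambda>y. \<Theta> y u + \<Theta> y u') (\<gamma> t) = (\<lambda>v. D t u v + D t u' v)"
      unfolding D_def by (rule dif_eq, rule has_derivative_add)
        (use diffT[OF t] in \<open>auto simp: frechet_derivative_works\<close>)
    ultimately show ?thesis by (simp add: D_def)
  qed
  have S_bound: "norm (S t) \<le> r" if t: "t \<in> {0..1}" for t
    using R[OF t] linear_scale[OF linD[OF t, of "w + h"], of t h]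
    by (simp add: S_def \<Theta>'_def \<gamma>_def D_def)
  have r0: "r \<ge> 0" using order_trans[OF norm_ge_zero S_bound[of 0]] by simp
  \<comment> \<open>The defect of \<open>H\<close>, found by solving
    \<open>H' = H t ** \<Theta>' t + Y t ** E t\<close> for \<open>E\<close> with the help of
    flatness. Every term is quadratic in \<open>h\<close> or contains the remainder
    \<open>S\<close>.\<close>
  define E where "E = (\<lambda>t. - S t - t *\<^sub>R D t h h
    - (t *\<^sub>R \<Theta> (\<gamma> t) h) ** (S t + \<Theta> (\<gamma> t) h + t *\<^sub>R D t w h + t *\<^sub>R D t h h))"
  have E_bound: "norm (E t) \<le> B" if t: "t \<in> {0..1}" for t
  proof -
    have t1: "norm (t *\<^sub>R A) \<le> norm A" for A :: "real^'k^'k"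
      using t by (simp add: mult_left_le_one_le)
    have b1: "norm (t *\<^sub>R D t h h) \<le> M * norm h ^ 2"
      using order_trans[OF t1 M(3)[OF t, of h h]] by (simp add: D_def \<gamma>_def power2_eq_square mult.assoc)
    have b2: "norm (t *\<^sub>R D t w h) \<le> M * norm h * norm w"
      using order_trans[OF t1 M(3)[OF t, of w h]] by (simp add: D_def \<gamma>_def mult_ac)
    have b3: "norm (\<Theta> (\<gamma> t) h) \<le> M * norm h"
      using M(2)[OF t] by (simp add: \<gamma>_def)
    let ?X = "S t + \<Theta> (\<gamma> t) h + t *\<^sub>R D t w h + t *\<^sub>R D t h h"
    have b4: "norm ?X \<le> r + M * norm h + M * norm h * norm w + M * norm h ^ 2"
      using b1 b2 b3 S_bound[OF t] by (intro norm_triangle_le add_mono) auto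
    have "norm ((t *\<^sub>R \<Theta> (\<gamma> t) h) ** ?X) \<le> norm (t *\<^sub>R \<Theta> (\<gamma> t) h) * norm ?X"
      by (rule norm_matrix_mult_le)
    also have "\<dots> \<le> (M * norm h) * (r + M * norm h + M * norm h * norm w + M * norm h ^ 2)"
      using b4 order_trans[OF t1 b3] M(1) by (intro mult_mono) auto
    finally have b5: "norm ((t *\<^sub>R \<Theta> (\<gamma> t) h) ** ?X)
      \<le> (M * norm h) * (r + M * norm h + M * norm h * norm w + M * norm h ^ 2)" .
    have "norm (E t) \<le> norm (S t) + norm (t *\<^sub>R D t h h) + norm ((t *\<^sub>R \<Theta> (\<gamma> t) h) ** ?X)"
      unfolding E_def by (rule order_trans[OF norm_triangle_ineq4 add_right_mono]) (metis norm_minus_cancel norm_triangle_ineq4)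
    then show ?thesis
      using S_bound[OF t] b1 b5 by (simp add: B_def)
  qed
  have derH: "(H has_vector_derivative H t ** \<Theta>' t + Y t ** E t) (at t within {0..1})"
    if t: "t \<in> {0..1}" for t
  proof -
    have "((\<lambda>t. \<Theta> (\<gamma> t) h) has_vector_derivative D t h w) (at t within {0..1})"
      unfolding D_def \<gamma>_def
      by (rule has_vector_derivative_line) (use diffT[OF t] in \<open>simp add: \<gamma>_def\<close>)
    then have "((\<lambda>t. mat 1 + t *\<^sub>R \<Theta> (\<gamma> t) h) has_vector_derivative
        (\<Theta> (\<gamma> t) h + t *\<^sub>R D t h w)) (at t within {0..1})"
      by (auto intro!: derivative_eq_intros)
    from bounded_bilinear.has_vector_derivative[OF bounded_bilinear_matrix_mult Y(1)[OF t] this]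
    have 1: "(H has_vector_derivative (Y t ** (\<Theta> (\<gamma> t) h + t *\<^sub>R D t h w)
        + Y t ** \<Theta> (\<gamma> t) w ** (mat 1 + t *\<^sub>R \<Theta> (\<gamma> t) h))) (at t within {0..1})"
      by (simp add: H_def \<gamma>_def)
    \<comment> \<open>Flatness exchanges the two arguments in the derivative of the connection, at
      the price of a commutator. The two products of that commutator cancel against those that arise
      from the factor \<open>mat 1 + t *\<^sub>R \<Theta> (\<gamma> t) h\<close> of
      \<open>H\<close>.\<close>
    have fl: "D t h w = D t w h - \<Theta> (\<gamma> t) w ** \<Theta> (\<gamma> t) h + \<Theta> (\<gamma> t) h ** \<Theta> (\<gamma> t) w"
      using flat[OF g[OF t], of h w] by (simp add: D_def algebra_simps)
    have 2: "\<Theta>' t = S t + \<Theta> (\<gamma> t) w + \<Theta> (\<gamma> t) h + t *\<^sub>R D t w h + t *\<^sub>R D t h h"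
      by (simp add: S_def linear_add[OF linT[OF t]] Dadd[OF t] algebra_simps)
    have "Y t ** (\<Theta> (\<gamma> t) h + t *\<^sub>R D t h w) + Y t ** \<Theta> (\<gamma> t) w ** (mat 1 + t *\<^sub>R \<Theta> (\<gamma> t) h)
      = H t ** \<Theta>' t + Y t ** E t"
      unfolding H_def matrix_mul_assoc[symmetric] matrix_add_ldistrib[symmetric] fl 2 E_def
      by (rule arg_cong[where f = "(**) (Y t)"])
        (simp add: matrix_add_ldistrib matrix_add_rdistrib matrix_mult_scaleR_left matrix_mult_scaleR_right
          algebra_simps)
    with 1 show ?thesis by simp
  qed
  \<comment> \<open>Variation of constants: multiplying by the inverse of \<open>Z\<close> removes
    the homogeneous part of the equation for \<open>H\<close>, and only the defect is left in the
    derivative.\<close>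
  define P where "P = (\<lambda>t. H t ** transpose (Z t))"
  have derP: "(P has_vector_derivative Y t ** E t ** transpose (Z t)) (at t within {0..1})"
    if t: "t \<in> {0..1}" for t
  proof -
    have "((\<lambda>t. transpose (Z t)) has_vector_derivative transpose (Z t ** \<Theta>' t)) (at t within {0..1})"
      unfolding \<Theta>'_def by (rule bounded_linear.has_vector_derivative[OF bounded_linear_transpose Z(1)[OF t]])
    from bounded_bilinear.has_vector_derivative[OF bounded_bilinear_matrix_mult derH[OF t] this]
    show ?thesis
      using skew[OF seg(2)[OF t]]
      by (simp add: P_def \<Theta>'_def matrix_transpose_mul matrix_mult_minus_left matrix_mult_minus_right
          matrix_mul_assoc matrix_add_rdistrib)
  qed
  have N: "norm (Y t) = N" "norm (Z t) = N" "norm (transpose (Z t)) = N" if "t \<in> {0..1}" for t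
    using Y(2)[OF that] Z(2)[OF that] by (simp_all add: N_def norm_orthogonal_matrix)
  have N0: "N \<ge> 0" by (simp add: N_def)
  have "norm (P 1 - P 0) \<le> N * B * N"
  proof (rule vector_mean_value_bound[OF derP])
    fix t :: real assume t: "t \<in> {0..1}"
    have "norm (Y t ** E t ** transpose (Z t)) \<le> norm (Y t ** E t) * N"
      using norm_matrix_mult_le[of "Y t ** E t"] N[OF t] by metis
    also have "\<dots> \<le> (N * norm (E t)) * N"
      using norm_matrix_mult_le[of "Y t" "E t"] N[OF t] N0 by (intro mult_right_mono) auto
    also have "\<dots> \<le> (N * B) * N"
      using E_bound[OF t] N0 by (intro mult_right_mono mult_left_mono)
    finally show "norm (Y t ** E t ** transpose (Z t)) \<le> N * B * N" .
  qed
  moreover have "P 0 = mat 1"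
    by (simp add: P_def H_def Y(3) Z(3))
  ultimately have "norm (H 1 ** transpose (Z 1) - mat 1) \<le> N * B * N"
    by (simp add: P_def)
  then have "norm ((H 1 ** transpose (Z 1) - mat 1) ** Z 1) \<le> N * B * N * N"
    using norm_matrix_mult_le[of "H 1 ** transpose (Z 1) - mat 1" "Z 1"] N(2)[of 1] N0
    by (smt (verit) atLeastAtMost_iff mult_right_mono)
  moreover have "(H 1 ** transpose (Z 1) - mat 1) ** Z 1 = H 1 - Z 1"
    using Z(2)[of 1] by (simp add: matrix_diff_rdistrib matrix_mul_assoc[symmetric] orthogonal_matrix_def)
  moreover have "H 1 = Y 1 + Y 1 ** \<Theta> (c + w) h"
    by (simp add: H_def \<gamma>_def matrix_add_ldistrib)
  ultimately have "norm (Y 1 + Y 1 ** \<Theta> (c + w) h - Z 1) \<le> N * B * N * N"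
    by metis
  also have "Y 1 + Y 1 ** \<Theta> (c + w) h - Z 1 = - (Z 1 - Y 1 - Y 1 ** \<Theta> (c + w) h)"
    by simp
  finally show ?thesis
    unfolding N_def[symmetric] B_def[symmetric] norm_minus_cancel
    by (simp add: power3_eq_cube mult_ac)
qed

text \<open>The bound of \<open>transport_comparison\<close> is o(|h|) once its \<open>r\<close> is.
  That holds because the linearization error of the connection is uniform along the compact ray; by
  linearity it suffices to control it for the finitely many basis directions.\<close>

lemma transport_has_derivative:
  assumes c: "\<And>x. x \<in> V \<Longrightarrow> closed_segment c x \<subseteq> V" and x: "x \<in> V"
    and Y0: "\<And>x. x \<in> V \<Longrightarrow> Y x 0 = mat 1"
    and Y: "\<And>x t. x \<in> V \<Longrightarrow> t \<in> {0..1} \<Longrightarrow>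
      (Y x has_vector_derivative Y x t ** \<Theta> (c + t *\<^sub>R (x - c)) (x - c)) (at t within {0..1})"
    and orth: "\<And>x t. x \<in> V \<Longrightarrow> t \<in> {0..1} \<Longrightarrow> orthogonal_matrix (Y x t)"
  shows "((\<lambda>x. Y x 1) has_derivative (\<lambda>h. Y x 1 ** \<Theta> x h)) (at x)"
proof -
  define w where "w = x - c"
  have xw: "x = c + w" by (simp add: w_def)
  define K where "K = closed_segment c x"
  have K: "compact K" "K \<subseteq> V" using c[OF x] by (auto simp: K_def)
  have seg: "c + t *\<^sub>R (z - c) \<in> closed_segment c z" if "t \<in> {0..1}" for t z
  proof -
    have "c + t *\<^sub>R (z - c) = (1 - t) *\<^sub>R c + t *\<^sub>R z" by (simp add: algebra_simps)
    then show ?thesis using that unfolding closed_segment_def by auto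
  qed
  have segK: "c + t *\<^sub>R w \<in> K" if "t \<in> {0..1}" for t
    using seg[OF that, of x] by (simp add: w_def K_def)
  obtain M1 where M1: "M1 \<ge> 0" "\<And>y u. y \<in> K \<Longrightarrow> norm (\<Theta> y u) \<le> M1 * norm u"
    using linear_compact_bound[of K \<Theta>] K lin smooth_on_continuous_on[OF sm] continuous_on_subset
    by (metis subsetD)
  have "\<exists>M\<ge>0. \<forall>y\<in>K. \<forall>v. norm (dif (\<lambda>y. \<Theta> y b) y v) \<le> M * norm v" for b
  proof (rule linear_compact_bound[OF K(1)])
    show "linear (dif (\<lambda>y. \<Theta> y b) y)" if "y \<in> K" for y
      using smooth_on_linear_dif[OF sm] that K by blast
    show "continuous_on K (\<lambda>y. dif (\<lambda>y. \<Theta> y b) y v)" for v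
      using continuous_on_subset[OF smooth_on_continuous_on[OF smooth_on_dif[OF sm]] K(2)] .
  qed
  then obtain M2 where M2: "\<And>b. M2 b \<ge> 0" "\<And>b y v. y \<in> K \<Longrightarrow> norm (dif (\<lambda>y. \<Theta> y b) y v) \<le> M2 b * norm v"
    by metis
  have expand: "\<Theta> y u = (\<Sum>b\<in>Basis. (u \<bullet> b) *\<^sub>R \<Theta> y b)" if "y \<in> V" for y u
    by (rule euclidean_expansion_linear[OF lin[OF that]])
  have expandD: "dif (\<lambda>y. \<Theta> y u) y v = (\<Sum>b\<in>Basis. (u \<bullet> b) *\<^sub>R dif (\<lambda>y. \<Theta> y b) y v)" if y: "y \<in> V" for y u v
  proof -
    have "dif (\<lambda>y. \<Theta> y u) y = dif (\<lambda>y. \<Sum>b\<in>Basis. (u \<bullet> b) *\<^sub>R \<Theta> y b) y"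
      by (rule dif_cong_open[OF V y]) (rule expand)
    also have "\<dots> = (\<lambda>v. \<Sum>b\<in>Basis. (u \<bullet> b) *\<^sub>R dif (\<lambda>y. \<Theta> y b) y v)"
      by (rule dif_eq, rule has_derivative_sum, rule has_derivative_scaleR_right)
        (rule smooth_on_has_derivative[OF sm y])
    finally show ?thesis by simp
  qed
  define M where "M = M1 + (\<Sum>b\<in>Basis. M2 b)"
  have sumM2: "(\<Sum>b\<in>Basis. M2 b) \<ge> 0" by (rule sum_nonneg) (rule M2)
  have M: "M \<ge> 0" "\<And>y u. y \<in> K \<Longrightarrow> norm (\<Theta> y u) \<le> M * norm u"
      "\<And>y u v. y \<in> K \<Longrightarrow> norm (dif (\<lambda>y. \<Theta> y u) y v) \<le> M * norm u * norm v"
  proof -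
    show "M \<ge> 0" using M1 sumM2 by (simp add: M_def)
    show "norm (\<Theta> y u) \<le> M * norm u" if "y \<in> K" for y u
      by (rule order_trans[OF M1(2)[OF that]]) (use sumM2 in \<open>simp add: M_def mult_right_mono\<close>)
    show "norm (dif (\<lambda>y. \<Theta> y u) y v) \<le> M * norm u * norm v" if y: "y \<in> K" for y u v
    proof -
      have "y \<in> V" using y K by auto
      have "norm (dif (\<lambda>y. \<Theta> y u) y v) \<le> (\<Sum>b\<in>Basis. \<bar>u \<bullet> b\<bar> * norm (dif (\<lambda>y. \<Theta> y b) y v))"
        unfolding expandD[OF \<open>y \<in> V\<close>, of u] by (rule order_trans[OF norm_sum]) simp
      also have "\<dots> \<le> (\<Sum>b\<in>Basis. norm u * (M2 b * norm v))"
        using M2(2)[OF y] by (intro sum_mono mult_mono) (auto simp: Basis_le_norm)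
      also have "\<dots> = (\<Sum>b\<in>Basis. M2 b) * norm u * norm v"
        by (simp add: sum_distrib_left sum_distrib_right mult_ac)
      also have "\<dots> \<le> M * norm u * norm v"
        using M1 by (intro mult_right_mono) (auto simp: M_def)
      finally show ?thesis .
    qed
  qed
  \<comment> \<open>Bounds \<open>norm (w + h)\<close> for \<open>norm h < 1\<close>.\<close>
  define W where "W = norm w + 1"
  have W: "W > 0" unfolding W_def by (smt (verit) norm_ge_zero)
  define N3 where "N3 = (sqrt CARD('k)) ^ 3"
  have N3: "N3 > 0" by (simp add: N3_def)
  have "bounded_linear (\<lambda>h. Y x 1 ** \<Theta> x h)"
    using bounded_linear_compose[OF bounded_bilinear.bounded_linear_right[OF bounded_bilinear_matrix_mult]]
      lin[OF x] by (simp add: linear_conv_bounded_linear)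
  moreover have "\<exists>d>0. \<forall>z. norm (z - x) < d \<longrightarrow>
    norm (Y z 1 - Y x 1 - Y x 1 ** \<Theta> x (z - x)) \<le> e * norm (z - x)" if "e > 0" for e
  proof -
    \<comment> \<open>Chosen so that \<open>N3 * r\<close> is exactly half of
      \<open>e * norm h\<close>; the division by \<open>DIM('a)\<close> in \<open>e''\<close> pays
      for the sum over the basis.\<close>
    define e' where "e' = e / (2 * N3 * W)"
    have e': "e' > 0" using that N3 W by (simp add: e'_def)
    define e'' where "e'' = e' / DIM('a)"
    have e'': "e'' > 0" using e' by (simp add: e''_def)
    have "\<forall>\<^sub>F h in nhds 0. \<forall>b\<in>Basis. \<forall>y\<in>K. norm (\<Theta> (y + h) b - \<Theta> y b - dif (\<lambda>y. \<Theta> y b) y h) \<le> e'' * norm h"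
      by (rule eventually_ball_finite[OF finite_Basis]) (intro ballI uniform_linearization[OF V sm K e''])
    then obtain d1 where d1: "d1 > 0" "\<And>h b y. norm h < d1 \<Longrightarrow> b \<in> Basis \<Longrightarrow> y \<in> K \<Longrightarrow>
        norm (\<Theta> (y + h) b - \<Theta> y b - dif (\<lambda>y. \<Theta> y b) y h) \<le> e'' * norm h"
      unfolding eventually_nhds_metric by auto
    obtain d2 where d2: "d2 > 0" "ball x d2 \<subseteq> V"
      using V x openE by blast
    \<comment> \<open>Coefficient of \<open>norm h * norm h\<close> in a bound for the remaining
      terms; the choice of \<open>d\<close> makes them at most the other half.\<close>
    define Q where "Q = M + M * (e' * W + M + M * norm w + M)"
    have Q: "Q \<ge> 0" using M(1) e' W by (simp add: Q_def)
    define d where "d = min (min d1 d2) (min 1 (e / (2 * N3 * (Q + 1))))"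
    have d: "d > 0" using d1 d2 that N3 Q by (simp add: d_def)
    have "norm (Y z 1 - Y x 1 - Y x 1 ** \<Theta> x (z - x)) \<le> e * norm (z - x)" if z: "norm (z - x) < d" for z
    proof -
      define h where "h = z - x"
      have h: "norm h < d1" "norm h < 1" "norm h < e / (2 * N3 * (Q + 1))" and zV: "z \<in> V"
        using z d2(2) by (auto simp: h_def d_def dist_norm norm_minus_commute subset_iff)
      have zw: "z - c = w + h" by (simp add: w_def h_def)
      have segz: "c + t *\<^sub>R (w + h) \<in> V" if "t \<in> {0..1}" for t
        using seg[OF that, of z] c[OF zV] by (auto simp: zw)
      define r where "r = e' * W * norm h"
      have r: "norm (\<Theta> (c + t *\<^sub>R (w + h)) (w + h) - \<Theta> (c + t *\<^sub>R w) (w + h)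
        - dif (\<lambda>y. \<Theta> y (w + h)) (c + t *\<^sub>R w) (t *\<^sub>R h)) \<le> r" if t: "t \<in> {0..1}" for t
      proof -
        let ?y = "c + t *\<^sub>R w"
        have y: "?y \<in> K" "?y \<in> V" using segK[OF t] K by auto
        have shift: "c + t *\<^sub>R (w + h) = ?y + t *\<^sub>R h" by (simp add: algebra_simps)
        have th: "norm (t *\<^sub>R h) \<le> norm h" using t by (simp add: mult_left_le_one_le)
        have "norm (\<Theta> (?y + t *\<^sub>R h) (w + h) - \<Theta> ?y (w + h) - dif (\<lambda>y. \<Theta> y (w + h)) ?y (t *\<^sub>R h))
          = norm (\<Sum>b\<in>Basis. ((w + h) \<bullet> b) *\<^sub>R (\<Theta> (?y + t *\<^sub>R h) b - \<Theta> ?y b - dif (\<lambda>y. \<Theta> y b) ?y (t *\<^sub>R h)))"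
          using expand[OF y(2), of "w + h"] expand[OF segz[OF t], of "w + h"] expandD[OF y(2), of "w + h" "t *\<^sub>R h"]
          unfolding shift by (simp only: sum_subtractf[symmetric] scaleR_diff_right)
        also have "\<dots> \<le> (\<Sum>b\<in>Basis. \<bar>(w + h) \<bullet> b\<bar> * norm (\<Theta> (?y + t *\<^sub>R h) b - \<Theta> ?y b - dif (\<lambda>y. \<Theta> y b) ?y (t *\<^sub>R h)))"
          by (rule order_trans[OF norm_sum]) simp
        also have "\<dots> \<le> (\<Sum>b\<in>(Basis :: 'a set). W * (e'' * norm h))"
        proof (intro sum_mono mult_mono)
          fix b :: 'a assume b: "b \<in> Basis"
          have "\<bar>(w + h) \<bullet> b\<bar> \<le> norm (w + h)" by (rule Basis_le_norm[OF b])
          also have "\<dots> \<le> W" using h(2) norm_triangle_ineq[of w h] by (simp add: W_def)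
          finally show "\<bar>(w + h) \<bullet> b\<bar> \<le> W" .
          have "norm (\<Theta> (?y + t *\<^sub>R h) b - \<Theta> ?y b - dif (\<lambda>y. \<Theta> y b) ?y (t *\<^sub>R h)) \<le> e'' * norm (t *\<^sub>R h)"
            by (rule d1(2)[OF _ b y(1)]) (use th h(1) in linarith)
          also have "\<dots> \<le> e'' * norm h" using th e'' by (intro mult_left_mono) auto
          finally show "norm (\<Theta> (?y + t *\<^sub>R h) b - \<Theta> ?y b - dif (\<lambda>y. \<Theta> y b) ?y (t *\<^sub>R h)) \<le> e'' * norm h" .
        qed (use W in auto)
        also have "\<dots> = r" by (simp add: r_def e''_def)
        finally show ?thesis unfolding shift .
      qed
      have "norm (Y z 1 - Y x 1 - Y x 1 ** \<Theta> (c + w) h) \<le>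
        N3 * (r + M * norm h ^ 2 + M * norm h * (r + M * norm h + M * norm h * norm w + M * norm h ^ 2))"
        unfolding N3_def
        by (rule transport_comparison[where c = c and w = w])
          (use Y[OF x] Y[OF zV] Y0[OF x] Y0[OF zV] orth[OF x] orth[OF zV] segK K segz M r
            in \<open>auto simp: zw w_def[symmetric]\<close>)
      also have "\<dots> \<le> N3 * (r + norm h * norm h * Q)"
      proof -
        have h2: "norm h * norm h \<le> norm h" using h(2) by (simp add: mult_left_le)
        have "r + M * norm h + M * norm h * norm w + M * norm h ^ 2 =
          norm h * (e' * W + M + M * norm w) + M * (norm h * norm h)"
          by (simp add: r_def algebra_simps power2_eq_square)
        also have "\<dots> \<le> norm h * (e' * W + M + M * norm w) + M * norm h"
          using h2 M(1) by (intro add_left_mono mult_left_mono)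
        finally have "r + M * norm h + M * norm h * norm w + M * norm h ^ 2 \<le> norm h * (e' * W + M + M * norm w + M)"
          by (simp add: algebra_simps)
        then have "M * norm h * (r + M * norm h + M * norm h * norm w + M * norm h ^ 2)
          \<le> M * norm h * (norm h * (e' * W + M + M * norm w + M))"
          using M(1) by (intro mult_left_mono) auto
        then show ?thesis
          using N3 by (intro mult_left_mono) (auto simp: Q_def algebra_simps power2_eq_square)
      qed
      also have "\<dots> \<le> e * norm h"
      proof -
        have "norm h * (2 * N3 * (Q + 1)) \<le> e"
          using h(3) N3 Q by (simp add: pos_less_divide_eq less_imp_le)
        then have "norm h * (2 * N3 * Q) \<le> e"
          using N3 norm_ge_zero[of h] by (smt (verit) mult_left_mono mult_pos_pos Q)
        then have "norm h * (norm h * (2 * N3 * Q)) \<le> norm h * e"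
          by (intro mult_left_mono) auto
        moreover have "N3 * r = norm h * e / 2"
          using N3 W by (simp add: r_def e'_def field_simps)
        ultimately show ?thesis by (simp add: algebra_simps)
      qed
      finally show ?thesis by (simp add: h_def xw)
    qed
    then show ?thesis using d by blast
  qed
  ultimately show ?thesis
    unfolding has_derivative_at_alt by blast
qed

theorem parallel_transport_exists:
  assumes "starlike V"
  shows "\<exists>g. smooth_on V g \<and> (\<forall>x\<in>V. orthogonal_matrix (g x) \<and> (g has_derivative (\<lambda>u. g x ** \<Theta> x u)) (at x))"
proof -
  obtain c where c: "\<And>x. x \<in> V \<Longrightarrow> closed_segment c x \<subseteq> V"
    using assms unfolding starlike_def by blast
  have "\<exists>Y. \<forall>x\<in>V. Y x 0 = mat 1 \<and>
    (\<forall>t\<in>{0..1}. (Y x has_vector_derivative Y x t ** \<Theta> (c + t *\<^sub>R (x - c)) (x - c)) (at t within {0..1}) \<and>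
       orthogonal_matrix (Y x t))"
    using ray_solution[OF c] by (intro bchoice) blast
  then obtain Y where Y: "\<And>x. x \<in> V \<Longrightarrow> Y x 0 = mat 1"
    "\<And>x t. x \<in> V \<Longrightarrow> t \<in> {0..1} \<Longrightarrow>
      (Y x has_vector_derivative Y x t ** \<Theta> (c + t *\<^sub>R (x - c)) (x - c)) (at t within {0..1})"
    "\<And>x t. x \<in> V \<Longrightarrow> t \<in> {0..1} \<Longrightarrow> orthogonal_matrix (Y x t)"
    by blast
  have der: "((\<lambda>x. Y x 1) has_derivative (\<lambda>u. Y x 1 ** \<Theta> x u)) (at x)" if "x \<in> V" for x
    by (rule transport_has_derivative[OF c that Y])
  have "smooth_on V (\<lambda>x. Y x 1)"
  proof (rule smooth_on_bootstrap[OF V der])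
    show "Ck_on k V (\<lambda>x. Y x 1 ** \<Theta> x v)" if "Ck_on k V (\<lambda>x. Y x 1)" for k v
      by (rule Ck_on_bounded_bilinear[OF bounded_bilinear_matrix_mult V that])
        (use sm in \<open>simp add: smooth_on_def\<close>)
  qed
  then show ?thesis
    using der Y(3) by (intro exI[of _ "\<lambda>x. Y x 1"]) auto
qed

end

section \<open>The Lax connection of the partial system\<close>

lemma matrix_inv_orthogonal:
  fixes Q :: "real^'n^'n"
  assumes "orthogonal_matrix Q"
  shows "matrix_inv Q = transpose Q"
proof -
  have Q: "Q ** transpose Q = mat 1" "transpose Q ** Q = mat 1"
    using assms by (simp_all add: orthogonal_matrix_def)
  then have "Q ** matrix_inv Q = mat 1 \<and> matrix_inv Q ** Q = mat 1"
    unfolding matrix_inv_def by (rule someI_ex[of "\<lambda>A'. Q ** A' = mat 1 \<and> A' ** Q = mat 1", OF exI, OF conjI])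
  then have "transpose Q = transpose Q ** (Q ** matrix_inv Q)"
    by simp
  also have "\<dots> = matrix_inv Q"
    by (simp add: matrix_mul_assoc Q)
  finally show ?thesis ..
qed

lemma dif_pd:
  fixes f :: "real^'n \<Rightarrow> 'b::real_normed_vector"
  assumes "f differentiable (at x)"
  shows "dif f x u = (\<Sum>j\<in>UNIV. u $ j *\<^sub>R pd j f x)"
proof -
  have "dif f x u = dif f x (\<Sum>j\<in>UNIV. u $ j *\<^sub>R axis j 1)"
    by (simp add: basis_expansion scalar_mult_eq_scaleR[symmetric])
  then show ?thesis
    by (simp add: linear_sum[OF linear_dif[OF assms]] linear_scale[OF linear_dif[OF assms]] pd_def)
qed

lemma sum_UNIV_Plus:
  "(\<Sum>q\<in>(UNIV :: ('a::finite + 'b::finite) set). f q) = (\<Sum>a\<in>UNIV. f (Inl a)) + (\<Sum>b\<in>UNIV. f (Inr b))"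
  unfolding UNIV_Plus_UNIV[symmetric] by (subst sum.Plus) auto

text \<open>Converse of \<open>parallel_transport_exists\<close>: antisymmetrizing the second
  derivatives of \<open>g\<close> gives \<open>g x\<close> times the curvature, and
  \<open>g x\<close> can be cancelled.\<close>

lemma connection_of_frame_flat:
  fixes g :: "'a::euclidean_space \<Rightarrow> real^'k^'k"
  assumes V: "open V" and g: "smooth_on V g" and \<Theta>: "\<And>u. smooth_on V (\<lambda>x. \<Theta> x u)"
    and dg: "\<And>x u. x \<in> V \<Longrightarrow> dif g x u = g x ** \<Theta> x u"
    and orth: "\<And>x. x \<in> V \<Longrightarrow> orthogonal_matrix (g x)" and x: "x \<in> V"
  shows "dif (\<lambda>y. \<Theta> y w) x u - dif (\<lambda>y. \<Theta> y u) x w + \<Theta> x u ** \<Theta> x w - \<Theta> x w ** \<Theta> x u = 0"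
    (is "?K = 0")
proof -
  have *: "dif (\<lambda>y. dif g y w) x u = g x ** (dif (\<lambda>y. \<Theta> y w) x u + \<Theta> x u ** \<Theta> x w)" for u w
  proof -
    have "dif (\<lambda>y. dif g y w) x = dif (\<lambda>y. g y ** \<Theta> y w) x"
      by (rule dif_cong_open[OF V x dg])
    then show ?thesis
      by (simp add: dif_bounded_bilinear[OF bounded_bilinear_matrix_mult] smooth_on_differentiable[OF _ x] g \<Theta>
          dg[OF x] matrix_add_ldistrib matrix_mul_assoc)
  qed
  have "g x ** ?K = dif (\<lambda>y. dif g y w) x u - dif (\<lambda>y. dif g y u) x w"
    unfolding * by (simp add: matrix_diff_ldistrib matrix_add_ldistrib)
  also have "\<dots> = 0"
    using second_dif_commute[OF V g x, of w u] by simp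
  finally have "transpose (g x) ** (g x ** ?K) = 0"
    by simp
  then show ?thesis
    using orth[OF x] by (simp add: matrix_mul_assoc orthogonal_matrix_def)
qed

section \<open>The connection form of the star system\<close>

definition star_form ::
    "real^'n::finite^'m::finite \<Rightarrow> real^'n^'n \<Rightarrow> real^'n \<Rightarrow> real^'n \<Rightarrow> real^('m + 'n + 1)^('m + 'n + 1)"
  where "star_form A F b u = (\<Sum>i\<in>UNIV. u $ i *\<^sub>R star_coeff A F b i)"

lemma mult_Cmat: "(B ** Cmat i) $ k $ j = (if j = i then B $ k $ i else 0)" for B :: "'a::semiring_1^'n^'m"
proof (cases "j = i")
  case True
  have "(\<Sum>r\<in>UNIV. B $ k $ r * (if r = i then 1 else 0)) = (\<Sum>r\<in>UNIV. if r = i then B $ k $ r else 0)"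
    by (rule sum.cong) auto
  then show ?thesis
    using True by (simp add: matrix_matrix_mult_def Cmat_def)
qed (simp add: matrix_matrix_mult_def Cmat_def)

lemma Cmat_mult: "(Cmat i ** B) $ k $ j = (if k = i then B $ i $ j else 0)" for B :: "'a::semiring_1^'n^'m"
proof (cases "k = i")
  case True
  have "(\<Sum>r\<in>UNIV. (if r = i then 1 else 0) * B $ r $ j) = (\<Sum>r\<in>UNIV. if r = i then B $ r $ j else 0)"
    by (rule sum.cong) auto
  then show ?thesis
    using True by (simp add: matrix_matrix_mult_def Cmat_def)
qed (simp add: matrix_matrix_mult_def Cmat_def)

lemma star_coeff_entries:
  "star_coeff A F b i $ Inl k $ Inl l = 0"
  "star_coeff A F b i $ Inl k $ Inr (Inl j) = - (if j = i then A $ k $ i else 0)"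
  "star_coeff A F b i $ Inl k $ Inr (Inr z) = 0"
  "star_coeff A F b i $ Inr (Inl j) $ Inl k = (if j = i then A $ k $ i else 0)"
  "star_coeff A F b i $ Inr (Inl p) $ Inr (Inl q) = (if p = i then F $ i $ q else 0) - (if q = i then F $ i $ p else 0)"
  "star_coeff A F b i $ Inr (Inl j) $ Inr (Inr z) = (if j = i then b $ i else 0)"
  "star_coeff A F b i $ Inr (Inr z) $ Inl k = 0"
  "star_coeff A F b i $ Inr (Inr z) $ Inr (Inl j) = - (if j = i then b $ i else 0)"
  "star_coeff A F b i $ Inr (Inr z) $ Inr (Inr z') = 0"
  by (simp_all add: star_coeff_def block3_def mult_Cmat Cmat_mult transpose_def
      columnvector_def rowvector_def)

lemma star_form_entries:
  "star_form A F b u $ Inl k $ Inl l = 0"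
  "star_form A F b u $ Inl k $ Inr (Inl j) = - (u $ j * A $ k $ j)"
  "star_form A F b u $ Inl k $ Inr (Inr z) = 0"
  "star_form A F b u $ Inr (Inl j) $ Inl k = u $ j * A $ k $ j"
  "star_form A F b u $ Inr (Inl p) $ Inr (Inl q) = u $ p * F $ p $ q - u $ q * F $ q $ p"
  "star_form A F b u $ Inr (Inl j) $ Inr (Inr z) = u $ j * b $ j"
  "star_form A F b u $ Inr (Inr z) $ Inl k = 0"
  "star_form A F b u $ Inr (Inr z) $ Inr (Inl j) = - (u $ j * b $ j)"
  "star_form A F b u $ Inr (Inr z) $ Inr (Inr z') = 0"
  by (simp_all add: star_form_def star_coeff_entries right_diff_distrib sum_subtractf sum_negf
      if_distrib[where f = "\<lambda>x. c * x" for c] cong: if_cong)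

lemma all_block_index:
  "(\<forall>p :: 'm + 'n + 1. P p) \<longleftrightarrow> (\<forall>k. P (Inl k)) \<and> (\<forall>j. P (Inr (Inl j))) \<and> P (Inr (Inr 1))"
proof -
  have "(\<forall>z :: 1. Q z) \<longleftrightarrow> Q 1" for Q
    by (metis (full_types) num1_eq1)
  then show ?thesis
    unfolding split_sum_all by simp
qed

lemma map_matrix_star_coeff_eq_lax_coeff:
  "map_matrix complex_of_real (star_coeff A F b i) = lax_coeff 1 A F b i"
  unfolding vec_eq_iff all_block_index
  by (simp add: map_matrix_def star_coeff_entries lax_coeff_def Let_def block3_def mult_Cmat Cmat_mult
      transpose_def columnvector_def rowvector_def)

lemma transpose_star_form: "transpose (star_form A F b u) = - star_form A F b u"
  unfolding vec_eq_iff all_block_index by (simp add: transpose_def star_form_entries)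

lemma linear_star_form: "linear (star_form A F b)"
  unfolding star_form_def
  by (rule linearI) (simp_all add: scaleR_left_distrib sum.distrib scaleR_sum_right)

lemma smooth_on_star_form:
  assumes "smooth_on W A" "smooth_on W F" "smooth_on W b" "open W"
  shows "smooth_on W (\<lambda>x. star_form (A x) (F x) (b x) u)"
proof (intro smooth_on_vecI assms(4))
  note [smooth_intros] = assms
  have "\<forall>p q. smooth_on W (\<lambda>x. star_form (A x) (F x) (b x) u $ p $ q)"
    unfolding all_block_index by (simp add: star_form_entries) (intro conjI allI smooth_intros)
  then show "smooth_on W (\<lambda>x. star_form (A x) (F x) (b x) u $ p $ q)" for p q
    by blast
qed

lemma dif_matrix_entry:
  "f differentiable (at x) \<Longrightarrow> dif f x u $ p $ q = dif (\<lambda>y. f y $ p $ q :: real) x u"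
proof -
  assume f: "f differentiable (at x)"
  then have "(\<lambda>y. f y $ p) differentiable (at x)"
    using bounded_linear.has_derivative[OF bounded_linear_vec_nth] unfolding differentiable_def by blast
  then show ?thesis
    using dif_vec_nth[OF f, of p u] dif_vec_nth[of "\<lambda>y. f y $ p" x q u] by simp
qed

lemma dif_cmult: "f differentiable (at x) \<Longrightarrow> dif (\<lambda>y. c * f y) x u = c * dif f x (u :: 'a::real_normed_vector)" for c :: real
  by (rule dif_bounded_linear[OF bounded_linear_mult_right])

lemma dif_uminus: "f differentiable (at x) \<Longrightarrow> dif (\<lambda>y. - f y) x u = - dif f x u"
  by (rule dif_bounded_linear[OF bounded_linear_minus[OF bounded_linear_ident]])

lemma dif_diff:
  "f differentiable (at x) \<Longrightarrow> g differentiable (at x) \<Longrightarrow> dif (\<lambda>y. f y - g y) x u = dif f x u - dif g x u"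
  by (subst dif_eq[OF has_derivative_diff[of f "dif f x" _ g "dif g x"]]) (auto simp: frechet_derivative_works)

lemma dif_add:
  "f differentiable (at x) \<Longrightarrow> g differentiable (at x) \<Longrightarrow> dif (\<lambda>y. f y + g y) x u = dif f x u + dif g x u"
  by (subst dif_eq[OF has_derivative_add[of f "dif f x" _ g "dif g x"]]) (auto simp: frechet_derivative_works)

lemma dif_sum:
  "(\<And>i. i \<in> I \<Longrightarrow> f i differentiable (at x)) \<Longrightarrow> dif (\<lambda>y. \<Sum>i\<in>I. f i y) x u = (\<Sum>i\<in>I. dif (f i) x u)"
  by (subst dif_eq[OF has_derivative_sum[of I f "\<lambda>i. dif (f i) x"]]) (auto simp: frechet_derivative_works)

lemma dif_const: "dif (\<lambda>y. c) x u = 0"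
  by (subst dif_eq[OF has_derivative_const]) simp

lemma skew_matrix_entry: "transpose M = - M \<Longrightarrow> M $ q $ p = - M $ p $ q" for M :: "real^'n^'n"
  by (drule arg_cong[where f = "\<lambda>M. M $ p $ q"]) (simp add: transpose_def)

section \<open>Curvature d\<Theta> + \<Theta> \<and> \<Theta> of the star system, block by
  block\<close>

definition star_curvature ::
    "(real^'n \<Rightarrow> real^'n::finite^'m::finite) \<Rightarrow> (real^'n \<Rightarrow> real^'n^'n) \<Rightarrow> (real^'n \<Rightarrow> real^'n) \<Rightarrow>
      real^'n \<Rightarrow> real^'n \<Rightarrow> real^'n \<Rightarrow> real^('m + 'n + 1)^('m + 'n + 1)"
  where "star_curvature A F b x u w =
    dif (\<lambda>y. star_form (A y) (F y) (b y) w) x u - dif (\<lambda>y. star_form (A y) (F y) (b y) u) x w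
    + star_form (A x) (F x) (b x) u ** star_form (A x) (F x) (b x) w
    - star_form (A x) (F x) (b x) w ** star_form (A x) (F x) (b x) u"

context
  fixes W :: "(real^'n::finite) set" and A :: "real^'n \<Rightarrow> real^'n^'m::finite"
    and F :: "real^'n \<Rightarrow> real^'n^'n" and b :: "real^'n \<Rightarrow> real^'n" and x
  assumes W: "open W" "x \<in> W" and sm: "smooth_on W A" "smooth_on W F" "smooth_on W b"
begin

lemma differentiable_entries:
  "(\<lambda>y. A y $ k $ j) differentiable (at x)" "(\<lambda>y. F y $ i $ j) differentiable (at x)"
  "(\<lambda>y. b y $ i) differentiable (at x)"
  by (rule smooth_on_differentiable[OF _ W(2)], intro smooth_intros sm W)+

lemmas dif_entries = dif_cmult[OF differentiable_entries(1)] dif_cmult[OF differentiable_entries(2)]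
  dif_cmult[OF differentiable_entries(3)]

lemma differentiable_cmult_entries:
  "(\<lambda>y. c * A y $ k $ j) differentiable (at x)" "(\<lambda>y. c * F y $ i $ j) differentiable (at x)"
  "(\<lambda>y. c * b y $ i) differentiable (at x)"
  by (rule smooth_on_differentiable[OF _ W(2)], intro smooth_intros sm W)+

lemma star_curvature_entry:
  "star_curvature A F b x u w $ p $ q =
    dif (\<lambda>y. star_form (A y) (F y) (b y) w $ p $ q) x u - dif (\<lambda>y. star_form (A y) (F y) (b y) u $ p $ q) x w
    + (\<Sum>r\<in>UNIV. star_form (A x) (F x) (b x) u $ p $ r * star_form (A x) (F x) (b x) w $ r $ q)
    - (\<Sum>r\<in>UNIV. star_form (A x) (F x) (b x) w $ p $ r * star_form (A x) (F x) (b x) u $ r $ q)"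
  unfolding star_curvature_def
  by (simp add: dif_matrix_entry smooth_on_differentiable[OF smooth_on_star_form[OF sm W(1)] W(2)]
      matrix_matrix_mult_def)

lemmas star_curvature_simps = star_curvature_entry star_form_entries sum_UNIV_Plus

lemmas dif_entry_simps = dif_const dif_entries dif_uminus[OF differentiable_cmult_entries(1)]
  dif_uminus[OF differentiable_cmult_entries(3)]
  dif_diff[OF differentiable_cmult_entries(2) differentiable_cmult_entries(2)]
  dif_pd[OF differentiable_entries(1)] dif_pd[OF differentiable_entries(2)] dif_pd[OF differentiable_entries(3)]

text \<open>In this block and the next two the connection has zero entries, and each product is
  symmetric in \<open>u\<close> and \<open>w\<close> because \<open>Cmat i ** Cmat j\<close>
  vanishes for different indices; so the curvature vanishes identically.\<close>

lemma star_curvature_normal_normal: "star_curvature A F b x u w $ Inl k $ Inl l = 0"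
  unfolding star_curvature_simps by (simp add: dif_const sum_subtractf[symmetric] mult_ac)

lemma star_curvature_normal_position: "star_curvature A F b x u w $ Inl k $ Inr (Inr z) = 0"
  unfolding star_curvature_simps by (simp add: dif_const sum_subtractf[symmetric] mult_ac)

lemma star_curvature_position_position: "star_curvature A F b x u w $ Inr (Inr z) $ Inr (Inr z') = 0"
  unfolding star_curvature_simps by (simp add: dif_const sum_subtractf[symmetric] mult_ac)

text \<open>The factors are 2 by 2 minors of \<open>u\<close> and \<open>w\<close>, which vanish for
  equal indices. This is why the equations of the system exclude equal indices.\<close>

lemma star_curvature_normal_tangent:
  "star_curvature A F b x u w $ Inl k $ Inr (Inl q) =
    (\<Sum>j\<in>UNIV. (u $ q * w $ j - w $ q * u $ j) * (pd j (\<lambda>y. A y $ k $ q) x - F x $ q $ j * A x $ k $ j))"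
  unfolding star_curvature_simps
  by (simp add: dif_entry_simps)
    (simp add: sum_distrib_left sum_subtractf[symmetric] sum.distrib[symmetric] sum_negf[symmetric] algebra_simps)

lemma star_curvature_tangent_position:
  "star_curvature A F b x u w $ Inr (Inl p) $ Inr (Inr z) =
    (\<Sum>j\<in>UNIV. (w $ p * u $ j - u $ p * w $ j) * (pd j (\<lambda>y. b y $ p) x - F x $ p $ j * b x $ j))"
  unfolding star_curvature_simps
  by (simp add: dif_entry_simps)
    (simp add: sum_distrib_left sum_subtractf[symmetric] sum.distrib[symmetric] sum_negf[symmetric] algebra_simps)

text \<open>For \<open>p\<close> and \<open>q\<close> different, orthogonal columns of
  \<open>A\<close> remove the Gram term; the derivatives at \<open>r = q\<close> and
  \<open>r = p\<close> in the two sums then complete the first factor to the first equation of the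
  system.\<close>

lemma star_curvature_tangent_tangent:
  "star_curvature A F b x u w $ Inr (Inl p) $ Inr (Inl q) =
    (w $ p * u $ q - u $ p * w $ q) *
      ((\<Sum>k\<in>UNIV. A x $ k $ p * A x $ k $ q) + b x $ p * b x $ q + (\<Sum>r\<in>UNIV. F x $ p $ r * F x $ q $ r))
    + (\<Sum>r\<in>UNIV. (u $ p * w $ r - w $ p * u $ r) * (F x $ p $ r * F x $ r $ q - pd r (\<lambda>y. F y $ p $ q) x))
    + (\<Sum>r\<in>UNIV. (u $ r * w $ q - w $ r * u $ q) * (F x $ r $ p * F x $ q $ r - pd r (\<lambda>y. F y $ q $ p) x))"
proof -
  \<comment> \<open>\<open>a\<close>, \<open>d\<close> and \<open>f\<close> are the contributions of
    the normal directions, of the derivatives and of the tangent directions; the position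
    contributes the product of the entries of \<open>b\<close>.\<close>
  have a: "(\<Sum>k\<in>UNIV. (u $ p * A x $ k $ p) * - (w $ q * A x $ k $ q)) - (\<Sum>k\<in>UNIV. (w $ p * A x $ k $ p) * - (u $ q * A x $ k $ q))
    = (w $ p * u $ q - u $ p * w $ q) * (\<Sum>k\<in>UNIV. A x $ k $ p * A x $ k $ q)"
    by (simp add: sum_distrib_left sum_subtractf[symmetric] sum_negf[symmetric] algebra_simps)
  have d: "dif (\<lambda>y. w $ p * F y $ p $ q - w $ q * F y $ q $ p) x u - dif (\<lambda>y. u $ p * F y $ p $ q - u $ q * F y $ q $ p) x w
    = (\<Sum>r\<in>UNIV. (u $ p * w $ r - w $ p * u $ r) * - pd r (\<lambda>y. F y $ p $ q) x)
    + (\<Sum>r\<in>UNIV. (u $ r * w $ q - w $ r * u $ q) * - pd r (\<lambda>y. F y $ q $ p) x)"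
    by (simp add: dif_entry_simps)
      (simp add: sum_distrib_left sum_subtractf[symmetric] sum.distrib[symmetric] sum_negf[symmetric] algebra_simps)
  have f: "(\<Sum>r\<in>UNIV. (u $ p * F x $ p $ r - u $ r * F x $ r $ p) * (w $ r * F x $ r $ q - w $ q * F x $ q $ r))
    - (\<Sum>r\<in>UNIV. (w $ p * F x $ p $ r - w $ r * F x $ r $ p) * (u $ r * F x $ r $ q - u $ q * F x $ q $ r))
    = (w $ p * u $ q - u $ p * w $ q) * (\<Sum>r\<in>UNIV. F x $ p $ r * F x $ q $ r)
    + (\<Sum>r\<in>UNIV. (u $ p * w $ r - w $ p * u $ r) * (F x $ p $ r * F x $ r $ q))
    + (\<Sum>r\<in>UNIV. (u $ r * w $ q - w $ r * u $ q) * (F x $ r $ p * F x $ q $ r))"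
    unfolding sum_distrib_left sum_subtractf[symmetric] sum.distrib[symmetric]
    by (rule sum.cong[OF refl]) algebra
  show ?thesis
    using a d f unfolding star_curvature_simps
    by (simp add: right_diff_distrib sum_subtractf sum_negf) (simp add: algebra_simps)
qed

text \<open>Derivatives and commutators of skew matrices are skew, so only the blocks on and above
  the diagonal have to be computed.\<close>

lemma transpose_star_curvature: "transpose (star_curvature A F b x u w) = - star_curvature A F b x u w"
proof -
  have "star_curvature A F b x u w $ q $ p = - star_curvature A F b x u w $ p $ q" for p q
  proof -
    have sk: "star_form A' F' b' v $ r $ s = - star_form A' F' b' v $ s $ r"
      for A' :: "real^'n^'m" and F' b' v r s
      by (rule skew_matrix_entry[OF transpose_star_form])
    have 1: "dif (\<lambda>y. star_form (A y) (F y) (b y) v $ q $ p) x v' = - dif (\<lambda>y. star_form (A y) (F y) (b y) v $ p $ q) x v'" for v v'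
    proof -
      have "(\<lambda>y. star_form (A y) (F y) (b y) v $ q $ p) = (\<lambda>y. - star_form (A y) (F y) (b y) v $ p $ q)"
        using sk by blast
      moreover have "(\<lambda>y. star_form (A y) (F y) (b y) v $ p $ q) differentiable (at x)"
        by (rule smooth_on_differentiable[OF _ W(2)], intro smooth_intros smooth_on_star_form sm W)
      ultimately show ?thesis
        using dif_uminus by simp
    qed
    have 2: "star_form (A x) (F x) (b x) v $ q $ r * star_form (A x) (F x) (b x) v' $ r $ p
      = star_form (A x) (F x) (b x) v' $ p $ r * star_form (A x) (F x) (b x) v $ r $ q" for v v' r
      using sk[of "A x" "F x" "b x" v q r] sk[of "A x" "F x" "b x" v' r p] by simp
    have 3: "(\<Sum>r\<in>UNIV. star_form (A x) (F x) (b x) v $ q $ r * star_form (A x) (F x) (b x) v' $ r $ p)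
      = (\<Sum>r\<in>UNIV. star_form (A x) (F x) (b x) v' $ p $ r * star_form (A x) (F x) (b x) v $ r $ q)" for v v'
      by (rule sum.cong[OF refl 2])
    show ?thesis
      using star_curvature_entry[of u w q p] star_curvature_entry[of u w p q] 1[of w u] 1[of u w] 3[of u w] 3[of w u]
      by linarith
  qed
  note sk = this
  show ?thesis
    unfolding vec_eq_iff
  proof (intro allI)
    show "transpose (star_curvature A F b x u w) $ p $ q = (- star_curvature A F b x u w) $ p $ q" for p q
      using sk[of p q] by (simp only: transpose_def vec_lambda_beta vector_uminus_component)
  qed
qed

text \<open>The hypothesis on the columns of \<open>A\<close> admits \<open>A = 0\<close>, which gives the connection at \<open>\<lambda> = 0\<close>.\<close>

lemma star_curvature_eq_0:
  assumes orth: "\<And>i j. i \<noteq> j \<Longrightarrow> (\<Sum>k\<in>UNIV. A x $ k $ i * A x $ k $ j) = 0"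
    and diag: "\<And>y i. y \<in> W \<Longrightarrow> F y $ i $ i = 0"
    and F1: "\<And>i j. i \<noteq> j \<Longrightarrow> pd j (\<lambda>y. F y $ i $ j) x + pd i (\<lambda>y. F y $ j $ i) x
          + (\<Sum>k\<in>UNIV. F x $ i $ k * F x $ j $ k) + b x $ i * b x $ j = 0"
    and F2: "\<And>i j k. i \<noteq> j \<Longrightarrow> j \<noteq> k \<Longrightarrow> i \<noteq> k \<Longrightarrow> pd k (\<lambda>y. F y $ i $ j) x = F x $ i $ k * F x $ k $ j"
    and b: "\<And>i j. i \<noteq> j \<Longrightarrow> pd j (\<lambda>y. b y $ i) x = F x $ i $ j * b x $ j"
    and A: "\<And>k i j. i \<noteq> j \<Longrightarrow> pd j (\<lambda>y. A y $ k $ i) x = F x $ i $ j * A x $ k $ j"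
  shows "star_curvature A F b x u w = 0"
proof -
  have Fx: "F x $ i $ i = 0" for i by (rule diag[OF W(2)])
  have pdF: "pd r (\<lambda>y. F y $ i $ i) x = 0" for r i
  proof -
    have "dif (\<lambda>y. F y $ i $ i) x = dif (\<lambda>y. 0) x"
      by (rule dif_cong_open[OF W]) (rule diag)
    then show ?thesis by (simp add: pd_def dif_const)
  qed
  have nt: "star_curvature A F b x u w $ Inl k $ Inr (Inl q) = 0" for k q
    unfolding star_curvature_normal_tangent
  proof (rule sum.neutral, rule ballI)
    show "(u $ q * w $ j - w $ q * u $ j) * (pd j (\<lambda>y. A y $ k $ q) x - F x $ q $ j * A x $ k $ j) = 0" for j
      using A[of q j k] by (cases "j = q") auto
  qed
  have tp: "star_curvature A F b x u w $ Inr (Inl p) $ Inr (Inr z) = 0" for p z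
    unfolding star_curvature_tangent_position
  proof (rule sum.neutral, rule ballI)
    show "(w $ p * u $ j - u $ p * w $ j) * (pd j (\<lambda>y. b y $ p) x - F x $ p $ j * b x $ j) = 0" for j
      using b[of p j] by (cases "j = p") auto
  qed
  have tt: "star_curvature A F b x u w $ Inr (Inl p) $ Inr (Inl q) = 0" for p q
  proof (cases "p = q")
    case True
    then show ?thesis
      unfolding star_curvature_tangent_tangent
      by (simp add: pdF sum.distrib[symmetric] algebra_simps)
  next
    case False
    \<comment> \<open>The term \<open>r = p\<close> vanishes as a minor with equal indices, those
      with \<open>r\<close> distinct from both indices by \<open>F2\<close>. At \<open>r = q\<close>
      the product vanishes with the diagonal of \<open>F\<close>, and only the derivative is
      left.\<close>
    have s1: "(\<Sum>r\<in>UNIV. (u $ p * w $ r - w $ p * u $ r) * (F x $ p $ r * F x $ r $ q - pd r (\<lambda>y. F y $ p $ q) x))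
      = (\<Sum>r\<in>UNIV. if r = q then (u $ p * w $ q - w $ p * u $ q) * (- pd q (\<lambda>y. F y $ p $ q) x) else 0)"
    proof (rule sum.cong[OF refl])
      show "(u $ p * w $ r - w $ p * u $ r) * (F x $ p $ r * F x $ r $ q - pd r (\<lambda>y. F y $ p $ q) x)
        = (if r = q then (u $ p * w $ q - w $ p * u $ q) * (- pd q (\<lambda>y. F y $ p $ q) x) else 0)" for r
        using F2[of p q r] False Fx by (cases "r = q"; cases "r = p") auto
    qed
    have s2: "(\<Sum>r\<in>UNIV. (u $ r * w $ q - w $ r * u $ q) * (F x $ r $ p * F x $ q $ r - pd r (\<lambda>y. F y $ q $ p) x))
      = (\<Sum>r\<in>UNIV. if r = p then (u $ p * w $ q - w $ p * u $ q) * (- pd p (\<lambda>y. F y $ q $ p) x) else 0)"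
    proof (rule sum.cong[OF refl])
      show "(u $ r * w $ q - w $ r * u $ q) * (F x $ r $ p * F x $ q $ r - pd r (\<lambda>y. F y $ q $ p) x)
        = (if r = p then (u $ p * w $ q - w $ p * u $ q) * (- pd p (\<lambda>y. F y $ q $ p) x) else 0)" for r
        using F2[of q p r] False Fx by (cases "r = q"; cases "r = p") (auto simp: mult.commute)
    qed
    show ?thesis
      unfolding star_curvature_tangent_tangent s1 s2 sum.delta[OF finite_class.finite_UNIV] orth[OF False]
      using F1[OF False] by simp algebra
  qed
  note sk = skew_matrix_entry[OF transpose_star_curvature]
  have nt': "star_curvature A F b x u w $ Inr (Inl q) $ Inl k = 0" for k q
    using sk[of u w "Inr (Inl q)" "Inl k"] nt[of k q] by linarith
  have tp': "star_curvature A F b x u w $ Inr (Inr z) $ Inr (Inl p) = 0" for p z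
    using sk[of u w "Inr (Inr z)" "Inr (Inl p)"] tp[of p z] by linarith
  have np': "star_curvature A F b x u w $ Inr (Inr z) $ Inl k = 0" for k z
    using sk[of u w "Inr (Inr z)" "Inl k"] star_curvature_normal_position[of u w k z] by linarith
  show ?thesis
    unfolding vec_eq_iff all_block_index
    by (simp add: nt tp tt nt' tp' np' star_curvature_normal_normal star_curvature_normal_position star_curvature_position_position)
qed

text \<open>Coordinate fields turn the minors into 0 or 1 up to sign and so isolate single
  equations. The equation for \<open>b\<close> is left to the place where \<open>F\<close> is
  defined by it.\<close>

lemma star_curvature_eq_0_imp:
  assumes flat: "\<And>u w. star_curvature A F b x u w = 0"
    and orth: "\<And>i j. i \<noteq> j \<Longrightarrow> (\<Sum>k\<in>UNIV. A x $ k $ i * A x $ k $ j) = 0"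
    and diag: "\<And>i. F x $ i $ i = 0" and ij: "i \<noteq> j"
  shows "pd j (\<lambda>y. F y $ i $ j) x + pd i (\<lambda>y. F y $ j $ i) x
          + (\<Sum>k\<in>UNIV. F x $ i $ k * F x $ j $ k) + b x $ i * b x $ j = 0"
    and "j \<noteq> k \<Longrightarrow> i \<noteq> k \<Longrightarrow> pd k (\<lambda>y. F y $ i $ j) x = F x $ i $ k * F x $ k $ j"
    and "pd j (\<lambda>y. A y $ l $ i) x = F x $ i $ j * A x $ l $ j"
proof -
  have axis: "axis p (1::real) $ q = (if q = p then 1 else 0)" for p q :: 'n
    by (simp add: axis_def)
  show "pd j (\<lambda>y. A y $ l $ i) x = F x $ i $ j * A x $ l $ j"
    using star_curvature_normal_tangent[of "axis i 1" "axis j 1" l i] ij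
    by (simp add: flat axis if_distrib[where f = "\<lambda>c. c * _"] cong: if_cong)
  show "pd k (\<lambda>y. F y $ i $ j) x = F x $ i $ k * F x $ k $ j" if "j \<noteq> k" "i \<noteq> k"
    using star_curvature_tangent_tangent[of "axis i 1" "axis k 1" i j] ij that
    by (simp add: flat axis if_distrib[where f = "\<lambda>c. c * _"] cong: if_cong)
  show "pd j (\<lambda>y. F y $ i $ j) x + pd i (\<lambda>y. F y $ j $ i) x
          + (\<Sum>k\<in>UNIV. F x $ i $ k * F x $ j $ k) + b x $ i * b x $ j = 0"
    using star_curvature_tangent_tangent[of "axis i 1" "axis j 1" i j] ij orth[OF ij]
    by (simp add: flat axis diag if_distrib[where f = "\<lambda>c. c * _"] cong: if_cong)
qed

end

section \<open>Charts of the sphere\<close>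

lemma sphere_valued_dif_orthogonal:
  fixes X :: "'a::real_normed_vector \<Rightarrow> 'e::euclidean_space"
  assumes "open W" "smooth_on W X" "X ` W \<subseteq> sphere 0 1" "x \<in> W"
  shows "dif X x v \<bullet> X x = 0"
proof -
  have "dif (\<lambda>y. X y \<bullet> X y) x = dif (\<lambda>y. 1) x"
  proof (rule dif_cong_open[OF assms(1,4)])
    show "X y \<bullet> X y = 1" if "y \<in> W" for y
      using assms(3) that by (auto simp: dot_square_norm)
  qed
  moreover have "dif (\<lambda>y. X y \<bullet> X y) x v = X x \<bullet> dif X x v + dif X x v \<bullet> X x"
    by (rule dif_inner) (rule smooth_on_differentiable[OF assms(2,4)])+
  ultimately show ?thesis
    by (simp add: dif_const inner_commute)
qed

text \<open>Together with \<open>cone_point\<close>, the identification of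
  \<open>real^('n + 1)\<close> with pairs of a point \<open>x\<close> and a radius \<open>r\<close>;
  the radius sits in the last block.\<close>

definition cone_base :: "real^('n::finite + 1) \<Rightarrow> real^'n"
  where "cone_base z = (\<chi> i. z $ Inl i)"

definition cone_point :: "real \<Rightarrow> real^'n::finite \<Rightarrow> real^('n + 1)"
  where "cone_point r x = (\<chi> q. case q of Inl i \<Rightarrow> x $ i | Inr _ \<Rightarrow> r)"

lemma cone_simps[simp]:
  "cone_base (cone_point r x) = x" "cone_point r x $ Inr z = r" "cone_point r x $ Inl i = x $ i"
  by (simp_all add: cone_base_def cone_point_def vec_eq_iff)

lemma cone_point_base: "cone_point (z $ Inr 1) (cone_base z) = z"
  unfolding vec_eq_iff split_sum_all by (simp add: cone_base_def)

lemma linear_cone_base: "linear cone_base"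
  by (rule linearI) (simp_all add: cone_base_def vec_eq_iff)

lemma linear_cone_point_0: "linear (cone_point 0)"
  by (rule linearI) (simp_all add: cone_point_def vec_eq_iff split_sum_all)

lemma cone_point_eq: "cone_point r x = cone_point 0 x + r *\<^sub>R axis (Inr 1) 1"
proof -
  have "z = 1" for z :: 1 by (rule num1_eq1)
  then show ?thesis
    unfolding vec_eq_iff split_sum_all by (auto simp: axis_def)
qed

lemma smooth_on_cone_base: "open S \<Longrightarrow> smooth_on S cone_base"
  using smooth_on_bounded_linear[OF linear_cone_base[unfolded linear_conv_bounded_linear] smooth_on_id] .

text \<open>A sphere-valued immersion extends to the map \<open>(x, r) \<mapsto> r \<phi> x\<close> between spaces of the same
  dimension, to which the inverse function theorem applies.\<close>

lemma sphere_immersion_local_inverse: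
  fixes \<phi> :: "real^'n \<Rightarrow> real^('n::finite + 1)"
  assumes W: "open W" "smooth_on W \<phi>" "\<phi> ` W \<subseteq> sphere 0 1" "x0 \<in> W" and inj: "inj (dif \<phi> x0)"
  obtains W' V \<rho> where "open W'" "W' \<subseteq> W" "x0 \<in> W'" "open V" "smooth_on V \<rho>"
    "\<And>x. x \<in> W' \<Longrightarrow> \<phi> x \<in> V \<and> \<rho> (\<phi> x) = x"
    "\<And>y. y \<in> V \<Longrightarrow> norm y = 1 \<Longrightarrow> \<rho> y \<in> W' \<and> \<phi> (\<rho> y) = y"
proof -
  define \<Phi> where "\<Phi> = (\<lambda>z. z $ Inr 1 *\<^sub>R \<phi> (cone_base z))"
  define U where "U = {z. cone_base z \<in> W \<and> z $ Inr 1 > 0}"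
  have contb: "continuous_on S cone_base" for S :: "(real^('n + 1)) set"
    using linear_cone_base linear_continuous_on linear_conv_bounded_linear by blast
  have "U = (cone_base -` W) \<inter> {z. 0 < z $ Inr 1}"
    by (auto simp: U_def)
  moreover have "open (cone_base -` W)"
    by (rule open_vimage[OF W(1) contb])
  moreover have "open {z :: real^('n + 1). 0 < z $ Inr 1}"
    by (intro open_Collect_less continuous_intros)
  ultimately have U: "open U"
    by auto
  have smc: "smooth_on U (\<lambda>z. \<phi> (cone_base z))"
    by (rule smooth_on_compose[OF W(2) smooth_on_cone_base[OF U] U W(1)]) (auto simp: U_def)
  have sm\<Phi>: "smooth_on U \<Phi>"
    unfolding \<Phi>_def by (intro smooth_intros smc U)
  have d\<Phi>: "dif \<Phi> z \<zeta> = z $ Inr 1 *\<^sub>R dif \<phi> (cone_base z) (cone_base \<zeta>) + \<zeta> $ Inr 1 *\<^sub>R \<phi> (cone_base z)"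
    if z: "z \<in> U" for z \<zeta>
  proof -
    have 1: "(\<lambda>z. z $ Inr 1) differentiable (at z)" "(\<lambda>z. \<phi> (cone_base z)) differentiable (at z)"
      by (rule smooth_on_differentiable[OF _ z], intro smooth_intros U smc)+
    have 2: "dif (\<lambda>z::real^('n + 1). z $ Inr 1) z \<zeta> = \<zeta> $ Inr 1"
      by (subst dif_eq[OF bounded_linear_imp_has_derivative[OF bounded_linear_vec_nth]]) simp
    have 3: "dif (\<lambda>z. \<phi> (cone_base z)) z \<zeta> = dif \<phi> (cone_base z) (cone_base \<zeta>)"
      by (subst dif_eq[OF has_derivative_compose[of cone_base cone_base _ _ \<phi> "dif \<phi> (cone_base z)"]])
        (use z W(2) linear_cone_base in \<open>auto simp: U_def linear_conv_bounded_linear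
          intro!: bounded_linear_imp_has_derivative smooth_on_has_derivative\<close>)
    show ?thesis
      unfolding \<Phi>_def using dif_scaleR[OF 1, of \<zeta>] by (simp add: 2 3)
  qed
  have x0: "cone_point 1 x0 \<in> U"
    using W(4) by (simp add: U_def)
  have "inj (dif \<Phi> (cone_point 1 x0))"
    unfolding linear_injective_0[OF smooth_on_linear_dif[OF sm\<Phi> x0]]
  proof (intro allI impI)
    fix \<zeta> assume "dif \<Phi> (cone_point 1 x0) \<zeta> = 0"
    then have 0: "dif \<phi> x0 (cone_base \<zeta>) + \<zeta> $ Inr 1 *\<^sub>R \<phi> x0 = 0"
      by (simp add: d\<Phi>[OF x0])
    then have "(dif \<phi> x0 (cone_base \<zeta>) + \<zeta> $ Inr 1 *\<^sub>R \<phi> x0) \<bullet> \<phi> x0 = 0"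
      by simp
    moreover have "\<phi> x0 \<bullet> \<phi> x0 = 1"
      using W(3,4) by (auto simp: dot_square_norm)
    \<comment> \<open>The inner product with \<open>\<phi> x0\<close> separates the radial from the
      tangential part.\<close>
    ultimately have r: "\<zeta> $ Inr 1 = 0"
      by (simp add: inner_add_left sphere_valued_dif_orthogonal[OF W])
    with 0 have "dif \<phi> x0 (cone_base \<zeta>) = 0"
      by simp
    then have "cone_base \<zeta> = 0"
      using inj linear_injective_0[OF smooth_on_linear_dif[OF W(2,4)]] by blast
    then show "\<zeta> = 0"
      using cone_point_base[of \<zeta>] r linear_0[OF linear_cone_point_0] by metis
  qed
  then obtain U' V \<Gamma> where *: "open U'" "U' \<subseteq> U" "cone_point 1 x0 \<in> U'" "open V"
    "homeomorphism U' V \<Phi> \<Gamma>" "smooth_on V \<Gamma>"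
    using smooth_inverse_function[OF U sm\<Phi> x0] by metis
  define W' where "W' = cone_point 1 -` U'"
  define \<rho> where "\<rho> = (\<lambda>y. cone_base (\<Gamma> y))"
  show thesis
  proof (rule that[of W' V \<rho>])
    have "continuous_on UNIV (\<lambda>x. cone_point 0 x + 1 *\<^sub>R axis (Inr 1) 1 :: real^('n + 1))"
      using linear_cone_point_0 by (intro continuous_intros linear_continuous_on) (simp add: linear_conv_bounded_linear)
    then have "continuous_on UNIV (cone_point 1 :: real^'n \<Rightarrow> _)"
      by (subst (asm) cone_point_eq[symmetric])
    then show "open W'"
      unfolding W'_def by (rule open_vimage[OF *(1)])
    show "W' \<subseteq> W" using *(2) by (auto simp: W'_def U_def)
    show "x0 \<in> W'" using *(3) by (simp add: W'_def)
    show "open V" by fact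
    show "smooth_on V \<rho>"
      unfolding \<rho>_def using smooth_on_bounded_linear[OF _ *(6,4)] linear_cone_base linear_conv_bounded_linear by blast
    show "\<phi> x \<in> V \<and> \<rho> (\<phi> x) = x" if "x \<in> W'" for x
    proof -
      have "cone_point 1 x \<in> U'" using that by (simp add: W'_def)
      then have "\<Phi> (cone_point 1 x) \<in> V" "\<Gamma> (\<Phi> (cone_point 1 x)) = cone_point 1 x"
        using *(5) by (auto simp: homeomorphism_def)
      then show ?thesis by (simp add: \<Phi>_def \<rho>_def)
    qed
    show "\<rho> y \<in> W' \<and> \<phi> (\<rho> y) = y" if "y \<in> V" "norm y = 1" for y
    proof -
      define z where "z = \<Gamma> y"
      have z: "z \<in> U'" "\<Phi> z = y"
        using *(5) that by (auto simp: homeomorphism_def z_def)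
      then have "cone_base z \<in> W" "z $ Inr 1 > 0"
        using *(2) by (auto simp: U_def)
      \<comment> \<open>\<phi> has unit length, so the norm of the image is the radius. Over the
        unit sphere it must be 1, which puts the preimage into the slice on which \<Phi> is
        \<phi>.\<close>
      moreover from this have "norm (\<Phi> z) = z $ Inr 1"
        using W(3) by (auto simp: \<Phi>_def)
      ultimately have z1: "z $ Inr 1 = 1" using z(2) that(2) by simp
      then have "z = cone_point 1 (cone_base z)"
        using cone_point_base[of z] by simp
      then show ?thesis
        using z z1 by (simp add: \<rho>_def z_def[symmetric] W'_def \<Phi>_def)
    qed
  qed
qed

lemma sphere_chart_local_inverse:
  fixes \<phi> :: "real^'n \<Rightarrow> real^('n::finite + 1)"
  assumes "sphere_chart W \<phi>" "y0 \<in> \<phi> ` W"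
  obtains V \<rho> where "open V" "y0 \<in> V" "smooth_on V \<rho>"
    "\<And>y. y \<in> V \<Longrightarrow> norm y = 1 \<Longrightarrow> \<rho> y \<in> W \<and> \<phi> (\<rho> y) = y"
proof -
  obtain x0 where x0: "x0 \<in> W" "y0 = \<phi> x0" using assms(2) by auto
  with assms(1) have "open W" "smooth_on W \<phi>" "\<phi> ` W \<subseteq> sphere 0 1" "inj (dif \<phi> x0)"
    by (auto simp: sphere_chart_def)
  from sphere_immersion_local_inverse[OF this(1-3) x0(1) this(4)] show ?thesis
    using that x0 by (metis subsetD)
qed

section \<open>Images and changes of charts\<close>

lemma openin_sphere_chart_image:
  fixes \<phi> :: "real^'n \<Rightarrow> real^('n::finite + 1)"
  assumes "sphere_chart W \<phi>"
  shows "openin (top_of_set (sphere 0 1)) (\<phi> ` W)"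
proof (subst openin_subopen, intro ballI)
  fix y0 assume "y0 \<in> \<phi> ` W"
  then obtain V \<rho> where V: "open V" "y0 \<in> V" "\<And>y. y \<in> V \<Longrightarrow> norm y = 1 \<Longrightarrow> \<rho> y \<in> W \<and> \<phi> (\<rho> y) = y"
    using sphere_chart_local_inverse[OF assms] by metis
  have "y0 \<in> sphere 0 1"
    using \<open>y0 \<in> \<phi> ` W\<close> assms by (auto simp: sphere_chart_def)
  moreover have "sphere 0 1 \<inter> V \<subseteq> \<phi> ` W"
  proof
    fix y assume "y \<in> sphere 0 1 \<inter> V"
    then have "\<rho> y \<in> W" "\<phi> (\<rho> y) = y" using V(3)[of y] by auto
    then show "y \<in> \<phi> ` W" by (metis imageI)
  qed
  ultimately show "\<exists>T. openin (top_of_set (sphere 0 1)) T \<and> y0 \<in> T \<and> T \<subseteq> \<phi> ` W"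
    using V(1,2) by (intro exI[of _ "sphere 0 1 \<inter> V"]) auto
qed

text \<open>\<open>the_inv_into W \<phi>\<close> is meaningful only on a subset of the sphere, which
  is not open in the ambient space, so its smoothness is expressed after composition with a map such
  as \<psi>. Locally it is the restriction of a smooth map \<rho> on an ambient open set.\<close>

lemma smooth_on_inverse_chart_compose:
  fixes \<phi> :: "real^'n \<Rightarrow> real^('n::finite + 1)" and \<psi> :: "'a::euclidean_space \<Rightarrow> real^('n + 1)"
  assumes "sphere_chart W \<phi>" and S: "open S" "smooth_on S \<psi>" "\<psi> ` S \<subseteq> \<phi> ` W"
  shows "smooth_on S (\<lambda>y. the_inv_into W \<phi> (\<psi> y))"
proof (rule smooth_on_local)
  fix y0 assume "y0 \<in> S"
  then have "\<psi> y0 \<in> \<phi> ` W" using S(3) by auto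
  then obtain V \<rho> where V: "open V" "\<psi> y0 \<in> V" "smooth_on V \<rho>"
      "\<And>y. y \<in> V \<Longrightarrow> norm y = 1 \<Longrightarrow> \<rho> y \<in> W \<and> \<phi> (\<rho> y) = y"
    using sphere_chart_local_inverse[OF assms(1)] by metis
  define T where "T = S \<inter> \<psi> -` V"
  have T: "open T" "y0 \<in> T"
    unfolding T_def using continuous_open_preimage[OF smooth_on_continuous_on[OF S(2)] S(1) V(1)] V(2) \<open>y0 \<in> S\<close>
    by auto
  have "smooth_on T (\<lambda>y. \<rho> (\<psi> y))"
    by (rule smooth_on_compose[OF V(3) smooth_on_subset[OF S(2)] T(1) V(1)]) (auto simp: T_def)
  moreover have "\<rho> (\<psi> y) = the_inv_into W \<phi> (\<psi> y)" if "y \<in> T" for y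
  proof -
    have "norm (\<psi> y) = 1"
      using S(3) that assms(1) by (auto simp: T_def sphere_chart_def subset_iff)
    then have "\<rho> (\<psi> y) \<in> W" "\<phi> (\<rho> (\<psi> y)) = \<psi> y"
      using V(4)[of "\<psi> y"] that by (auto simp: T_def)
    then show ?thesis
      using the_inv_into_f_eq[of \<phi> W "\<rho> (\<psi> y)" "\<psi> y"] assms(1) by (auto simp: sphere_chart_def)
  qed
  ultimately have "smooth_on T (\<lambda>y. the_inv_into W \<phi> (\<psi> y))"
    by (rule smooth_on_cong[OF _ T(1)])
  then show "\<exists>T. open T \<and> y0 \<in> T \<and> smooth_on T (\<lambda>y. the_inv_into W \<phi> (\<psi> y))"
    using T by blast
qed

lemma first_ff_compose:
  fixes X :: "real^'n::finite \<Rightarrow> 'e::euclidean_space" and \<tau> :: "real^'k::finite \<Rightarrow> real^'n"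
  assumes "\<tau> differentiable (at y)" "X differentiable (at (\<tau> y))"
  shows "first_ff (\<lambda>y. X (\<tau> y)) y u w = first_ff X (\<tau> y) (dif \<tau> y u) (dif \<tau> y w)"
  unfolding first_ff_def by (simp add: dif_compose[OF assms])

text \<open>Every chart \<psi> into the image factors as \<phi> after a smooth \<tau>, and first
  fundamental forms pull back along \<tau>; hence the comparison in the one chart \<phi> implies the
  condition in all charts.\<close>

lemma isometric_immersion_of_same_first_ff:
  fixes \<phi> :: "real^'n \<Rightarrow> real^('n::finite + 1)" and X :: "real^'n \<Rightarrow> real^('m::finite + 'n + 1)"
  assumes \<phi>: "sphere_chart W \<phi>" and X: "smooth_on W X" "X ` W \<subseteq> sphere 0 1"
    and ff: "\<And>x u w. x \<in> W \<Longrightarrow> first_ff X x u w = first_ff \<phi> x u w"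
  shows "isometric_immersion (\<phi> ` W) (\<lambda>y. X (the_inv_into W \<phi> y))"
proof -
  have W: "open W" "smooth_on W \<phi>" "inj_on \<phi> W"
    using \<phi> by (auto simp: sphere_chart_def)
  have "smooth_on S ((\<lambda>y. X (the_inv_into W \<phi> y)) \<circ> \<psi>) \<and>
       (\<forall>y\<in>S. \<forall>u w. first_ff ((\<lambda>y. X (the_inv_into W \<phi> y)) \<circ> \<psi>) y u w = first_ff \<psi> y u w)"
    if ch: "chart_in (\<phi> ` W) S \<psi>" for S \<psi>
  proof -
    have S: "open S" "smooth_on S \<psi>" "\<psi> ` S \<subseteq> \<phi> ` W"
      using ch by (auto simp: chart_in_def sphere_chart_def)
    define \<tau> where "\<tau> = (\<lambda>y. the_inv_into W \<phi> (\<psi> y))"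
    have sm: "smooth_on S \<tau>"
      unfolding \<tau>_def by (rule smooth_on_inverse_chart_compose[OF \<phi> S])
    have \<tau>: "\<tau> y \<in> W" "\<phi> (\<tau> y) = \<psi> y" if "y \<in> S" for y
    proof -
      have "\<psi> y \<in> \<phi> ` W" using S(3) that by auto
      then show "\<tau> y \<in> W" "\<phi> (\<tau> y) = \<psi> y"
        unfolding \<tau>_def using the_inv_into_into[OF W(3) _ subset_refl] f_the_inv_into_f[OF W(3)] by auto
    qed
    have eq: "(\<lambda>y. X (the_inv_into W \<phi> y)) \<circ> \<psi> = (\<lambda>y. X (\<tau> y))"
      by (simp add: \<tau>_def o_def)
    have "smooth_on S (\<lambda>y. X (\<tau> y))"
      by (rule smooth_on_compose[OF X(1) sm S(1) W(1)]) (use \<tau> in auto)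
    moreover have "first_ff (\<lambda>y. X (\<tau> y)) y u w = first_ff \<psi> y u w" if y: "y \<in> S" for y u w
    proof -
      have d: "\<tau> differentiable (at y)" "X differentiable (at (\<tau> y))" "\<phi> differentiable (at (\<tau> y))"
        using smooth_on_differentiable[OF sm y] smooth_on_differentiable[OF X(1) \<tau>(1)[OF y]]
          smooth_on_differentiable[OF W(2) \<tau>(1)[OF y]] by auto
      have "dif \<psi> y = dif (\<lambda>y. \<phi> (\<tau> y)) y"
        by (rule dif_cong_open[OF S(1) y]) (simp add: \<tau>)
      then have "first_ff \<psi> y u w = first_ff (\<lambda>y. \<phi> (\<tau> y)) y u w"
        by (simp add: first_ff_def)
      then show ?thesis
        by (simp add: first_ff_compose[OF d(1,2)] first_ff_compose[OF d(1,3)] ff[OF \<tau>(1)[OF y]])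
    qed
    ultimately show ?thesis
      unfolding eq by blast
  qed
  moreover have "(\<lambda>y. X (the_inv_into W \<phi> y)) ` (\<phi> ` W) \<subseteq> sphere 0 1"
    using X(2) by (auto simp: the_inv_into_f_f[OF W(3)])
  ultimately show ?thesis
    unfolding isometric_immersion_def using openin_sphere_chart_image[OF \<phi>] by blast
qed

section \<open>From solutions of the system to immersions\<close>

lemma orthogonal_matrix_inv_mult_eq_iff:
  fixes Q D S :: "real^'k^'k"
  assumes "orthogonal_matrix Q"
  shows "matrix_inv Q ** D = S \<longleftrightarrow> D = Q ** S"
  using assms unfolding matrix_inv_orthogonal[OF assms] orthogonal_matrix_def
  by (metis matrix_mul_assoc matrix_mul_lid)

lemma solves_star_iff:
  "solves_star W A F b g \<longleftrightarrow> smooth_on W g \<and>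
    (\<forall>x\<in>W. orthogonal_matrix (g x) \<and> (\<forall>u. dif g x u = g x ** star_form (A x) (F x) (b x) u))"
  unfolding solves_star_def star_form_def[symmetric]
  by (auto simp: orthogonal_matrix_inv_mult_eq_iff)

lemma stiefel_columns_orthonormal:
  "A \<in> stiefel \<Longrightarrow> (\<Sum>k\<in>UNIV. A $ k $ i * A $ k $ j) = (if i = j then 1 else 0)"
  unfolding stiefel_def by (drule CollectD, drule arg_cong[where f = "\<lambda>M. M $ i $ j"])
    (simp add: matrix_matrix_mult_def transpose_def mat_def)

lemma flat_star_connection:
  assumes W: "open W" and sys: "partial_G_system_I W A F b"
  shows "flat_orthogonal_connection W (\<lambda>x. star_form (A x) (F x) (b x))"
proof (rule flat_orthogonal_connection.intro)
  have sm: "smooth_on W A" "smooth_on W F" "smooth_on W b"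
    using sys by (auto simp: partial_G_system_I_def)
  show "open W" by fact
  show "linear (star_form (A x) (F x) (b x))" for x by (rule linear_star_form)
  show "smooth_on W (\<lambda>x. star_form (A x) (F x) (b x) u)" for u
    by (rule smooth_on_star_form[OF sm W])
  show "transpose (star_form (A x) (F x) (b x) u) = - star_form (A x) (F x) (b x) u" for x u
    by (rule transpose_star_form)
  fix x u w assume x: "x \<in> W"
  have "star_curvature A F b x u w = 0"
  proof (rule star_curvature_eq_0[OF W x sm])
    show "(\<Sum>k\<in>UNIV. A x $ k $ i * A x $ k $ j) = 0" if "i \<noteq> j" for i j
      using stiefel_columns_orthonormal[of "A x" i j] sys x that by (auto simp: partial_G_system_I_def)
  qed (use sys x in \<open>auto simp: partial_G_system_I_def\<close>)
  then show "dif (\<lambda>y. star_form (A y) (F y) (b y) w) x u - dif (\<lambda>y. star_form (A y) (F y) (b y) u) x w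
     + star_form (A x) (F x) (b x) u ** star_form (A x) (F x) (b x) w
     - star_form (A x) (F x) (b x) w ** star_form (A x) (F x) (b x) u = 0"
    by (simp add: star_curvature_def)
qed

lemma solves_star_exists:
  assumes "open W" "partial_G_system_I W A F b" and V: "open V" "V \<subseteq> W" "starlike V"
  shows "\<exists>g. solves_star V A F b g"
proof -
  have "partial_G_system_I V A F b"
    using assms(2) V(2) unfolding partial_G_system_I_def by (auto intro: smooth_on_subset)
  then interpret conn: flat_orthogonal_connection V "\<lambda>x. star_form (A x) (F x) (b x)"
    by (rule flat_star_connection[OF V(1)])
  obtain g where g: "smooth_on V g" "\<And>x. x \<in> V \<Longrightarrow> orthogonal_matrix (g x)"
    "\<And>x. x \<in> V \<Longrightarrow> (g has_derivative (\<lambda>u. g x ** star_form (A x) (F x) (b x) u)) (at x)"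
    using conn.parallel_transport_exists[OF V(3)] by blast
  show ?thesis
    unfolding solves_star_iff using g(1,2) by (intro exI[of _ g]) (simp add: dif_eq[OF g(3)])
qed

section \<open>The frame of the sphere itself: the tangential block at \<lambda> = 0\<close>

definition tangent_block :: "real^('m::finite + 'k::finite)^('m + 'k) \<Rightarrow> real^'k^'k"
  where "tangent_block M = (\<chi> p q. M $ Inr p $ Inr q)"

lemma bounded_linear_tangent_block: "bounded_linear tangent_block"
  unfolding linear_conv_bounded_linear[symmetric]
  by (rule linearI) (simp_all add: tangent_block_def vec_eq_iff)

lemma transpose_tangent_block: "transpose (tangent_block M) = tangent_block (transpose M)"
  by (simp add: tangent_block_def transpose_def vec_eq_iff)

text \<open>The block of a product also contains a path through the normal indices; the hypothesis
  closes it.\<close>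

lemma tangent_block_mult:
  assumes "\<And>p k. M $ Inr p $ Inl k = 0"
  shows "tangent_block (M ** N) = tangent_block M ** tangent_block N"
  by (simp add: vec_eq_iff tangent_block_def matrix_matrix_mult_def sum_UNIV_Plus assms)

text \<open>The connection at \<open>\<lambda> = 0\<close>, with its trivial normal block removed. Its frames describe \<open>S\<^sup>n\<close>
  itself.\<close>

definition intrinsic_form :: "'m::finite itself \<Rightarrow> real^'n::finite^'n \<Rightarrow> real^'n \<Rightarrow> real^'n \<Rightarrow> real^('n + 1)^('n + 1)"
  where "intrinsic_form T F b u = tangent_block (star_form (0 :: real^'n^'m) F b u)"

text \<open>The equations for \<open>F\<close> and \<open>b\<close> do not contain \<open>A\<close>,
  so they survive its replacement by 0, and the equation for \<open>A\<close> becomes trivial.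
  Without \<open>A\<close> the normal block decouples, and the tangential block inherits the
  flatness.\<close>

lemma flat_intrinsic_connection:
  assumes W: "open W" and sys: "partial_G_system_I W (A :: real^'n \<Rightarrow> real^'n^'m) F b"
  shows "flat_orthogonal_connection W (\<lambda>x. intrinsic_form TYPE('m::finite) (F x) (b x))"
proof (rule flat_orthogonal_connection.intro)
  have sm: "smooth_on W F" "smooth_on W b"
    using sys by (auto simp: partial_G_system_I_def)
  let ?S = "\<lambda>x. star_form (0 :: real^'n^'m) (F x) (b x)"
  have smS: "smooth_on W (\<lambda>x. ?S x u)" for u
    by (rule smooth_on_star_form[OF smooth_on_const sm W])
  show "open W" by fact
  show "linear (intrinsic_form TYPE('m) (F x) (b x))" for x
    unfolding intrinsic_form_def
    using linear_compose[OF linear_star_form, of tangent_block] bounded_linear_tangent_block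
    by (simp add: linear_conv_bounded_linear o_def)
  show "smooth_on W (\<lambda>x. intrinsic_form TYPE('m) (F x) (b x) u)" for u
    unfolding intrinsic_form_def by (rule smooth_on_bounded_linear[OF bounded_linear_tangent_block smS W])
  show "transpose (intrinsic_form TYPE('m) (F x) (b x) u) = - intrinsic_form TYPE('m) (F x) (b x) u" for x u
    unfolding intrinsic_form_def transpose_tangent_block transpose_star_form
    by (simp add: tangent_block_def vec_eq_iff)
  fix x u w assume x: "x \<in> W"
  have pd0: "pd j (\<lambda>y. (0 :: real^'n^'m) $ k $ i) x = 0" for j k i
    by (simp add: pd_def dif_const)
  have K0: "star_curvature (\<lambda>x. 0 :: real^'n^'m) F b x u w = 0"
    by (rule star_curvature_eq_0[OF W x smooth_on_const sm])
      (use sys x pd0 in \<open>auto simp: partial_G_system_I_def\<close>)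
  have "tangent_block (star_curvature (\<lambda>x. 0 :: real^'n^'m) F b x u w)
    = dif (\<lambda>y. tangent_block (?S y w)) x u - dif (\<lambda>y. tangent_block (?S y u)) x w
     + tangent_block (?S x u) ** tangent_block (?S x w) - tangent_block (?S x w) ** tangent_block (?S x u)"
  proof -
    have z: "?S x v $ Inr p $ Inl k = 0" for v p k
      using star_form_entries(4)[of "0 :: real^'n^'m" "F x" "b x" v] star_form_entries(7)[of "0 :: real^'n^'m" "F x" "b x" v]
      by (cases p) auto
    interpret tb: bounded_linear "tangent_block :: real^('m + 'n + 1)^('m + 'n + 1) \<Rightarrow> _"
      by (rule bounded_linear_tangent_block)
    show ?thesis
      unfolding star_curvature_def
      by (simp add: tb.add tb.diff tangent_block_mult z
          dif_bounded_linear[OF bounded_linear_tangent_block smooth_on_differentiable[OF smS x]])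
  qed
  then show "dif (\<lambda>y. intrinsic_form TYPE('m) (F y) (b y) w) x u - dif (\<lambda>y. intrinsic_form TYPE('m) (F y) (b y) u) x w
     + intrinsic_form TYPE('m) (F x) (b x) u ** intrinsic_form TYPE('m) (F x) (b x) w
     - intrinsic_form TYPE('m) (F x) (b x) w ** intrinsic_form TYPE('m) (F x) (b x) u = 0"
    unfolding intrinsic_form_def K0 by (simp add: tangent_block_def vec_eq_iff)
qed

section \<open>Columns of frames and their first fundamental forms\<close>

lemma bounded_linear_column: "bounded_linear (column q :: real^'n^'m \<Rightarrow> real^'m)"
  unfolding linear_conv_bounded_linear[symmetric]
  by (rule linearI) (simp_all add: column_def vec_eq_iff)

lemma column_matrix_mult: "column q (A ** B) = A *v column q B" for A :: "real^'n^'m"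
  by (simp add: column_def matrix_matrix_mult_def matrix_vector_mult_def)

lemma orthogonal_matrix_inner:
  fixes Q :: "real^'k^'k"
  assumes "orthogonal_matrix Q"
  shows "(Q *v a) \<bullet> (Q *v c) = a \<bullet> c"
proof -
  have "(Q *v a) \<bullet> (Q *v c) = (transpose Q *v (Q *v a)) \<bullet> c"
    by (simp add: dot_lmul_matrix transpose_matrix_vector)
  then show ?thesis
    using assms by (simp add: matrix_vector_mul_assoc orthogonal_matrix_def)
qed

lemma norm_column_orthogonal_matrix: "orthogonal_matrix Q \<Longrightarrow> norm (column q Q) = 1" for Q :: "real^'k^'k"
  by (simp add: orthogonal_matrix_orthonormal_columns)

text \<open>The derivative of a column of \<open>g\<close> is \<open>g\<close> applied to the same
  column of the connection, and \<open>g\<close> is an isometry; so the metric is read off the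
  connection alone.\<close>

lemma first_ff_frame_column:
  fixes g :: "real^'n::finite \<Rightarrow> real^'k::finite^'k"
  assumes "g differentiable (at x)" "\<And>u. dif g x u = g x ** \<Theta> u" "orthogonal_matrix (g x)"
  shows "first_ff (\<lambda>y. column q (g y)) x u w = column q (\<Theta> u) \<bullet> column q (\<Theta> w)"
  unfolding first_ff_def
  by (simp add: dif_bounded_linear[OF bounded_linear_column assms(1)] assms(2) column_matrix_mult
      orthogonal_matrix_inner[OF assms(3)])

lemma column_star_form_inner:
  "column (Inr (Inr 1)) (star_form A F b u) \<bullet> column (Inr (Inr 1)) (star_form A F b w)
    = (\<Sum>i\<in>UNIV. (b $ i)\<^sup>2 * (u $ i * w $ i))"
  by (simp add: inner_vec_def column_def sum_UNIV_Plus star_form_entries power2_eq_square mult_ac)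

lemma column_intrinsic_form_inner:
  "column (Inr 1) (intrinsic_form T F b u) \<bullet> column (Inr 1) (intrinsic_form T F b w)
    = (\<Sum>i\<in>UNIV. (b $ i)\<^sup>2 * (u $ i * w $ i))"
  by (simp add: inner_vec_def column_def sum_UNIV_Plus intrinsic_form_def tangent_block_def
      star_form_entries power2_eq_square mult_ac)

lemma inj_dif_of_first_ff:
  fixes X :: "real^'n::finite \<Rightarrow> 'e::euclidean_space"
  assumes "X differentiable (at x)" "\<And>u. first_ff X x u u = 0 \<Longrightarrow> u = 0"
  shows "inj (dif X x)"
  using assms linear_injective_0[OF linear_dif[OF assms(1)]] by (auto simp: first_ff_def)

lemma diagonal_form_definite:
  assumes "\<And>i. (b :: real^'n) $ i \<noteq> 0" "(\<Sum>i\<in>UNIV. (b $ i)\<^sup>2 * (u $ i * u $ i)) = 0"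
  shows "u = 0"
proof -
  have "\<forall>i\<in>UNIV. (b $ i)\<^sup>2 * (u $ i * u $ i) = 0"
    using assms(2) by (subst (asm) sum_nonneg_eq_0_iff) auto
  then show ?thesis
    using assms(1) by (simp add: vec_eq_iff)
qed

text \<open>The last column of the connection contains neither \<open>A\<close> nor \<lambda>. So
  the last columns of the frames at \<lambda> = 1 and \<lambda> = 0 induce the same metric, one in
  the large sphere and one in the sphere whose dimension is that of the domain.\<close>

lemma local_isometric_immersion_of_solution:
  fixes A :: "real^'n::finite \<Rightarrow> real^'n^'m::finite"
  assumes W: "open W" and sys: "partial_G_system_I W A F b" and V: "open V" "V \<subseteq> W" and g: "solves_star V A F b g"
  shows "\<forall>x\<in>V. last_column (g x) \<in> sphere 0 1"
    and "local_isometric_immersion_of_sphere {x \<in> V. \<forall>i. b x $ i \<noteq> 0} (\<lambda>x. last_column (g x))"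
proof -
  let ?X = "\<lambda>x. last_column (g x)"
  have g': "smooth_on V g" "\<And>x. x \<in> V \<Longrightarrow> orthogonal_matrix (g x)"
    "\<And>x u. x \<in> V \<Longrightarrow> dif g x u = g x ** star_form (A x) (F x) (b x) u"
    using g by (auto simp: solves_star_iff)
  have sph: "?X x \<in> sphere 0 1" if "x \<in> V" for x
    using norm_column_orthogonal_matrix[OF g'(2)[OF that]] by (simp add: last_column_def)
  then show "\<forall>x\<in>V. last_column (g x) \<in> sphere 0 1" by blast
  have smX: "smooth_on V ?X"
    unfolding last_column_def by (rule smooth_on_bounded_linear[OF bounded_linear_column g'(1) V(1)])
  have ffX: "first_ff ?X x u w = (\<Sum>i\<in>UNIV. (b x $ i)\<^sup>2 * (u $ i * w $ i))" if "x \<in> V" for x u w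
    unfolding last_column_def
    by (subst first_ff_frame_column[OF smooth_on_differentiable[OF g'(1) that] g'(3)[OF that] g'(2)[OF that]])
      (rule column_star_form_inner)
  let ?V0 = "{x \<in> V. \<forall>i. b x $ i \<noteq> 0}"
  have smb: "smooth_on V b"
    using sys V(2) smooth_on_subset by (auto simp: partial_G_system_I_def)
  have "?V0 = (\<Inter>i. V \<inter> (\<lambda>x. b x $ i) -` (- {0}))" by auto
  moreover have "open (V \<inter> (\<lambda>x. b x $ i) -` (- {0}))" for i
    by (rule continuous_open_preimage[OF smooth_on_continuous_on[OF smooth_on_vec_nth[OF smb V(1)]] V(1)])
      (simp add: open_Compl)
  ultimately have V0: "open ?V0"
    by (simp only:) (rule open_INT, auto)
  have "\<exists>V' \<phi> Y. p \<in> V' \<and> V' \<subseteq> ?V0 \<and> sphere_chart V' \<phi> \<and>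
       isometric_immersion (\<phi> ` V') Y \<and> (\<forall>x\<in>V'. ?X x = Y (\<phi> x))" if p: "p \<in> ?V0" for p
  proof -
    \<comment> \<open>A ball is starlike, so the intrinsic connection has a frame on it; inside
      \<open>?V0\<close> the diagonal form with entries \<open>(b x $ i)\<^sup>2\<close> is
      definite, so \<phi> is an immersion there.\<close>
    obtain r where r: "r > 0" "ball p r \<subseteq> ?V0"
      using V0 p openE by blast
    let ?B = "ball p r"
    have pB: "p \<in> ?B" using r(1) by simp
    have BW: "?B \<subseteq> W" "?B \<subseteq> V" using r(2) V(2) by auto
    have "partial_G_system_I ?B A F b"
      using sys BW(1) unfolding partial_G_system_I_def by (auto intro: smooth_on_subset)
    then interpret conn: flat_orthogonal_connection ?B "\<lambda>x. intrinsic_form TYPE('m) (F x) (b x)"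
      by (rule flat_intrinsic_connection[OF open_ball])
    have "starlike ?B" using r(1) convex_imp_starlike[of ?B] by auto
    then obtain h where h: "smooth_on ?B h" "\<And>x. x \<in> ?B \<Longrightarrow> orthogonal_matrix (h x)"
      "\<And>x. x \<in> ?B \<Longrightarrow> (h has_derivative (\<lambda>u. h x ** intrinsic_form TYPE('m) (F x) (b x) u)) (at x)"
      using conn.parallel_transport_exists by blast
    define \<phi> where "\<phi> = (\<lambda>x. column (Inr 1) (h x))"
    have sm\<phi>: "smooth_on ?B \<phi>"
      unfolding \<phi>_def by (rule smooth_on_bounded_linear[OF bounded_linear_column h(1) open_ball])
    have sph\<phi>: "\<phi> ` ?B \<subseteq> sphere 0 1"
      using norm_column_orthogonal_matrix[OF h(2)] by (auto simp: \<phi>_def)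
    have ff\<phi>: "first_ff \<phi> x u w = (\<Sum>i\<in>UNIV. (b x $ i)\<^sup>2 * (u $ i * w $ i))" if "x \<in> ?B" for x u w
      unfolding \<phi>_def
      by (subst first_ff_frame_column[OF smooth_on_differentiable[OF h(1) that] _ h(2)[OF that],
            of "intrinsic_form TYPE('m) (F x) (b x)"])
        (simp_all only: dif_eq[OF h(3)[OF that]] column_intrinsic_form_inner)
    have inj\<phi>: "inj (dif \<phi> x)" if "x \<in> ?B" for x
    proof (rule inj_dif_of_first_ff[OF smooth_on_differentiable[OF sm\<phi> that]])
      fix u assume "first_ff \<phi> x u u = 0"
      then show "u = 0"
        using that r(2) by (intro diagonal_form_definite[of "b x" u]) (auto simp: ff\<phi>)
    qed
    \<comment> \<open>The immersion \<phi> need not be injective on the ball; its smooth local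
      inverse yields a smaller neighbourhood on which it is a chart.\<close>
    obtain W' V' \<rho> where W': "open W'" "W' \<subseteq> ?B" "p \<in> W'"
      "\<And>x. x \<in> W' \<Longrightarrow> \<phi> x \<in> V' \<and> \<rho> (\<phi> x) = x"
      using sphere_immersion_local_inverse[OF open_ball sm\<phi> sph\<phi> pB inj\<phi>[OF pB]] by metis
    have "inj_on \<phi> W'"
      using W'(4) by (intro inj_on_inverseI[of _ \<rho>]) blast
    then have chart: "sphere_chart W' \<phi>"
      unfolding sphere_chart_def
      using W' sph\<phi> inj\<phi> smooth_on_subset[OF sm\<phi> W'(2)] by blast
    have "isometric_immersion (\<phi> ` W') (\<lambda>y. ?X (the_inv_into W' \<phi> y))"
    proof (rule isometric_immersion_of_same_first_ff[OF chart])
      show "smooth_on W' ?X" using smooth_on_subset[OF smX] W'(2) BW(2) by blast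
      show "?X ` W' \<subseteq> sphere 0 1" using sph W'(2) BW(2) by blast
      show "first_ff ?X x u w = first_ff \<phi> x u w" if "x \<in> W'" for x u w
        using that W'(2) BW(2) by (subst ffX ff\<phi>, blast)+ simp
    qed
    moreover have "\<forall>x\<in>W'. ?X x = ?X (the_inv_into W' \<phi> (\<phi> x))"
      using the_inv_into_f_f[OF \<open>inj_on \<phi> W'\<close>] by simp
    ultimately show ?thesis
      using W' chart r(2) by (intro exI[of _ W'] exI[of _ \<phi>] exI[of _ "\<lambda>y. ?X (the_inv_into W' \<phi> y)"]) blast
  qed
  then show "local_isometric_immersion_of_sphere ?V0 ?X"
    unfolding local_isometric_immersion_of_sphere_def using V0 by blast
qed

section \<open>Immersions with a parallel normal frame\<close>

text \<open>The variational inequality that characterizes the closest point, applied to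
  \<open>v\<close> and to \<open>- v\<close>.\<close>

lemma closest_point_subspace_eq_0:
  fixes S :: "'e::euclidean_space set"
  assumes "subspace S" "closest_point S a = 0" "v \<in> S"
  shows "a \<bullet> v = 0"
proof -
  have "(a - closest_point S a) \<bullet> (w - closest_point S a) \<le> 0" if "w \<in> S" for w
    using assms(1) that by (intro closest_point_dot subspace_imp_convex closed_subspace)
  from this[of v] this[of "- v"] show ?thesis
    using assms by (simp add: subspace_neg)
qed

lemma dif_inner_const_on:
  fixes f g :: "'a::real_normed_vector \<Rightarrow> 'e::euclidean_space"
  assumes "open W" "x \<in> W" "smooth_on W f" "smooth_on W g" "\<And>y. y \<in> W \<Longrightarrow> f y \<bullet> g y = c"
  shows "f x \<bullet> dif g x u + dif f x u \<bullet> g x = 0"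
proof -
  have "dif (\<lambda>y. f y \<bullet> g y) x = dif (\<lambda>y. c) x"
    by (rule dif_cong_open[OF assms(1,2,5)])
  then show ?thesis
    using dif_inner[OF smooth_on_differentiable[OF assms(3,2)] smooth_on_differentiable[OF assms(4,2)], of u]
    by (simp add: dif_const)
qed

text \<open>Three product rules for coefficients of the metric, combined so that by symmetry all but
  one second derivative cancel. Its use: the tangential part of second derivatives depends on the
  metric only.\<close>

lemma koszul_formula:
  fixes X :: "real^'n::finite \<Rightarrow> 'e::euclidean_space"
  assumes W: "open W" "smooth_on W X" "x \<in> W"
  shows "2 * (dif X x v \<bullet> dif (\<lambda>y. dif X y w) x u) =
    dif (\<lambda>y. first_ff X y v w) x u + dif (\<lambda>y. first_ff X y v u) x w - dif (\<lambda>y. first_ff X y u w) x v"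
proof -
  have *: "dif (\<lambda>y. first_ff X y v w) x u = dif X x v \<bullet> dif (\<lambda>y. dif X y w) x u
     + dif (\<lambda>y. dif X y v) x u \<bullet> dif X x w" for u v w
    unfolding first_ff_def
    by (rule dif_inner) (rule smooth_on_differentiable[OF smooth_on_dif[OF W(2)] W(3)])+
  show ?thesis
    unfolding * second_dif_commute[OF W, of v u] second_dif_commute[OF W, of v w] second_dif_commute[OF W, of u w]
    by (simp add: inner_commute)
qed

section \<open>Structure equations in a parallel normal frame\<close>

locale framed_immersion =
  fixes W :: "(real^'n::finite) set" and X :: "real^'n \<Rightarrow> real^('m::finite + 'n + 1)"
    and E :: "'m \<Rightarrow> real^'n \<Rightarrow> real^('m + 'n + 1)"
  assumes openW: "open W" and smX: "smooth_on W X" and sphX: "X ` W \<subseteq> sphere 0 1"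
    and smE: "\<And>k. smooth_on W (E k)"
    and normalE: "\<And>k x. x \<in> W \<Longrightarrow> E k x \<in> normal_space X x"
    and orthonormalE: "\<And>k l x. x \<in> W \<Longrightarrow> E k x \<bullet> E l x = (if k = l then 1 else 0)"
    and parallelE: "\<And>k i x. x \<in> W \<Longrightarrow> normal_derivative X i (E k) x = 0"
begin

lemmas diffX = smooth_on_differentiable[OF smX]
lemmas diffE = smooth_on_differentiable[OF smE]
lemmas smdX = smooth_on_dif[OF smX]
lemmas diffdX = smooth_on_differentiable[OF smdX]

lemma X_X: "x \<in> W \<Longrightarrow> X x \<bullet> X x = 1"
  using sphX by (auto simp: dot_square_norm)

lemma dX_X: "x \<in> W \<Longrightarrow> dif X x u \<bullet> X x = 0"
  by (rule sphere_valued_dif_orthogonal[OF openW smX sphX])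

lemma E_X: "x \<in> W \<Longrightarrow> E k x \<bullet> X x = 0"
  using normalE by (auto simp: normal_space_def)

lemma E_dX: "x \<in> W \<Longrightarrow> E k x \<bullet> dif X x u = 0"
  using normalE by (auto simp: normal_space_def)

lemma subspace_normal_space: "subspace (normal_space X x)"
  unfolding subspace_def normal_space_def by (simp add: inner_add_left)

lemma dE_normal:
  assumes x: "x \<in> W" and v: "v \<in> normal_space X x"
  shows "dif (E k) x u \<bullet> v = 0"
proof -
  have "pd i (E k) x \<bullet> v = 0" for i
    using closest_point_subspace_eq_0[OF subspace_normal_space _ v] parallelE[OF x, of i k]
    by (simp add: normal_derivative_def)
  then show ?thesis
    by (simp add: dif_pd[OF diffE[OF x]] inner_sum_left)
qed

lemma dE_E: "x \<in> W \<Longrightarrow> dif (E k) x u \<bullet> E l x = 0"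
  by (rule dE_normal) (auto intro: normalE)

text \<open>The position is not in \<open>normal_space\<close>, which is taken inside the sphere;
  this component vanishes because \<open>E k\<close> is orthogonal to the derivative of
  \<open>X\<close> too.\<close>

lemma dE_X: "x \<in> W \<Longrightarrow> dif (E k) x u \<bullet> X x = 0"
  using dif_inner_const_on[OF openW _ smE smX E_X, of x k u] E_dX by simp

lemma ddX_E:
  assumes x: "x \<in> W"
  shows "dif (\<lambda>y. dif X y u) x w \<bullet> E k x = - (dif X x u \<bullet> dif (E k) x w)"
  using dif_inner_const_on[OF openW x smE smdX E_dX, of k u w] by (simp add: inner_commute)

lemma ddX_X:
  assumes x: "x \<in> W"
  shows "dif (\<lambda>y. dif X y u) x w \<bullet> X x = - first_ff X x u w"
  using dif_inner_const_on[OF openW x smX smdX, of u 0 w] dX_X by (simp add: inner_commute first_ff_def)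

lemma dX_dE_commute:
  assumes x: "x \<in> W"
  shows "dif X x u \<bullet> dif (E k) x w = dif X x w \<bullet> dif (E k) x u"
  using ddX_E[OF x, of u w k] ddX_E[OF x, of w u k] second_dif_commute[OF openW smX x, of u w] by simp

text \<open>The Ricci equation for a flat normal bundle.\<close>

lemma dE_dE_commute:
  assumes x: "x \<in> W"
  shows "dif (E k) x u \<bullet> dif (E l) x w = dif (E k) x w \<bullet> dif (E l) x u"
proof -
  have "dif (E k) x u \<bullet> dif (E l) x w + dif (\<lambda>y. dif (E k) y u) x w \<bullet> E l x = 0" for u w
    by (rule dif_inner_const_on[OF openW x smooth_on_dif[OF smE] smE dE_E])
  from this[of u w] this[of w u] show ?thesis
    using second_dif_commute[OF openW smE x, of k u w] by simp
qed

end

section \<open>Adapted frames in principal coordinates\<close>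

lemma transpose_mult_entry: "(transpose P ** Q) $ p $ q = column p P \<bullet> column q Q" for P Q :: "real^'n^'m"
  by (simp add: matrix_matrix_mult_def transpose_def column_def inner_vec_def)

locale principal_coordinates = framed_immersion W X E
  for W :: "(real^'n::finite) set" and X :: "real^'n \<Rightarrow> real^('m::finite + 'n + 1)" and E +
  fixes A :: "real^'n \<Rightarrow> real^'n^'m" and b :: "real^'n \<Rightarrow> real^'n"
  assumes smA: "smooth_on W A" and smb: "smooth_on W b" and stiefelA: "A ` W \<subseteq> stiefel"
    and b_nonzero: "\<And>x i. x \<in> W \<Longrightarrow> b x $ i \<noteq> 0"
    and first: "\<And>x u w. x \<in> W \<Longrightarrow> first_ff X x u w = (\<Sum>i\<in>UNIV. (b x $ i)\<^sup>2 * (u $ i * w $ i))"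
    and second: "\<And>x u w. x \<in> W \<Longrightarrow> second_ff X E x u w =
         (\<Sum>i\<in>UNIV. \<Sum>j\<in>UNIV. (A x $ j $ i * b x $ i * (u $ i * w $ i)) *\<^sub>R E j x)"
begin

lemma first_axis: "x \<in> W \<Longrightarrow> first_ff X x u (axis j 1) = (b x $ j)\<^sup>2 * u $ j"
  by (simp add: first axis_def if_distrib cong: if_cong)

lemma dX_dE:
  assumes x: "x \<in> W"
  shows "dif X x u \<bullet> dif (E k) x w = (\<Sum>i\<in>UNIV. A x $ k $ i * b x $ i * (u $ i * w $ i))"
proof -
  have "second_ff X E x u w \<bullet> E k x = dif X x u \<bullet> dif (E k) x w"
    by (simp add: second_ff_def inner_sum_left orthonormalE[OF x] if_distrib cong: if_cong)
  moreover have "second_ff X E x u w \<bullet> E k x = (\<Sum>i\<in>UNIV. A x $ k $ i * b x $ i * (u $ i * w $ i))"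
    by (simp add: second[OF x] inner_sum_left orthonormalE[OF x] if_distrib cong: if_cong)
  ultimately show ?thesis by simp
qed

lemma dX_axis_dE: "x \<in> W \<Longrightarrow> pd i X x \<bullet> dif (E k) x w = A x $ k $ i * b x $ i * w $ i"
  unfolding pd_def by (simp add: dX_dE axis_def if_distrib if_distribR cong: if_cong)

abbreviation "frame \<equiv> adapted_frame X E b"

lemma column_frame:
  "column (Inl k) (frame x) = E k x"
  "column (Inr (Inl i)) (frame x) = (1 / b x $ i) *\<^sub>R pd i X x"
  "column (Inr (Inr z)) (frame x) = X x"
  by (simp_all add: adapted_frame_def column_def vec_eq_iff)

lemma pdX_pdX: "x \<in> W \<Longrightarrow> pd i X x \<bullet> pd j X x = (if i = j then (b x $ j)\<^sup>2 else 0)"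
  using first_axis[of x "axis i 1" j] by (simp add: first_ff_def pd_def axis_def)

lemma orthogonal_frame:
  assumes x: "x \<in> W"
  shows "orthogonal_matrix (frame x)"
proof -
  have "\<forall>p q. column p (frame x) \<bullet> column q (frame x) = (if p = q then 1 else 0)"
  proof -
    have "E k x \<bullet> pd i X x = 0" "pd i X x \<bullet> E k x = 0" "X x \<bullet> pd i X x = 0" "pd i X x \<bullet> X x = 0"
      "X x \<bullet> E k x = 0" for i k
      using E_dX[OF x] dX_X[OF x] E_X[OF x] by (simp_all add: pd_def inner_commute)
    then show ?thesis
      unfolding all_block_index column_frame
      by (simp add: orthonormalE[OF x] E_X[OF x] X_X[OF x] pdX_pdX[OF x] power2_eq_square b_nonzero[OF x])
  qed
  then show ?thesis
    unfolding orthogonal_matrix by (simp add: vec_eq_iff transpose_mult_entry mat_def)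
qed

lemma smooth_frame: "smooth_on W frame"
proof (intro smooth_on_vecI openW)
  note [smooth_intros] = openW smE smX smb
  have "\<forall>q. smooth_on W (\<lambda>x. frame x $ p $ q)" for p
    unfolding all_block_index adapted_frame_def
    by (simp del: scaleR_conv_of_real) (intro conjI allI smooth_intros b_nonzero)
  then show "smooth_on W (\<lambda>x. frame x $ p $ q)" for p q by blast
qed

text \<open>The Levi-Civita connection of a diagonal metric, by the Koszul formula. Divided by
  \<open>b x $ i\<close> and \<open>b x $ j\<close> it becomes
  \<open>u $ i * f_ij - u $ j * f_ji\<close> with the entries \<open>f_ij\<close> of
  \<open>F_of b x\<close>, which is where that definition comes from.\<close>

lemma tangent_connection:
  assumes x: "x \<in> W" and ij: "i \<noteq> j"
  shows "pd i X x \<bullet> dif (pd j X) x u = u $ i * b x $ i * pd j (\<lambda>y. b y $ i) x - u $ j * b x $ j * pd i (\<lambda>y. b y $ j) x"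
proof -
  have db: "dif (\<lambda>y. first_ff X y u (axis k 1)) x w = 2 * u $ k * b x $ k * dif (\<lambda>y. b y $ k) x w" for u k w
  proof -
    have d: "(\<lambda>y. b y $ k) differentiable (at x)"
      by (rule smooth_on_differentiable[OF smooth_on_vec_nth[OF smb openW] x])
    have "dif (\<lambda>y. first_ff X y u (axis k 1)) x = dif (\<lambda>y. (b y $ k * b y $ k) * u $ k) x"
      by (rule dif_cong_open[OF openW x]) (simp add: first_axis power2_eq_square)
    moreover have "dif (\<lambda>y. (b y $ k * b y $ k) * u $ k) x w = dif (\<lambda>y. b y $ k * b y $ k) x w * u $ k"
      by (rule dif_bounded_linear[OF bounded_linear_mult_left])
        (rule smooth_on_differentiable[OF _ x], intro smooth_intros smb openW)
    ultimately show ?thesis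
      by (simp add: dif_mult[OF d d])
  qed
  have "2 * (dif X x (axis i 1) \<bullet> dif (\<lambda>y. dif X y (axis j 1)) x u) =
    dif (\<lambda>y. first_ff X y (axis i 1) (axis j 1)) x u + dif (\<lambda>y. first_ff X y (axis i 1) u) x (axis j 1)
     - dif (\<lambda>y. first_ff X y u (axis j 1)) x (axis i 1)"
    by (rule koszul_formula[OF openW smX x])
  moreover have "(\<lambda>y. first_ff X y (axis i 1) u) = (\<lambda>y. first_ff X y u (axis i 1))"
    by (simp add: first_ff_def inner_commute)
  ultimately show ?thesis
    using ij by (simp add: db pd_def[of _ X] pd_def[abs_def]) (simp add: axis_def algebra_simps)
qed

lemma frame_skew:
  assumes x: "x \<in> W"
  shows "column p (frame x) \<bullet> dif (\<lambda>y. column q (frame y)) x u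
    = - (column q (frame x) \<bullet> dif (\<lambda>y. column p (frame y)) x u)"
proof -
  have orth: "column p (frame y) \<bullet> column q (frame y) = (if p = q then 1 else 0)" if "y \<in> W" for y
    using orthogonal_frame[OF that] unfolding orthogonal_matrix vec_eq_iff transpose_mult_entry
    by (simp add: mat_def)
  have "column p (frame x) \<bullet> dif (\<lambda>y. column q (frame y)) x u
      + dif (\<lambda>y. column p (frame y)) x u \<bullet> column q (frame x) = 0"
    by (rule dif_inner_const_on[OF openW x _ _ orth])
      (rule smooth_on_bounded_linear[OF bounded_linear_column smooth_frame openW])+
  then show ?thesis
    by (simp add: inner_commute)
qed

text \<open>The matrix \<open>T\<close> of the transposed frame times its derivative has several
  sources: parallelism annihilates the normal block, the second form gives the coupling of tangent
  and normal directions, the metric gives the position column, and its connection the tangent block.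
  Orthonormality of the frame makes \<open>T\<close> skew and yields the rest.\<close>

lemma dif_frame:
  assumes x: "x \<in> W"
  shows "dif frame x u = frame x ** star_form (A x) (F_of b x) (b x) u" (is "_ = _ ** ?S")
proof -
  let ?c = "\<lambda>q y. column q (frame y)"
  define T where "T p q = ?c p x \<bullet> dif (?c q) x u" for p q
  have skew: "T p q = - T q p" for p q
    unfolding T_def by (rule frame_skew[OF x])
  have diffpd: "pd j X differentiable (at x)" for j
    unfolding pd_def[abs_def] by (rule diffdX[OF x])
  have diffb: "(\<lambda>y. 1 / b y $ j) differentiable (at x)" for j
    by (rule smooth_on_differentiable[OF _ x], intro smooth_intros smb openW b_nonzero)
  have nn: "T (Inl l) (Inl k) = 0" for k l
    unfolding T_def column_frame using dE_E[OF x, of k u l] by (simp add: inner_commute)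
  have tn: "T (Inr (Inl i)) (Inl k) = u $ i * A x $ k $ i" for i k
    unfolding T_def column_frame using b_nonzero[OF x] by (simp add: dX_axis_dE[OF x])
  have pn: "T (Inr (Inr z)) (Inl k) = 0" for z k
    unfolding T_def column_frame using dE_X[OF x, of k u] by (simp add: inner_commute)
  have tp: "T (Inr (Inl i)) (Inr (Inr z)) = u $ i * b x $ i" for i z
    unfolding T_def column_frame using b_nonzero[OF x] first_axis[OF x, of u i]
    by (simp add: first_ff_def pd_def inner_commute power2_eq_square)
  have pp: "T (Inr (Inr z)) (Inr (Inr z')) = 0" for z z'
    unfolding T_def column_frame using dX_X[OF x, of u] by (simp add: inner_commute)
  have tt: "T (Inr (Inl i)) (Inr (Inl j)) = u $ i * F_of b x $ i $ j - u $ j * F_of b x $ j $ i" for i j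
  proof (cases "i = j")
    case True
    then show ?thesis using skew[of "Inr (Inl i)" "Inr (Inl i)"] by simp
  next
    case False
    \<comment> \<open>The second summand is a multiple of \<open>pd j X x\<close> and drops out in
      the inner product with \<open>pd i X x\<close>.\<close>
    have "dif (?c (Inr (Inl j))) x u = (1 / b x $ j) *\<^sub>R dif (pd j X) x u + dif (\<lambda>y. 1 / b y $ j) x u *\<^sub>R pd j X x"
      unfolding column_frame by (rule dif_scaleR[OF diffb diffpd])
    then have "T (Inr (Inl i)) (Inr (Inl j)) = (1 / b x $ i) * (1 / b x $ j) * (pd i X x \<bullet> dif (pd j X) x u)"
      unfolding T_def column_frame(2)[of i x] using False by (simp add: inner_add_right pdX_pdX[OF x])
    then show ?thesis
      unfolding tangent_connection[OF x False] using False b_nonzero[OF x]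
      by (simp add: F_of_def field_simps)
  qed
  have nt: "T (Inl k) (Inr (Inl i)) = - (u $ i * A x $ k $ i)" for i k
    using skew[of "Inl k" "Inr (Inl i)"] tn by simp
  have np: "T (Inl k) (Inr (Inr z)) = 0" for z k
    using skew[of "Inl k" "Inr (Inr z)"] pn by simp
  have pt: "T (Inr (Inr z)) (Inr (Inl i)) = - (u $ i * b x $ i)" for i z
    using skew[of "Inr (Inr z)" "Inr (Inl i)"] tp by simp
  have "\<forall>p q. T p q = ?S $ p $ q"
    unfolding all_block_index
    by (simp add: star_form_entries nn tn pn tp pp tt nt np pt)
  moreover have "(transpose (frame x) ** dif frame x u) $ p $ q = T p q" for p q
    unfolding transpose_mult_entry T_def
    by (simp add: dif_bounded_linear[OF bounded_linear_column smooth_on_differentiable[OF smooth_frame x]])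
  ultimately have "transpose (frame x) ** dif frame x u = ?S"
    by (simp add: vec_eq_iff)
  then have "frame x ** ?S = frame x ** transpose (frame x) ** dif frame x u"
    by (simp add: matrix_mul_assoc[symmetric])
  then show ?thesis
    by (simp add: orthogonal_matrix_mult_transpose[OF orthogonal_frame[OF x]])
qed

lemma smooth_F_of: "smooth_on W (F_of b)"
proof (intro smooth_on_vecI openW)
  show "smooth_on W (\<lambda>x. F_of b x $ i $ j)" for i j
    unfolding F_of_def
    by (cases "i = j") (simp_all add: smooth_on_const, intro smooth_intros smb openW b_nonzero)
qed

lemma frame_solves_star: "solves_star W A (F_of b) b frame"
  unfolding solves_star_iff using smooth_frame orthogonal_frame dif_frame by blast

lemma system_solution: "partial_G_system_I W A (F_of b) b"
proof -
  have flat: "star_curvature A (F_of b) b x u w = 0" if x: "x \<in> W" for x u w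
    unfolding star_curvature_def
    by (rule connection_of_frame_flat[OF openW smooth_frame smooth_on_star_form[OF smA smooth_F_of smb openW]
          dif_frame orthogonal_frame x])
  have diag: "F_of b x $ i $ i = 0" for x i
    by (simp add: F_of_def)
  have orth: "(\<Sum>k\<in>UNIV. A x $ k $ i * A x $ k $ j) = 0" if "x \<in> W" "i \<noteq> j" for x i j
    using stiefel_columns_orthonormal[of "A x" i j] stiefelA that by auto
  show ?thesis
    unfolding partial_G_system_I_def
  proof (intro conjI ballI allI impI smA smb smooth_F_of stiefelA diag)
    fix x assume x: "x \<in> W"
    note imp = star_curvature_eq_0_imp[OF openW x smA smooth_F_of smb flat[OF x] orth[OF x] diag]
    show "pd j (\<lambda>y. F_of b y $ i $ j) x + pd i (\<lambda>y. F_of b y $ j $ i) x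
          + (\<Sum>k\<in>UNIV. F_of b x $ i $ k * F_of b x $ j $ k) + b x $ i * b x $ j = 0" if "i \<noteq> j" for i j
      using imp(1) that by blast
    show "pd k (\<lambda>y. F_of b y $ i $ j) x = F_of b x $ i $ k * F_of b x $ k $ j"
      if "i \<noteq> j \<and> j \<noteq> k \<and> i \<noteq> k" for i j k
      using imp(2)[of i j k] that by blast
    show "pd j (\<lambda>y. b y $ i) x = F_of b x $ i $ j * b x $ j" if "i \<noteq> j" for i j
      using that b_nonzero[OF x] by (simp add: F_of_def)
    show "pd j (\<lambda>y. A y $ k $ i) x = F_of b x $ i $ j * A x $ k $ j" if "i \<noteq> j" for k i j
      using imp(3) that by blast
  qed
qed

end

section \<open>Passage from an immersion to its charts\<close>

lemma framed_immersion_chart: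
  assumes "isometric_immersion M X" "parallel_normal_frame M X e" "chart_in M W \<phi>"
  shows "framed_immersion W (X \<circ> \<phi>) (\<lambda>k. e k \<circ> \<phi>)"
proof
  show "open W"
    using assms(3) by (simp add: chart_in_def sphere_chart_def)
  show "smooth_on W (X \<circ> \<phi>)"
    using assms(1,3) unfolding isometric_immersion_def by metis
  have "X ` M \<subseteq> sphere 0 1" "\<phi> ` W \<subseteq> M"
    using assms(1,3) unfolding isometric_immersion_def chart_in_def by simp_all
  then show "(X \<circ> \<phi>) ` W \<subseteq> sphere 0 1"
    unfolding image_comp[symmetric] by blast
  have frame: "(\<forall>k. smooth_on W (e k \<circ> \<phi>)) \<and>
       (\<forall>x\<in>W.
          (\<forall>k. e k (\<phi> x) \<in> normal_space (X \<circ> \<phi>) x) \<and>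
          (\<forall>k l. e k (\<phi> x) \<bullet> e l (\<phi> x) = (if k = l then 1 else 0)) \<and>
          (\<forall>k i. normal_derivative (X \<circ> \<phi>) i (e k \<circ> \<phi>) x = 0))"
    using assms(2,3) unfolding parallel_normal_frame_def by blast
  then show "smooth_on W (e k \<circ> \<phi>)" for k
    by blast
  fix k l i x assume "x \<in> W"
  with frame show "(e k \<circ> \<phi>) x \<in> normal_space (X \<circ> \<phi>) x"
    "(e k \<circ> \<phi>) x \<bullet> (e l \<circ> \<phi>) x = (if k = l then 1 else 0)"
    "normal_derivative (X \<circ> \<phi>) i (e k \<circ> \<phi>) x = 0"
    by simp_all
qed

lemma principal_coordinates_of_forms:
  fixes X :: "real^('n + 1) \<Rightarrow> real^('m::finite + 'n::finite + 1)"
  assumes "isometric_immersion M X" "parallel_normal_frame M X e" "forms_in_coordinates M X e W \<phi> A b"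
  shows "principal_coordinates W (X \<circ> \<phi>) (\<lambda>k. e k \<circ> \<phi>) A b"
proof -
  have chart: "chart_in M W \<phi>"
    using assms(3) by (simp add: forms_in_coordinates_def)
  interpret framed_immersion W "X \<circ> \<phi>" "\<lambda>k. e k \<circ> \<phi>"
    by (rule framed_immersion_chart[OF assms(1,2) chart])
  have ff: "first_ff (X \<circ> \<phi>) x u w = (\<Sum>i\<in>UNIV. (b x $ i)\<^sup>2 * (u $ i * w $ i))" if "x \<in> W" for x u w
    using assms(3) that by (simp add: forms_in_coordinates_def)
  \<comment> \<open>\<open>forms_in_coordinates\<close> does not state this; it holds because \<phi>
    is an immersion with the same metric, so no coordinate direction has length 0.\<close>
  have "b x $ i \<noteq> 0" if x: "x \<in> W" for x i
  proof
    assume "b x $ i = 0"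
    then have "first_ff (X \<circ> \<phi>) x (axis i 1) (axis i 1) = 0"
      by (simp add: ff[OF x] axis_def if_distrib cong: if_cong)
    then have "first_ff \<phi> x (axis i 1) (axis i 1) = 0"
      using assms(1) chart x by (simp add: isometric_immersion_def)
    then have "dif \<phi> x (axis i 1) = 0" by (simp add: first_ff_def)
    moreover have "inj (dif \<phi> x)" "linear (dif \<phi> x)"
      using chart x smooth_on_linear_dif[of W \<phi> x] by (auto simp: chart_in_def sphere_chart_def)
    ultimately have "axis i (1::real) = 0"
      using linear_injective_0 by blast
    then show False by simp
  qed
  then show ?thesis
    using assms(3) ff by unfold_locales (auto simp: forms_in_coordinates_def)
qed

section \<open>Joint eigenvectors\<close>

text \<open>A maximum of \<open>f v \<bullet> v\<close> on the unit sphere of \<open>U\<close> is an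
  eigenvector: the first variation in every direction of \<open>U\<close> must vanish.\<close>

lemma symmetric_operator_eigenvector:
  fixes f :: "'a::euclidean_space \<Rightarrow> 'a"
  assumes f: "linear f" and sym: "\<And>u v. f u \<bullet> v = u \<bullet> f v"
    and U: "subspace U" "U \<noteq> {0}" "f ` U \<subseteq> U"
  shows "\<exists>v\<in>U. norm v = 1 \<and> (\<exists>c. f v = c *\<^sub>R v)"
proof -
  have "compact (U \<inter> sphere 0 1)"
    using closed_Int_compact[OF closed_subspace[OF U(1)] compact_sphere] .
  moreover obtain u0 where "u0 \<in> U" "u0 \<noteq> 0"
    using U(2) subspace_0[OF U(1)] by blast
  then have "(1 / norm u0) *\<^sub>R u0 \<in> U \<inter> sphere 0 1"
    using subspace_scale[OF U(1)] by auto
  then have "U \<inter> sphere 0 1 \<noteq> {}" by blast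
  moreover have "continuous_on (U \<inter> sphere 0 1) (\<lambda>v. f v \<bullet> v)"
    using f by (intro continuous_intros linear_continuous_on) (simp add: linear_conv_bounded_linear)
  ultimately obtain v where "v \<in> U \<inter> sphere 0 1" and
    max': "\<forall>w\<in>U \<inter> sphere 0 1. f w \<bullet> w \<le> f v \<bullet> v"
    using continuous_attains_sup[of "U \<inter> sphere 0 1" "\<lambda>v. f v \<bullet> v"] by blast
  then have v: "v \<in> U" "norm v = 1" by auto
  have max: "f w \<bullet> w \<le> f v \<bullet> v" if "w \<in> U" "norm w = 1" for w
    using max' that by simp
  define c where "c = f v \<bullet> v"
  have nonneg: "f w \<bullet> w \<le> c * (w \<bullet> w)" if "w \<in> U" for w
  proof (cases "w = 0")
    case False
    define w' where "w' = (1 / norm w) *\<^sub>R w"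
    have "w' \<in> U" "norm w' = 1"
      using that False subspace_scale[OF U(1)] by (simp_all add: w'_def)
    then have "f w' \<bullet> w' \<le> c" unfolding c_def by (rule max)
    moreover have "f w' \<bullet> w' = (f w \<bullet> w) / (w \<bullet> w)"
      by (simp add: w'_def linear_scale[OF f] dot_square_norm power2_eq_square)
    ultimately show ?thesis
      using False by (simp add: pos_divide_le_eq)
  qed (simp add: linear_0[OF f])
  have "(c *\<^sub>R v - f v) \<bullet> w = 0" if w: "w \<in> U" for w
  proof (rule ccontr)
    define B where "B = (c *\<^sub>R v - f v) \<bullet> w"
    define q where "q = c * (w \<bullet> w) - f w \<bullet> w"
    assume "(c *\<^sub>R v - f v) \<bullet> w \<noteq> 0"
    then have "B \<noteq> 0" by (simp add: B_def)
    have q: "q \<ge> 0" using nonneg[OF w] by (simp add: q_def)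
    have quad: "0 \<le> 2 * t * B + t * t * q" for t
    proof -
      have "v + t *\<^sub>R w \<in> U"
        using v(1) w U(1) by (simp add: subspace_add subspace_scale)
      from nonneg[OF this] have "f (v + t *\<^sub>R w) \<bullet> (v + t *\<^sub>R w) \<le> c * ((v + t *\<^sub>R w) \<bullet> (v + t *\<^sub>R w))" .
      moreover have "f w \<bullet> v = f v \<bullet> w" using sym[of w v] by (simp add: inner_commute)
      moreover have "v \<bullet> v = 1" using v(2) by (simp add: dot_square_norm)
      ultimately show ?thesis
        by (simp add: B_def q_def linear_add[OF f] linear_scale[OF f] inner_add_left inner_add_right
            inner_diff_left c_def[symmetric] inner_commute[of w v] algebra_simps)
    qed
    \<comment> \<open>A value of \<open>t\<close> at which the quadratic is negative if
      \<open>B \<noteq> 0\<close>; the 1 in the denominator is there because \<open>q\<close> may be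
      0.\<close>
    have "2 * (- B / (q + 1)) * B + (- B / (q + 1)) * (- B / (q + 1)) * q = - (B * B) * (q + 2) / ((q + 1) * (q + 1))"
      using q by (simp add: divide_simps) algebra
    moreover have "(B * B) * (q + 2) / ((q + 1) * (q + 1)) > 0"
    proof -
      have "B * B > 0" using \<open>B \<noteq> 0\<close> not_real_square_gt_zero by blast
      then show ?thesis using q by simp
    qed
    ultimately show False
      using quad[of "- B / (q + 1)"] by simp
  qed
  moreover have "c *\<^sub>R v - f v \<in> U"
    using v(1) U by (intro subspace_diff subspace_scale) auto
  ultimately have "(c *\<^sub>R v - f v) \<bullet> (c *\<^sub>R v - f v) = 0" by blast
  then have "f v = c *\<^sub>R v" by simp
  then show ?thesis
    using v by blast
qed

text \<open>Induction on the dimension. If some \<open>f k\<close> is not a scalar on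
  \<open>U\<close>, one of its eigenspaces is a proper nonzero subspace, invariant under all
  operators that commute with \<open>f k\<close>.\<close>

lemma joint_eigenvector:
  fixes f :: "'k \<Rightarrow> 'a::euclidean_space \<Rightarrow> 'a"
  assumes f: "\<And>k. linear (f k)" and sym: "\<And>k u v. f k u \<bullet> v = u \<bullet> f k v"
    and comm: "\<And>k l u. f k (f l u) = f l (f k u)"
    and U: "subspace U" "U \<noteq> {0}" "\<And>k. f k ` U \<subseteq> U"
  shows "\<exists>v\<in>U. norm v = 1 \<and> (\<forall>k. \<exists>c. f k v = c *\<^sub>R v)"
  using U
proof (induction "dim U" arbitrary: U rule: less_induct)
  case less
  show ?case
  proof (cases "\<forall>k. \<exists>c. \<forall>u\<in>U. f k u = c *\<^sub>R u")
    case True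
    obtain u where "u \<in> U" "u \<noteq> 0"
      using less.prems(2) subspace_0[OF less.prems(1)] by blast
    then have "(1 / norm u) *\<^sub>R u \<in> U" "norm ((1 / norm u) *\<^sub>R u) = 1"
      using subspace_scale[OF less.prems(1)] by auto
    then show ?thesis using True by blast
  next
    case False
    then obtain k where k: "\<nexists>c. \<forall>u\<in>U. f k u = c *\<^sub>R u" by blast
    obtain v c where v: "v \<in> U" "norm v = 1" "f k v = c *\<^sub>R v"
      using symmetric_operator_eigenvector[OF f sym less.prems(1,2,3)] by blast
    define U' where "U' = {u \<in> U. f k u = c *\<^sub>R u}"
    have U': "subspace U'"
      using less.prems(1) unfolding U'_def subspace_def
      by (auto simp: linear_0[OF f] linear_add[OF f] linear_scale[OF f] scaleR_add_right)
    have "U' \<subseteq> U" by (auto simp: U'_def)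
    moreover have "U' \<noteq> U" using k by (auto simp: U'_def)
    ultimately have "dim U' < dim U"
      using subspace_dim_equal[OF U' less.prems(1)] dim_subset[of U' U] by linarith
    moreover have "v \<in> U'" "v \<noteq> 0" using v by (simp add: U'_def, metis norm_zero zero_neq_one)
    then have "U' \<noteq> {0}" by blast
    moreover have "f l ` U' \<subseteq> U'" for l
    proof
      fix y assume "y \<in> f l ` U'"
      then obtain u where u: "u \<in> U" "f k u = c *\<^sub>R u" "y = f l u" by (auto simp: U'_def)
      then have "f k y = c *\<^sub>R y"
        using comm[of k l u] by (simp add: linear_scale[OF f])
      then show "y \<in> U'" using u less.prems(3)[of l] by (auto simp: U'_def)
    qed
    ultimately obtain w where "w \<in> U'" "norm w = 1" "\<forall>k. \<exists>c. f k w = c *\<^sub>R w"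
      using less.hyps[OF _ U'] by blast
    then show ?thesis using \<open>U' \<subseteq> U\<close> by blast
  qed
qed

text \<open>Split off one joint eigenvector; by symmetry its orthogonal complement is invariant
  under all \<open>f k\<close>.\<close>

lemma joint_orthonormal_eigenvectors:
  fixes f :: "'k \<Rightarrow> 'a::euclidean_space \<Rightarrow> 'a"
  assumes f: "\<And>k. linear (f k)" and sym: "\<And>k u v. f k u \<bullet> v = u \<bullet> f k v"
    and comm: "\<And>k l u. f k (f l u) = f l (f k u)"
    and U: "subspace U" "\<And>k. f k ` U \<subseteq> U"
  shows "\<exists>B. finite B \<and> B \<subseteq> U \<and> card B = dim U \<and> (\<forall>u\<in>B. norm u = 1 \<and> (\<forall>k. \<exists>c. f k u = c *\<^sub>R u)) \<and>
    (\<forall>u\<in>B. \<forall>w\<in>B. u \<noteq> w \<longrightarrow> u \<bullet> w = 0)"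
  using U
proof (induction "dim U" arbitrary: U)
  case 0
  then show ?case by (intro exI[of _ "{}"]) auto
next
  case (Suc d)
  have "U \<noteq> {0}" using Suc.hyps(2) by (metis dim_singleton dim_eq_0 nat.distinct(1) subset_refl)
  have "\<exists>v\<in>U. norm v = 1 \<and> (\<forall>k. \<exists>c. f k v = c *\<^sub>R v)"
    by (rule joint_eigenvector[OF f sym comm Suc.prems(1) \<open>U \<noteq> {0}\<close> Suc.prems(2)])
  then obtain v where v: "v \<in> U" "norm v = 1" "\<forall>k. \<exists>c. f k v = c *\<^sub>R v"
    by blast
  define U' where "U' = {u \<in> U. u \<bullet> v = 0}"
  have U': "subspace U'"
    using Suc.prems(1) unfolding U'_def subspace_def by (auto simp: inner_add_left)
  have "dim {y \<in> U. \<forall>x\<in>span {v}. orthogonal x y} + dim (span {v}) = dim U"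
    using v(1) Suc.prems(1) by (intro dim_subspace_orthogonal_to_vectors) (auto simp: span_minimal)
  moreover have "{y \<in> U. \<forall>x\<in>span {v}. orthogonal x y} = U'"
    by (auto simp: U'_def span_singleton orthogonal_def inner_commute)
  moreover have "v \<noteq> 0" using v(2) by auto
  ultimately have "d = dim U'"
    using Suc.hyps(2) by simp
  moreover have "f k ` U' \<subseteq> U'" for k
  proof
    fix y assume "y \<in> f k ` U'"
    then obtain u where u: "u \<in> U" "u \<bullet> v = 0" "y = f k u" by (auto simp: U'_def)
    obtain c where "f k v = c *\<^sub>R v" using v(3) by blast
    then have "y \<bullet> v = 0" using sym[of k u v] u by simp
    then show "y \<in> U'" using u Suc.prems(2)[of k] by (auto simp: U'_def)
  qed
  ultimately obtain B where B: "finite B" "B \<subseteq> U'" "card B = d"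
    "\<forall>u\<in>B. norm u = 1 \<and> (\<forall>k. \<exists>c. f k u = c *\<^sub>R u)" "\<forall>u\<in>B. \<forall>w\<in>B. u \<noteq> w \<longrightarrow> u \<bullet> w = 0"
    using Suc.hyps(1)[OF _ U'] by metis
  have orth: "u \<bullet> v = 0" if "u \<in> B" for u using that B(2) by (auto simp: U'_def)
  have "v \<notin> B" using orth v(2) by (metis dot_square_norm norm_eq_zero power_one zero_neq_one)
  then have "card (insert v B) = dim U" using B(1,3) Suc.hyps(2) by simp
  then show ?case
    using B v orth by (intro exI[of _ "insert v B"]) (auto simp: U'_def inner_commute)
qed

lemma joint_orthonormal_eigenbasis:
  fixes f :: "'k \<Rightarrow> real^'n \<Rightarrow> real^'n"
  assumes "\<And>k. linear (f k)" "\<And>k u v. f k u \<bullet> v = u \<bullet> f k v" "\<And>k l u. f k (f l u) = f l (f k u)"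
  shows "\<exists>w :: 'n \<Rightarrow> real^'n. (\<forall>i j. w i \<bullet> w j = (if i = j then 1 else 0)) \<and> (\<forall>k i. \<exists>c. f k (w i) = c *\<^sub>R w i)"
proof -
  obtain B where B: "finite B" "card B = CARD('n)" "\<forall>u\<in>B. norm u = 1 \<and> (\<forall>k. \<exists>c. f k u = c *\<^sub>R u)"
    "\<forall>u\<in>B. \<forall>w\<in>B. u \<noteq> w \<longrightarrow> u \<bullet> w = 0"
    using joint_orthonormal_eigenvectors[where f = f, OF assms subspace_UNIV subset_UNIV] by auto
  then obtain w where w: "bij_betw w (UNIV :: 'n set) B"
    using finite_same_card_bij[of "UNIV :: 'n set" B] by auto
  then have wB: "w i \<in> B" for i by (auto simp: bij_betw_def)
  have "w i \<bullet> w j = (if i = j then 1 else 0)" for i j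
  proof (cases "i = j")
    case True
    then show ?thesis using B(3) wB[of j] by (simp add: dot_square_norm)
  next
    case False
    then have "w i \<noteq> w j" using w by (auto simp: bij_betw_def inj_def)
    then show ?thesis using B(4) wB False by simp
  qed
  then show ?thesis using B(3) wB by blast
qed

text \<open>Orthonormal vectors in full number are the columns of an orthogonal matrix, whose
  transpose preserves inner products.\<close>

lemma orthonormal_parseval:
  fixes c :: "'k::finite \<Rightarrow> real^'k"
  assumes "\<And>p q. c p \<bullet> c q = (if p = q then 1 else 0)"
  shows "v \<bullet> w = (\<Sum>q\<in>UNIV. (c q \<bullet> v) * (c q \<bullet> w))"
proof -
  define Q where "Q = (\<chi> p q. c q $ p)"
  have col: "column q Q = c q" for q by (simp add: Q_def column_def vec_eq_iff)
  have "orthogonal_matrix Q"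
    unfolding orthogonal_matrix vec_eq_iff transpose_mult_entry by (simp add: col assms mat_def)
  then have "(transpose Q *v v) \<bullet> (transpose Q *v w) = v \<bullet> w"
    by (intro orthogonal_matrix_inner) simp
  moreover have "(transpose Q *v u) $ q = c q \<bullet> u" for u q
    by (simp add: matrix_vector_mult_def transpose_def Q_def inner_vec_def)
  ultimately show ?thesis by (simp add: inner_vec_def[of "v v* Q"])
qed

section \<open>Smooth dependence of eigenvectors\<close>

lemma bounded_bilinear_matrix_vector_mult:
  "bounded_bilinear ((*v) :: real^'n^'m \<Rightarrow> real^'n \<Rightarrow> real^'m)"
  unfolding bilinear_conv_bounded_bilinear[symmetric] bilinear_def
  by (auto simp: linear_iff matrix_vector_mult_def vec_eq_iff
      distrib_left distrib_right sum.distrib sum_distrib_left algebra_simps)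

lemmas smooth_on_matrix_vector_mult[smooth_intros] =
  smooth_on_bounded_bilinear[OF bounded_bilinear_matrix_vector_mult]

definition vec_left :: "real^('a::finite + 'b::finite) \<Rightarrow> real^'a"
  where "vec_left z = (\<chi> i. z $ Inl i)"

definition vec_right :: "real^('a::finite + 'b::finite) \<Rightarrow> real^'b"
  where "vec_right z = (\<chi> i. z $ Inr i)"

definition vec_join :: "real^'a::finite \<Rightarrow> real^'b::finite \<Rightarrow> real^('a + 'b)"
  where "vec_join x y = (\<chi> p. case p of Inl i \<Rightarrow> x $ i | Inr i \<Rightarrow> y $ i)"

lemma vec_join_simps[simp]:
  "vec_left (vec_join x y) = x" "vec_right (vec_join x y) = y" "vec_join (vec_left z) (vec_right z) = z"
  unfolding vec_left_def vec_right_def vec_join_def vec_eq_iff split_sum_all by simp_all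

lemma vec_join_eq_0: "vec_join x y = 0 \<longleftrightarrow> x = 0 \<and> y = 0"
  unfolding vec_join_def vec_eq_iff split_sum_all by simp

lemma bounded_linear_vec_left: "bounded_linear vec_left"
  unfolding linear_conv_bounded_linear[symmetric] by (rule linearI) (simp_all add: vec_left_def vec_eq_iff)

lemma bounded_linear_vec_right: "bounded_linear vec_right"
  unfolding linear_conv_bounded_linear[symmetric] by (rule linearI) (simp_all add: vec_right_def vec_eq_iff)

lemma bounded_linear_vec_join_0: "bounded_linear (\<lambda>x. vec_join x 0)" "bounded_linear (vec_join 0)"
  unfolding linear_conv_bounded_linear[symmetric]
  by (rule linearI; simp add: vec_join_def vec_eq_iff split_sum_all)+

lemma vec_join_split: "vec_join x y = vec_join x 0 + vec_join 0 y"
  unfolding vec_join_def vec_eq_iff split_sum_all by simp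

lemma dif_bounded_linear_self: "bounded_linear L \<Longrightarrow> dif L x u = L u"
  by (simp add: dif_eq[OF bounded_linear_imp_has_derivative])

text \<open>For \<open>w0\<close> with \<open>H w0 = c w0\<close>, \<open>c \<noteq> 0\<close>, the equation \<open>H w = (w0 \<bullet> H w) G w\<close> fixes the scale of the
  eigenvector \<open>w\<close> and can be solved by the inverse function theorem.\<close>

lemma smooth_generalized_eigenvector:
  fixes H G :: "real^'n::finite \<Rightarrow> real^'n^'n"
  assumes W: "open W" "x0 \<in> W" and sm: "smooth_on W H" "smooth_on W G"
    and G0: "G x0 = mat 1" and sym: "transpose (H x0) = H x0"
    and w0: "norm w0 = 1" "H x0 *v w0 = c *\<^sub>R w0" "c \<noteq> 0"
    and simple: "\<And>\<eta>. H x0 *v \<eta> = c *\<^sub>R \<eta> \<Longrightarrow> \<exists>t. \<eta> = t *\<^sub>R w0"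
  shows "\<exists>N w. open N \<and> x0 \<in> N \<and> N \<subseteq> W \<and> smooth_on N w \<and> w x0 = w0 \<and>
    (\<forall>x\<in>N. H x *v w x = (w0 \<bullet> (H x *v w x)) *\<^sub>R (G x *v w x))"
proof -
  define L where "L = (vec_left :: real^('n + 'n) \<Rightarrow> real^'n)"
  define R where "R = (vec_right :: real^('n + 'n) \<Rightarrow> real^'n)"
  have blL: "bounded_linear L" and blR: "bounded_linear R"
    by (simp_all add: L_def R_def bounded_linear_vec_left bounded_linear_vec_right)
  define U where "U = L -` W"
  have U: "open U"
    unfolding U_def by (rule open_vimage[OF W(1)]) (rule linear_continuous_on[OF blL])
  have smL: "smooth_on U L" and smR: "smooth_on U R"
    using smooth_on_bounded_linear[OF blL smooth_on_id U] smooth_on_bounded_linear[OF blR smooth_on_id U] U by simp_all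
  have smHL: "smooth_on U (\<lambda>z. H (L z))" and smGL: "smooth_on U (\<lambda>z. G (L z))"
    by (rule smooth_on_compose[OF _ smL U W(1)]; use sm in \<open>auto simp: U_def\<close>)+
  \<comment> \<open>\<open>z\<close> stands for the pair of a point \<open>L z\<close> and a vector
    \<open>R z\<close>; \<open>P\<close> vanishes when the vector solves the normalized equation at
    the point.\<close>
  define P where "P = (\<lambda>z. H (L z) *v R z - (w0 \<bullet> (H (L z) *v R z)) *\<^sub>R (G (L z) *v R z))"
  have smP: "smooth_on U P"
    unfolding P_def by (intro smooth_intros smHL smGL smR U)
  \<comment> \<open>With the point kept as a component, the inverse function theorem does the work
    of the implicit function theorem.\<close>
  define \<Psi> where "\<Psi> = (\<lambda>z. vec_join (L z) (P z))"
  have \<Psi>_eq: "\<Psi> = (\<lambda>z. vec_join (L z) 0 + vec_join 0 (P z))"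
    unfolding \<Psi>_def by (rule ext) (rule vec_join_split)
  have sm1: "smooth_on U (\<lambda>z. vec_join (L z) 0 :: real^('n + 'n))" and sm2: "smooth_on U (\<lambda>z. vec_join 0 (P z) :: real^('n + 'n))"
    using smooth_on_bounded_linear[OF bounded_linear_vec_join_0(1) smL U]
      smooth_on_bounded_linear[OF bounded_linear_vec_join_0(2) smP U] by simp_all
  have sm\<Psi>: "smooth_on U \<Psi>"
    unfolding \<Psi>_eq by (intro smooth_intros sm1 sm2 U)
  define z0 where "z0 = vec_join x0 w0"
  have z0: "L z0 = x0" "R z0 = w0" "z0 \<in> U"
    using W(2) by (simp_all add: z0_def L_def R_def U_def)
  note d = smooth_on_differentiable[OF _ z0(3)]
  have d\<Psi>: "dif \<Psi> z0 \<zeta> = vec_join (L \<zeta>) (dif P z0 \<zeta>)" for \<zeta>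
  proof -
    have "dif \<Psi> z0 \<zeta> = dif (\<lambda>z. vec_join (L z) 0) z0 \<zeta> + dif (\<lambda>z. vec_join 0 (P z)) z0 \<zeta>"
      unfolding \<Psi>_eq by (rule dif_add[OF d[OF sm1] d[OF sm2]])
    also have "\<dots> = vec_join (L \<zeta>) 0 + vec_join 0 (dif P z0 \<zeta>)"
      by (simp add: dif_bounded_linear[OF bounded_linear_vec_join_0(1) d[OF smL]]
          dif_bounded_linear[OF bounded_linear_vec_join_0(2) d[OF smP]] dif_bounded_linear_self[OF blL])
    finally show ?thesis using vec_join_split by metis
  qed
  have dP: "dif P z0 \<zeta> = H x0 *v R \<zeta> - ((w0 \<bullet> (H x0 *v R \<zeta>)) *\<^sub>R w0 + c *\<^sub>R R \<zeta>)" if "L \<zeta> = 0" for \<zeta>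
  proof -
    have comp0: "dif (\<lambda>z. K (L z)) z0 \<zeta> = 0" if K: "smooth_on W K" for K :: "real^'n \<Rightarrow> real^'n^'n"
    proof -
      have K': "K differentiable (at (L z0))"
        using smooth_on_differentiable[OF K W(2)] z0(1) by simp
      show ?thesis
        using dif_compose[OF d[OF smL] K', of \<zeta>] linear_0[OF linear_dif[OF K']]
        by (simp add: dif_bounded_linear_self[OF blL] \<open>L \<zeta> = 0\<close>)
    qed
    have 1: "smooth_on U (\<lambda>z. H (L z) *v R z)" "smooth_on U (\<lambda>z. G (L z) *v R z)"
      by (intro smooth_intros smHL smGL smR U)+
    have 2: "smooth_on U (\<lambda>z. w0 \<bullet> (H (L z) *v R z))"
      by (intro smooth_intros 1 U)
    have 3: "smooth_on U (\<lambda>z. (w0 \<bullet> (H (L z) *v R z)) *\<^sub>R (G (L z) *v R z))"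
      by (intro smooth_intros 1 2 U)
    have dH: "dif (\<lambda>z. H (L z) *v R z) z0 \<zeta> = H x0 *v R \<zeta>"
      by (simp add: dif_bounded_bilinear[OF bounded_bilinear_matrix_vector_mult d[OF smHL] d[OF smR]]
          comp0[OF sm(1)] dif_bounded_linear_self[OF blR] z0)
    have dG: "dif (\<lambda>z. G (L z) *v R z) z0 \<zeta> = R \<zeta>"
      by (simp add: dif_bounded_bilinear[OF bounded_bilinear_matrix_vector_mult d[OF smGL] d[OF smR]]
          comp0[OF sm(2)] dif_bounded_linear_self[OF blR] z0 G0)
    have dw: "dif (\<lambda>z. w0 \<bullet> (H (L z) *v R z)) z0 \<zeta> = w0 \<bullet> (H x0 *v R \<zeta>)"
      by (simp add: dif_bounded_linear[OF bounded_linear_inner_right d[OF 1(1)]] dH)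
    have "w0 \<bullet> w0 = 1" using w0(1) by (simp add: dot_square_norm)
    then show ?thesis
      unfolding P_def
      by (simp add: dif_diff[OF d[OF 1(1)] d[OF 3]] dH dif_scaleR[OF d[OF 2] d[OF 1(2)]] dG dw z0 G0 w0(2))
  qed
  have "inj (dif \<Psi> z0)"
    unfolding linear_injective_0[OF smooth_on_linear_dif[OF sm\<Psi> z0(3)]]
  proof (intro allI impI)
    fix \<zeta> assume "dif \<Psi> z0 \<zeta> = 0"
    then have L0: "L \<zeta> = 0" and "dif P z0 \<zeta> = 0"
      by (simp_all add: d\<Psi> vec_join_eq_0)
    then have eq: "H x0 *v R \<zeta> = (w0 \<bullet> (H x0 *v R \<zeta>)) *\<^sub>R w0 + c *\<^sub>R R \<zeta>"
      using dP[OF L0] by simp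
    \<comment> \<open>Pairing the equation with \<open>w0\<close> gives
      \<open>c * t = c * t + c * t\<close>. So the normalization excludes the direction of the
      eigenvector, and simplicity of the eigenvalue excludes all others.\<close>
    define t where "t = w0 \<bullet> R \<zeta>"
    have "w0 \<bullet> (H x0 *v R \<zeta>) = (H x0 *v w0) \<bullet> R \<zeta>"
      using dot_lmul_matrix[of w0 "H x0" "R \<zeta>"] sym by (metis transpose_matrix_vector)
    then have ct: "w0 \<bullet> (H x0 *v R \<zeta>) = c * t"
      by (simp add: w0(2) t_def)
    have "w0 \<bullet> (H x0 *v R \<zeta>) = w0 \<bullet> ((w0 \<bullet> (H x0 *v R \<zeta>)) *\<^sub>R w0 + c *\<^sub>R R \<zeta>)"
      using eq by simp
    moreover have "w0 \<bullet> w0 = 1" using w0(1) by (simp add: dot_square_norm)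
    ultimately have "c * t = c * t + c * t"
      by (simp add: ct inner_add_right t_def[symmetric])
    then have t: "t = 0" using w0(3) by simp
    with eq ct have "H x0 *v R \<zeta> = c *\<^sub>R R \<zeta>" by simp
    then obtain s where s: "R \<zeta> = s *\<^sub>R w0" using simple by blast
    then have "s = 0" using t w0(1) by (simp add: t_def dot_square_norm)
    then have "R \<zeta> = 0" using s by simp
    then have "vec_join (L \<zeta>) (R \<zeta>) = 0" using L0 by (simp add: vec_join_eq_0)
    then show "\<zeta> = 0" by (simp add: L_def R_def)
  qed
  then obtain U' V \<Gamma> where *: "open U'" "U' \<subseteq> U" "z0 \<in> U'" "open V" "homeomorphism U' V \<Psi> \<Gamma>" "smooth_on V \<Gamma>"
    using smooth_inverse_function[OF U sm\<Psi> z0(3)] by metis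
  have "w0 \<bullet> w0 = 1" using w0(1) by (simp add: dot_square_norm)
  then have \<Psi>z0: "\<Psi> z0 = vec_join x0 0"
    by (simp add: \<Psi>_def P_def z0 w0(2) G0)
  define N where "N = (\<lambda>x. vec_join x 0) -` V"
  define w where "w = (\<lambda>x. R (\<Gamma> (vec_join x 0)))"
  have N: "open N"
    unfolding N_def by (rule open_vimage[OF *(4)]) (rule linear_continuous_on[OF bounded_linear_vec_join_0(1)])
  have \<Gamma>: "L (\<Gamma> (vec_join x 0)) = x" "P (\<Gamma> (vec_join x 0)) = 0" "x \<in> W" if "x \<in> N" for x
  proof -
    have "\<Gamma> (vec_join x 0) \<in> U'" "\<Psi> (\<Gamma> (vec_join x 0)) = vec_join x 0"
      using *(5) that by (auto simp: homeomorphism_def N_def)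
    then show *: "L (\<Gamma> (vec_join x 0)) = x" "P (\<Gamma> (vec_join x 0)) = 0"
      unfolding \<Psi>_def by (metis vec_join_simps(1), metis vec_join_simps(2))
    then show "x \<in> W" using \<open>\<Gamma> (vec_join x 0) \<in> U'\<close> \<open>U' \<subseteq> U\<close> by (auto simp: U_def)
  qed
  have "smooth_on N w"
  proof -
    have "smooth_on N (\<lambda>x. \<Gamma> (vec_join x 0))"
      by (rule smooth_on_compose[OF *(6) smooth_on_bounded_linear[OF bounded_linear_vec_join_0(1) smooth_on_id[OF N] N] N *(4)])
        (auto simp: N_def)
    then show ?thesis
      unfolding w_def by (rule smooth_on_bounded_linear[OF blR _ N])
  qed
  moreover have "x0 \<in> N" "w x0 = w0"
    using *(3,5) \<Psi>z0 z0(2) unfolding N_def w_def homeomorphism_def by force+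
  moreover have "H x *v w x = (w0 \<bullet> (H x *v w x)) *\<^sub>R (G x *v w x)" if "x \<in> N" for x
    using \<Gamma>(2)[OF that] unfolding P_def \<Gamma>(1)[OF that] w_def[symmetric] by (simp add: w_def)
  ultimately show ?thesis
    using N \<Gamma>(3) by (intro exI[of _ N] exI[of _ w]) blast
qed

section \<open>Principal directions\<close>

lemma smooth_on_dif_apply:
  fixes f :: "real^'n::finite \<Rightarrow> 'b::real_normed_vector"
  assumes "open W" "smooth_on W f" "smooth_on W s"
  shows "smooth_on W (\<lambda>x. dif f x (s x))"
proof -
  have "smooth_on W (\<lambda>x. \<Sum>j\<in>UNIV. s x $ j *\<^sub>R pd j f x)"
    by (intro smooth_intros assms)
  then show ?thesis
    by (rule smooth_on_cong[OF _ assms(1)]) (simp add: dif_pd smooth_on_differentiable[OF assms(2)])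
qed

section \<open>Intrinsic quantities and the Gauss equation\<close>

lemma tangential_second_derivative_intrinsic:
  fixes X :: "real^'n::finite \<Rightarrow> 'e::euclidean_space" and \<phi> :: "real^'n \<Rightarrow> 'f::euclidean_space"
  assumes W: "open W" "smooth_on W X" "smooth_on W \<phi>" "x \<in> W"
    and ff: "\<And>x u w. x \<in> W \<Longrightarrow> first_ff X x u w = first_ff \<phi> x u w"
  shows "dif X x v \<bullet> dif (\<lambda>y. dif X y w) x u = dif \<phi> x v \<bullet> dif (\<lambda>y. dif \<phi> y w) x u"
proof -
  have "dif (\<lambda>y. first_ff X y p q) x = dif (\<lambda>y. first_ff \<phi> y p q) x" for p q
    by (rule dif_cong_open[OF W(1,4)]) (rule ff)
  then show ?thesis
    using koszul_formula[OF W(1,2,4), of v w u] koszul_formula[OF W(1,3,4), of v w u] by simp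
qed

text \<open>The expression is the curvature of the first fundamental form, up to terms that depend only on
  the form itself.\<close>

lemma second_derivatives_intrinsic:
  fixes X :: "real^'n::finite \<Rightarrow> 'e::euclidean_space" and \<phi> :: "real^'n \<Rightarrow> 'f::euclidean_space"
  assumes W: "open W" "smooth_on W X" "smooth_on W \<phi>" "x \<in> W"
    and ff: "\<And>x u w. x \<in> W \<Longrightarrow> first_ff X x u w = first_ff \<phi> x u w"
  shows "dif (\<lambda>y. dif X y b) x a \<bullet> dif (\<lambda>y. dif X y d) x c - dif (\<lambda>y. dif X y c) x a \<bullet> dif (\<lambda>y. dif X y d) x b
    = dif (\<lambda>y. dif \<phi> y b) x a \<bullet> dif (\<lambda>y. dif \<phi> y d) x c - dif (\<lambda>y. dif \<phi> y c) x a \<bullet> dif (\<lambda>y. dif \<phi> y d) x b"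
proof -
  \<comment> \<open>Products of second derivatives arise when inner products of a first with a
    second derivative are differentiated. The third derivatives cancel by symmetry, and the
    differentiated inner products are intrinsic.\<close>
  have R: "dif (\<lambda>y. dif Y y b) x a \<bullet> dif (\<lambda>y. dif Y y d) x c - dif (\<lambda>y. dif Y y c) x a \<bullet> dif (\<lambda>y. dif Y y d) x b
    = dif (\<lambda>y. dif Y y d \<bullet> dif (\<lambda>y. dif Y y b) y a) x c - dif (\<lambda>y. dif Y y d \<bullet> dif (\<lambda>y. dif Y y c) y a) x b"
    if Y: "smooth_on W Y" for Y :: "real^'n \<Rightarrow> 'z::euclidean_space"
  proof -
    have eq: "dif (\<lambda>y. dif Y y d \<bullet> dif (\<lambda>y. dif Y y q) y a) x r =
      dif Y x d \<bullet> dif (\<lambda>y. dif (\<lambda>y. dif Y y q) y a) x r + dif (\<lambda>y. dif Y y d) x r \<bullet> dif (\<lambda>y. dif Y y q) x a" for q r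
      by (rule dif_inner) (rule smooth_on_differentiable[OF _ W(4)], intro smooth_intros Y)+
    have swap: "dif (\<lambda>y. dif (\<lambda>y. dif Y y q) y a) x r = dif (\<lambda>y. dif (\<lambda>y. dif Y y a) y q) x r" for q r
    proof -
      have "dif (\<lambda>y. dif (\<lambda>y. dif Y y q) y a) x = dif (\<lambda>y. dif (\<lambda>y. dif Y y a) y q) x"
        by (rule dif_cong_open[OF W(1,4)]) (rule second_dif_commute[OF W(1) Y])
      then show ?thesis by simp
    qed
    have "dif (\<lambda>y. dif (\<lambda>y. dif Y y b) y a) x c = dif (\<lambda>y. dif (\<lambda>y. dif Y y c) y a) x b"
      unfolding swap by (rule second_dif_commute[OF W(1) smooth_on_dif[OF Y] W(4)])
    then show ?thesis
      unfolding eq by (simp add: inner_commute)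
  qed
  have "dif (\<lambda>y. dif X y d \<bullet> dif (\<lambda>y. dif X y q) y a) x = dif (\<lambda>y. dif \<phi> y d \<bullet> dif (\<lambda>y. dif \<phi> y q) y a) x" for q
    by (rule dif_cong_open[OF W(1,4)]) (rule tangential_second_derivative_intrinsic[OF W(1-3) _ ff])
  then show ?thesis
    unfolding R[OF W(2)] R[OF W(3)] by simp
qed

lemma sphere_frame_parseval:
  fixes \<phi> :: "real^'n::finite \<Rightarrow> real^('n + 1)" and s :: "'n \<Rightarrow> real^'n"
  assumes W: "open W" "smooth_on W \<phi>" "\<phi> ` W \<subseteq> sphere 0 1" "x \<in> W"
    and s: "\<And>i j. first_ff \<phi> x (s i) (s j) = (if i = j then 1 else 0)"
  shows "v \<bullet> w = (\<Sum>i\<in>UNIV. (dif \<phi> x (s i) \<bullet> v) * (dif \<phi> x (s i) \<bullet> w)) + (\<phi> x \<bullet> v) * (\<phi> x \<bullet> w)"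
proof -
  define c where "c = (\<lambda>q. case q of Inl i \<Rightarrow> dif \<phi> x (s i) | Inr (z :: 1) \<Rightarrow> \<phi> x)"
  have "\<phi> x \<bullet> \<phi> x = 1" using W(3,4) by (auto simp: dot_square_norm)
  moreover have "dif \<phi> x (s i) \<bullet> \<phi> x = 0" "\<phi> x \<bullet> dif \<phi> x (s i) = 0" for i
    using sphere_valued_dif_orthogonal[OF W] by (simp_all add: inner_commute)
  ultimately have "\<forall>p q. c p \<bullet> c q = (if p = q then 1 else 0)"
    unfolding split_sum_all c_def using s by (simp add: first_ff_def)
  then have "v \<bullet> w = (\<Sum>q\<in>UNIV. (c q \<bullet> v) * (c q \<bullet> w))"
    by (intro orthonormal_parseval) blast
  then show ?thesis
    by (simp add: sum_UNIV_Plus c_def)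
qed

context framed_immersion
begin

text \<open>The normal frame, the tangent frame and the position are m + n + 1 orthonormal vectors,
  hence a basis of the ambient space.\<close>

lemma frame_parseval:
  fixes s :: "'n \<Rightarrow> real^'n"
  assumes x: "x \<in> W" and s: "\<And>i j. first_ff X x (s i) (s j) = (if i = j then 1 else 0)"
  shows "v \<bullet> w = (\<Sum>k\<in>UNIV. (E k x \<bullet> v) * (E k x \<bullet> w)) +
    (\<Sum>i\<in>UNIV. (dif X x (s i) \<bullet> v) * (dif X x (s i) \<bullet> w)) + (X x \<bullet> v) * (X x \<bullet> w)"
proof -
  define c where "c = (\<lambda>q. case q of Inl k \<Rightarrow> E k x | Inr (Inl i) \<Rightarrow> dif X x (s i) | Inr (Inr (z :: 1)) \<Rightarrow> X x)"
  have "dif X x (s i) \<bullet> X x = 0" "X x \<bullet> dif X x (s i) = 0" "E k x \<bullet> dif X x (s i) = 0" "dif X x (s i) \<bullet> E k x = 0"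
    "E k x \<bullet> X x = 0" "X x \<bullet> E k x = 0" for i k
    using E_X[OF x] E_dX[OF x] dX_X[OF x] by (simp_all add: inner_commute)
  then have "\<forall>p q. c p \<bullet> c q = (if p = q then 1 else 0)"
    unfolding split_sum_all c_def using s orthonormalE[OF x] X_X[OF x] by (simp add: first_ff_def)
  then have "v \<bullet> w = (\<Sum>q\<in>UNIV. (c q \<bullet> v) * (c q \<bullet> w))"
    by (intro orthonormal_parseval) blast
  then show ?thesis
    by (simp add: sum_UNIV_Plus c_def)
qed

lemma tangent_parseval:
  fixes s :: "'n \<Rightarrow> real^'n"
  assumes x: "x \<in> W" and s: "\<And>i j. first_ff X x (s i) (s j) = (if i = j then 1 else 0)"
    and w: "\<And>k. E k x \<bullet> w = 0" "X x \<bullet> w = 0"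
  shows "v \<bullet> w = (\<Sum>i\<in>UNIV. (dif X x (s i) \<bullet> v) * (dif X x (s i) \<bullet> w))"
  using frame_parseval[OF x s, of v w] by (simp add: w)

text \<open>Expand the second derivatives of \<open>X\<close> and of \<phi> in adapted frames. The
  tangential and radial parts agree, and \<phi>, being of full dimension in its sphere, has no
  normal part. Hence the normal terms of \<open>X\<close> contribute nothing to the expression in
  \<open>second_derivatives_intrinsic\<close>.\<close>

lemma gauss_equation:
  fixes \<phi> :: "real^'n \<Rightarrow> real^('n + 1)" and s :: "'n \<Rightarrow> real^'n"
  assumes x: "x \<in> W" and s: "\<And>i j. first_ff X x (s i) (s j) = (if i = j then 1 else 0)"
    and \<phi>: "smooth_on W \<phi>" "\<phi> ` W \<subseteq> sphere 0 1"
    and ff: "\<And>x u w. x \<in> W \<Longrightarrow> first_ff X x u w = first_ff \<phi> x u w"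
  shows "(\<Sum>k\<in>UNIV. (dif X x b \<bullet> dif (E k) x a) * (dif X x d \<bullet> dif (E k) x c))
    = (\<Sum>k\<in>UNIV. (dif X x c \<bullet> dif (E k) x a) * (dif X x d \<bullet> dif (E k) x b))"
proof -
  let ?\<Gamma> = "\<lambda>i b a. dif X x (s i) \<bullet> dif (\<lambda>y. dif X y b) x a"
  have ddX: "dif (\<lambda>y. dif X y b) x a \<bullet> dif (\<lambda>y. dif X y d) x c =
    (\<Sum>k\<in>UNIV. (dif X x b \<bullet> dif (E k) x a) * (dif X x d \<bullet> dif (E k) x c)) + (\<Sum>i\<in>UNIV. ?\<Gamma> i b a * ?\<Gamma> i d c)
     + first_ff X x b a * first_ff X x d c" for a b c d
  proof -
    have "E k x \<bullet> dif (\<lambda>y. dif X y p) x q = - (dif X x p \<bullet> dif (E k) x q)" for k p q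
      using ddX_E[OF x] by (simp add: inner_commute)
    moreover have "X x \<bullet> dif (\<lambda>y. dif X y p) x q = - first_ff X x p q" for p q
      using ddX_X[OF x] by (simp add: inner_commute)
    ultimately show ?thesis
      by (subst frame_parseval[OF x s]) simp_all
  qed
  have dd\<phi>: "dif (\<lambda>y. dif \<phi> y b) x a \<bullet> dif (\<lambda>y. dif \<phi> y d) x c =
    (\<Sum>i\<in>UNIV. ?\<Gamma> i b a * ?\<Gamma> i d c) + first_ff X x b a * first_ff X x d c" for a b c d
  proof -
    have "dif \<phi> x v \<bullet> dif (\<lambda>y. dif \<phi> y p) x q = dif X x v \<bullet> dif (\<lambda>y. dif X y p) x q" for v p q
      by (rule tangential_second_derivative_intrinsic[OF openW smX \<phi>(1) x ff, symmetric])
    moreover have "\<phi> x \<bullet> dif (\<lambda>y. dif \<phi> y p) x q = - first_ff X x p q" for p q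
    proof -
      have "\<phi> y \<bullet> dif \<phi> y p = 0" if "y \<in> W" for y
        using sphere_valued_dif_orthogonal[OF openW \<phi> that] by (simp add: inner_commute)
      from dif_inner_const_on[OF openW x \<phi>(1) smooth_on_dif[OF \<phi>(1)] this, of q] show ?thesis
        using ff[OF x, of p q] inner_commute[of "dif \<phi> x q" "dif \<phi> x p"] unfolding first_ff_def by linarith
    qed
    moreover have "first_ff \<phi> x (s i) (s j) = (if i = j then 1 else 0)" for i j
      using s ff[OF x] by simp
    ultimately show ?thesis
      by (subst sphere_frame_parseval[OF openW \<phi> x]) simp_all
  qed
  show ?thesis
    using second_derivatives_intrinsic[OF openW smX \<phi>(1) x ff, of b a d c]
    unfolding ddX dd\<phi> by simp
qed

end

section \<open>Principal frames, curvature normals and the closed coframe\<close>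

locale principal_directions = framed_immersion W X E
  for W :: "(real^'n::finite) set" and X :: "real^'n \<Rightarrow> real^('m::finite + 'n + 1)" and E +
  fixes \<phi> :: "real^'n \<Rightarrow> real^('n + 1)" and s :: "'n \<Rightarrow> real^'n \<Rightarrow> real^'n"
    and v :: "'m \<Rightarrow> real" and \<mu> :: "'n \<Rightarrow> real^'n \<Rightarrow> real"
  assumes sm\<phi>: "smooth_on W \<phi>" and sph\<phi>: "\<phi> ` W \<subseteq> sphere 0 1"
    and ff\<phi>: "\<And>x u w. x \<in> W \<Longrightarrow> first_ff X x u w = first_ff \<phi> x u w"
    and sms: "\<And>i. smooth_on W (s i)"
    and ortho_s: "\<And>x i j. x \<in> W \<Longrightarrow> first_ff X x (s i x) (s j x) = (if i = j then 1 else 0)"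
    and principal: "\<And>x i u. x \<in> W \<Longrightarrow>
      (\<Sum>k\<in>UNIV. v k * (dif X x u \<bullet> dif (E k) x (s i x))) = \<mu> i x * first_ff X x (s i x) u"
    and distinct: "\<And>x i j. x \<in> W \<Longrightarrow> i \<noteq> j \<Longrightarrow> \<mu> i x \<noteq> \<mu> j x"
    and nonzero: "\<And>x i. x \<in> W \<Longrightarrow> \<mu> i x \<noteq> 0"
begin

lemma dE_parseval:
  assumes x: "x \<in> W"
  shows "w \<bullet> dif (E k) x u = (\<Sum>i\<in>UNIV. (dif X x (s i x) \<bullet> w) * (dif X x (s i x) \<bullet> dif (E k) x u))"
  using dE_E[OF x, of k u] dE_X[OF x, of k u]
  by (intro tangent_parseval[OF x ortho_s[OF x]]) (simp_all add: inner_commute)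

text \<open>By the Ricci equation the shape operator of \<open>E k\<close> commutes with the
  combination with coefficients \<open>v\<close>. As the eigenvalues \<open>\<mu> i x\<close> of the
  latter are distinct, its eigenvectors diagonalize the former.\<close>

lemma second_form_offdiagonal:
  assumes x: "x \<in> W" and "i \<noteq> j"
  shows "dif X x (s i x) \<bullet> dif (E k) x (s j x) = 0"
proof -
  \<comment> \<open>The left side is the product of one shape operator with the combination;
    expanding it in the principal frame lets the combination act on its eigenvector.\<close>
  have *: "(\<Sum>l\<in>UNIV. v l * (dif (E k) x (s i x) \<bullet> dif (E l) x (s j x))) = \<mu> j x * (dif X x (s j x) \<bullet> dif (E k) x (s i x))"
    for i j
  proof -
    have "(\<Sum>l\<in>UNIV. v l * (dif (E k) x (s i x) \<bullet> dif (E l) x (s j x)))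
      = (\<Sum>l\<in>UNIV. \<Sum>p\<in>UNIV. (dif X x (s p x) \<bullet> dif (E k) x (s i x)) * (v l * (dif X x (s p x) \<bullet> dif (E l) x (s j x))))"
      by (subst dE_parseval[OF x]) (simp add: sum_distrib_left mult_ac)
    also have "\<dots> = (\<Sum>p\<in>UNIV. (dif X x (s p x) \<bullet> dif (E k) x (s i x)) * (\<mu> j x * first_ff X x (s j x) (s p x)))"
      by (subst sum.swap) (simp add: sum_distrib_left[symmetric] principal[OF x])
    also have "\<dots> = \<mu> j x * (dif X x (s j x) \<bullet> dif (E k) x (s i x))"
      by (simp add: ortho_s[OF x] if_distrib cong: if_cong)
    finally show ?thesis .
  qed
  have "(\<Sum>l\<in>UNIV. v l * (dif (E k) x (s i x) \<bullet> dif (E l) x (s j x))) = (\<Sum>l\<in>UNIV. v l * (dif (E k) x (s j x) \<bullet> dif (E l) x (s i x)))"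
    by (rule sum.cong[OF refl]) (simp only: dE_dE_commute[OF x, of k "s i x" _ "s j x"])
  then have "\<mu> j x * (dif X x (s i x) \<bullet> dif (E k) x (s j x)) = \<mu> i x * (dif X x (s i x) \<bullet> dif (E k) x (s j x))"
    unfolding * using dX_dE_commute[OF x, of "s j x" k "s i x"] by simp
  then show ?thesis
    using distinct[OF x \<open>i \<noteq> j\<close>] by simp
qed

definition T :: "'n \<Rightarrow> real^'n \<Rightarrow> real^('m + 'n + 1)"
  where "T i x = dif X x (s i x)"

text \<open>For fixed \<open>i\<close> the components of the i-th curvature normal in the parallel
  frame, with the sign convention of \<open>second_ff\<close>.\<close>

definition lam :: "'m \<Rightarrow> 'n \<Rightarrow> real^'n \<Rightarrow> real"
  where "lam k i x = T i x \<bullet> dif (E k) x (s i x)"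

definition rho :: "'n \<Rightarrow> real^'n \<Rightarrow> real"
  where "rho i x = sqrt (\<Sum>k\<in>UNIV. lam k i x * lam k i x)"

definition a :: "'m \<Rightarrow> 'n \<Rightarrow> real^'n \<Rightarrow> real"
  where "a k i x = lam k i x / rho i x"

text \<open>The unit coframe dual to the principal frame, scaled by the length of the curvature
  normal; it becomes dx_i.\<close>

definition alpha :: "'n \<Rightarrow> real^'n \<Rightarrow> real^'n \<Rightarrow> real"
  where "alpha i x u = rho i x * first_ff X x (s i x) u"

lemma T_T: "x \<in> W \<Longrightarrow> T i x \<bullet> T j x = (if i = j then 1 else 0)"
  using ortho_s by (simp add: T_def first_ff_def)

lemma lam_eigen:
  assumes x: "x \<in> W"
  shows "T i x \<bullet> dif (E k) x u = lam k i x * first_ff X x (s i x) u"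
proof -
  have "T i x \<bullet> dif (E k) x u = dif X x u \<bullet> dif (E k) x (s i x)"
    unfolding T_def by (rule dX_dE_commute[OF x])
  also have "\<dots> = (\<Sum>j\<in>UNIV. (dif X x (s j x) \<bullet> dif X x u) * (dif X x (s j x) \<bullet> dif (E k) x (s i x)))"
    by (rule dE_parseval[OF x])
  also have "\<dots> = (\<Sum>j\<in>UNIV. if j = i then (dif X x (s j x) \<bullet> dif X x u) * lam k i x else 0)"
    by (rule sum.cong[OF refl]) (simp add: second_form_offdiagonal[OF x] lam_def T_def)
  finally show ?thesis by (simp add: first_ff_def)
qed

text \<open>The eigenvalue \<open>\<mu> i x\<close> is a combination of the i-th principal
  curvatures, which therefore cannot all vanish.\<close>

lemma lam_square_pos:
  assumes x: "x \<in> W"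
  shows "(\<Sum>k\<in>UNIV. lam k i x * lam k i x) > 0"
proof (rule ccontr)
  assume "\<not> (\<Sum>k\<in>UNIV. lam k i x * lam k i x) > 0"
  moreover have "(\<Sum>k\<in>UNIV. lam k i x * lam k i x) \<ge> 0"
    by (rule sum_nonneg) simp
  ultimately have "(\<Sum>k\<in>UNIV. lam k i x * lam k i x) = 0" by linarith
  then have "\<forall>k\<in>UNIV. lam k i x * lam k i x = 0"
    by (subst (asm) sum_nonneg_eq_0_iff) auto
  then have "lam k i x = 0" for k by simp
  then have "(\<Sum>k\<in>UNIV. v k * (dif X x (s i x) \<bullet> dif (E k) x (s i x))) = 0"
    by (simp add: lam_def T_def)
  then show False
    using principal[OF x, of "s i x" i] nonzero[OF x, of i] ortho_s[OF x, of i i] by simp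
qed

lemma rho_pos: "x \<in> W \<Longrightarrow> rho i x > 0"
  unfolding rho_def using lam_square_pos by simp

text \<open>In the Gauss equation for two different principal directions one side consists of
  off-diagonal entries only.\<close>

lemma lam_orthogonal:
  assumes x: "x \<in> W" and "i \<noteq> j"
  shows "(\<Sum>k\<in>UNIV. lam k i x * lam k j x) = 0"
  using gauss_equation[OF x ortho_s[OF x] sm\<phi> sph\<phi> ff\<phi>, of "s i x" "s i x" "s j x" "s j x"] \<open>i \<noteq> j\<close>
  by (simp add: lam_def T_def second_form_offdiagonal[OF x])

lemma a_orthonormal:
  assumes x: "x \<in> W"
  shows "(\<Sum>k\<in>UNIV. a k i x * a k j x) = (if i = j then 1 else 0)"
proof -
  have "(\<Sum>k\<in>UNIV. a k i x * a k j x) = (\<Sum>k\<in>UNIV. lam k i x * lam k j x) / (rho i x * rho j x)"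
    by (simp add: a_def sum_divide_distrib)
  moreover have "rho i x * rho i x = (\<Sum>k\<in>UNIV. lam k i x * lam k i x)"
    unfolding rho_def using lam_square_pos[OF x, of i] by simp
  ultimately show ?thesis
    using lam_orthogonal[OF x] lam_square_pos[OF x, of i] by (cases "i = j") auto
qed

lemma T_dE: "x \<in> W \<Longrightarrow> T i x \<bullet> dif (E k) x u = a k i x * alpha i x u"
  using lam_eigen rho_pos by (simp add: a_def alpha_def less_imp_neq[symmetric])

text \<open>Orthonormality of the columns of \<open>a\<close> inverts \<open>T_dE\<close>. In this
  form the derivative of \<open>alpha\<close> involves second derivatives of \<open>E k\<close>,
  whose symmetry can be used.\<close>

lemma alpha_eq: "x \<in> W \<Longrightarrow> alpha i x u = (\<Sum>k\<in>UNIV. a k i x * (T i x \<bullet> dif (E k) x u))"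
  by (simp add: T_dE mult.assoc[symmetric] sum_distrib_right[symmetric] a_orthonormal)

lemma smooth_T: "smooth_on W (T i)"
  unfolding T_def[abs_def] by (rule smooth_on_dif_apply[OF openW smX sms])

lemma smooth_lam: "smooth_on W (lam k i)"
  unfolding lam_def[abs_def] by (intro smooth_intros smooth_T smooth_on_dif_apply openW smE sms)

lemma smooth_rho: "smooth_on W (rho i)"
  unfolding rho_def[abs_def] by (intro smooth_intros smooth_lam openW lam_square_pos)

lemma smooth_a: "smooth_on W (a k i)"
  unfolding a_def[abs_def] using rho_pos by (intro smooth_intros smooth_lam smooth_rho openW) (simp add: less_imp_neq[symmetric])

lemma smooth_alpha: "smooth_on W (\<lambda>x. alpha i x u)"
  unfolding alpha_def first_ff_def by (intro smooth_intros smooth_rho smooth_on_dif_apply openW smX sms)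

lemma linear_alpha: "x \<in> W \<Longrightarrow> linear (alpha i x)"
  using smooth_on_linear_dif[OF smX, of x]
  by (auto simp: linear_iff alpha_def first_ff_def inner_add_right algebra_simps)

text \<open>The Codazzi equation: as the columns of \<open>a\<close> are orthonormal, the forms \<open>alpha i\<close> are closed.\<close>

lemma alpha_closed:
  assumes x: "x \<in> W"
  shows "dif (\<lambda>y. alpha i y w) x u = dif (\<lambda>y. alpha i y u) x w"
proof -
  note d = smooth_on_differentiable[OF _ x]
  have unit: "T i x \<bullet> dif (T i) x u = 0" for u
    using dif_inner_const_on[OF openW x smooth_T smooth_T T_T, of i i u] by (simp add: inner_commute)
  \<comment> \<open>The columns of \<open>a\<close> have constant length, so they are orthogonal to
    their derivatives.\<close>
  have a1: "(\<Sum>k\<in>UNIV. dif (a k i) x u * a k i x) = 0" for u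
  proof -
    have "dif (\<lambda>y. \<Sum>k\<in>UNIV. a k i y * a k i y) x = dif (\<lambda>y. 1) x"
      by (rule dif_cong_open[OF openW x]) (simp add: a_orthonormal)
    moreover have "dif (\<lambda>y. \<Sum>k\<in>UNIV. a k i y * a k i y) x u = (\<Sum>k\<in>UNIV. dif (\<lambda>y. a k i y * a k i y) x u)"
      by (rule dif_sum) (rule d, intro smooth_intros smooth_a openW)
    ultimately have "(\<Sum>k\<in>UNIV. 2 * (dif (a k i) x u * a k i x)) = 0"
      by (simp add: dif_mult[OF d[OF smooth_a] d[OF smooth_a]] dif_const mult.commute[of "a _ i x"])
    then show ?thesis
      by (simp add: sum_distrib_left[symmetric])
  qed
  \<comment> \<open>Only second derivatives of \<open>E k\<close> remain, and these are symmetric in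
    \<open>u\<close> and \<open>w\<close>.\<close>
  have *: "dif (\<lambda>y. alpha i y w) x u = (\<Sum>k\<in>UNIV. a k i x * (T i x \<bullet> dif (\<lambda>y. dif (E k) y w) x u))" for u w
  proof -
    have smE': "smooth_on W (\<lambda>y. dif (E k) y w)" for k by (rule smooth_on_dif[OF smE])
    have smTE: "smooth_on W (\<lambda>y. T i y \<bullet> dif (E k) y w)" for k
      by (intro smooth_intros smooth_T smE openW)
    have "dif (\<lambda>y. alpha i y w) x = dif (\<lambda>y. \<Sum>k\<in>UNIV. a k i y * (T i y \<bullet> dif (E k) y w)) x"
      by (rule dif_cong_open[OF openW x]) (rule alpha_eq)
    moreover have "dif (\<lambda>y. \<Sum>k\<in>UNIV. a k i y * (T i y \<bullet> dif (E k) y w)) x u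
      = (\<Sum>k\<in>UNIV. dif (\<lambda>y. a k i y * (T i y \<bullet> dif (E k) y w)) x u)"
      by (rule dif_sum) (rule d, intro smooth_on_mult smTE smooth_a openW)
    moreover have "dif (\<lambda>y. a k i y * (T i y \<bullet> dif (E k) y w)) x u =
      a k i x * (T i x \<bullet> dif (\<lambda>y. dif (E k) y w) x u) + a k i x * (dif (T i) x u \<bullet> dif (E k) x w)
      + dif (a k i) x u * a k i x * alpha i x w" for k
      by (simp add: dif_mult[OF d[OF smooth_a] d[OF smTE]] dif_inner[OF d[OF smooth_T] d[OF smE']] T_dE[OF x] algebra_simps)
    \<comment> \<open>In the principal frame this becomes a sum over \<open>j\<close> weighted by
      the inner products of the columns \<open>i\<close> and \<open>j\<close> of \<open>a\<close>.
      Only \<open>j = i\<close> is left, and there the unit vector \<open>T i\<close> is orthogonal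
      to its derivative.\<close>
    moreover have "(\<Sum>k\<in>UNIV. a k i x * (dif (T i) x u \<bullet> dif (E k) x w)) = 0"
    proof -
      have "(\<Sum>k\<in>UNIV. a k i x * (dif (T i) x u \<bullet> dif (E k) x w))
        = (\<Sum>k\<in>UNIV. \<Sum>j\<in>UNIV. (a k i x * a k j x) * ((T j x \<bullet> dif (T i) x u) * alpha j x w))"
        by (subst dE_parseval[OF x]) (simp add: T_def[symmetric] T_dE[OF x] sum_distrib_left mult_ac)
      also have "\<dots> = (\<Sum>j\<in>UNIV. (if i = j then 1 else 0) * ((T j x \<bullet> dif (T i) x u) * alpha j x w))"
        by (subst sum.swap) (simp only: sum_distrib_right[symmetric] a_orthonormal[OF x])
      also have "\<dots> = (\<Sum>j\<in>(UNIV :: 'n set). 0)"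
        by (rule sum.cong[OF refl]) (auto simp: unit)
      finally show ?thesis by simp
    qed
    moreover have "(\<Sum>k\<in>UNIV. dif (a k i) x u * a k i x * alpha i x w) = 0"
      using a1[of u] by (simp add: sum_distrib_right[symmetric])
    ultimately show ?thesis
      by (simp add: sum.distrib)
  qed
  show ?thesis
    unfolding * by (rule sum.cong[OF refl]) (simp only: second_dif_commute[OF openW smE x, of _ w u])
qed

end

section \<open>Curvature coordinates\<close>

text \<open>A closed form \<open>\<alpha>\<close> is a flat connection with values in \<open>so(2)\<close>; the angle of a parallel frame is a
  primitive.\<close>

lemma local_primitive:
  fixes \<alpha> :: "'a::euclidean_space \<Rightarrow> 'a \<Rightarrow> real"
  assumes S: "open S" "x0 \<in> S" and lin: "\<And>x. x \<in> S \<Longrightarrow> linear (\<alpha> x)"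
    and sm: "\<And>u. smooth_on S (\<lambda>x. \<alpha> x u)"
    and closed: "\<And>x u w. x \<in> S \<Longrightarrow> dif (\<lambda>y. \<alpha> y w) x u = dif (\<lambda>y. \<alpha> y u) x w"
  obtains N f where "open N" "x0 \<in> N" "N \<subseteq> S" "smooth_on N f" "\<And>x. x \<in> N \<Longrightarrow> (f has_derivative \<alpha> x) (at x)"
proof -
  obtain r where r: "r > 0" "ball x0 r \<subseteq> S" using S openE by blast
  let ?B = "ball x0 r"
  define J :: "real^2^2" where "J = (\<chi> i j. if i = 1 \<and> j = 2 then - 1 else if i = 2 \<and> j = 1 then 1 else 0)"
  have J: "transpose J = - J"
    by (simp add: J_def vec_eq_iff transpose_def forall_2)
  have smB: "smooth_on ?B (\<lambda>x. \<alpha> x u)" for u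
    using smooth_on_subset[OF sm r(2)] .
  interpret conn: flat_orthogonal_connection ?B "\<lambda>x u. \<alpha> x u *\<^sub>R J"
  proof (rule flat_orthogonal_connection.intro)
    show "open ?B" by simp
    show "linear (\<lambda>u. \<alpha> x u *\<^sub>R J)" if "x \<in> ?B" for x
    proof -
      have "linear (\<alpha> x)" using lin that r(2) by blast
      then show ?thesis by (auto simp: linear_iff scaleR_left_distrib)
    qed
    show "smooth_on ?B (\<lambda>x. \<alpha> x u *\<^sub>R J)" for u
      by (intro smooth_intros smB) simp
    show "transpose (\<alpha> x u *\<^sub>R J) = - (\<alpha> x u *\<^sub>R J)" for x u
      using J linear_scale[OF bounded_linear.linear[OF bounded_linear_transpose], of "\<alpha> x u" J] by simp
    fix x u w assume x: "x \<in> ?B"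
    have "dif (\<lambda>y. \<alpha> y w *\<^sub>R J) x u = dif (\<lambda>y. \<alpha> y w) x u *\<^sub>R J" for u w
      by (rule dif_bounded_linear[OF bounded_linear_scaleR_left]) (rule smooth_on_differentiable[OF smB x])
    then show "dif (\<lambda>y. \<alpha> y w *\<^sub>R J) x u - dif (\<lambda>y. \<alpha> y u *\<^sub>R J) x w + (\<alpha> x u *\<^sub>R J) ** (\<alpha> x w *\<^sub>R J)
        - (\<alpha> x w *\<^sub>R J) ** (\<alpha> x u *\<^sub>R J) = 0"
      using closed[of x w u] x r(2) by (auto simp: matrix_mult_scaleR_left matrix_mult_scaleR_right)
  qed
  have "starlike ?B" using r(1) convex_imp_starlike[of ?B] by auto
  then obtain g where g: "smooth_on ?B g" "\<And>x. x \<in> ?B \<Longrightarrow> orthogonal_matrix (g x)"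
    "\<And>x. x \<in> ?B \<Longrightarrow> (g has_derivative (\<lambda>u. g x ** (\<alpha> x u *\<^sub>R J))) (at x)"
    using conn.parallel_transport_exists by blast
  have x0B: "x0 \<in> ?B" using r(1) by simp
  \<comment> \<open>Rotated so that the frame is the identity at \<open>x0\<close>, where the angle
    is then 0.\<close>
  define R where "R = (\<lambda>x. transpose (g x0) ** g x)"
  have R0: "R x0 = mat 1"
    using g(2)[OF x0B] by (simp add: R_def orthogonal_matrix_def)
  have Rorth: "orthogonal_matrix (R x)" if "x \<in> ?B" for x
    unfolding R_def by (intro orthogonal_matrix_mul) (simp_all add: g(2)[OF x0B] g(2)[OF that])
  have dR: "(R has_derivative (\<lambda>u. \<alpha> x u *\<^sub>R (R x ** J))) (at x)" if "x \<in> ?B" for x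
    unfolding R_def
    using bounded_linear.has_derivative[OF bounded_bilinear.bounded_linear_right[OF bounded_bilinear_matrix_mult] g(3)[OF that], of "transpose (g x0)"]
    by (simp add: matrix_mul_assoc matrix_mult_scaleR_right)
  have ds: "((\<lambda>x. R x $ 2 $ 1) has_derivative (\<lambda>u. \<alpha> x u * R x $ 2 $ 2)) (at x)" if "x \<in> ?B" for x
  proof -
    have "(R x ** J) $ 2 $ 1 = R x $ 2 $ 2"
      by (simp add: matrix_matrix_mult_def sum_2 J_def)
    then show ?thesis
      using bounded_linear.has_derivative[OF bounded_linear_vec_nth
          bounded_linear.has_derivative[OF bounded_linear_vec_nth dR[OF that], of 2], of 1] by simp
  qed
  have norm1: "(R x $ 2 $ 1)\<^sup>2 + (R x $ 2 $ 2)\<^sup>2 = 1" if "x \<in> ?B" for x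
  proof -
    have "(R x ** transpose (R x)) $ 2 $ 2 = 1"
      using orthogonal_matrix_mult_transpose[OF Rorth[OF that]] by (simp add: mat_def)
    then show ?thesis
      by (simp add: matrix_matrix_mult_def sum_2 transpose_def power2_eq_square)
  qed
  \<comment> \<open>The second row of \<open>R x\<close> consists of the sine and the cosine of the
    angle; where the cosine is positive, \<open>arcsin\<close> recovers the angle smoothly from the
    sine.\<close>
  define N where "N = ?B \<inter> (\<lambda>x. R x $ 2 $ 2) -` {0<..}"
  define f where "f = (\<lambda>x. arcsin (R x $ 2 $ 1))"
  have smR: "smooth_on ?B (\<lambda>x. R x $ 2 $ 2)"
    unfolding R_def by (intro smooth_intros g(1)) simp_all
  have N: "open N" "x0 \<in> N" "N \<subseteq> S"
    unfolding N_def using continuous_open_preimage[OF smooth_on_continuous_on[OF smR], of "{0<..}"] x0B R0 r(2)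
    by (auto simp: mat_def)
  have df: "(f has_derivative \<alpha> x) (at x)" if "x \<in> N" for x
  proof -
    have x: "x \<in> ?B" "R x $ 2 $ 2 > 0" using that by (auto simp: N_def)
    then have "(R x $ 2 $ 2)\<^sup>2 > 0" by simp
    then have "(R x $ 2 $ 1)\<^sup>2 < 1" using norm1[OF x(1)] by linarith
    then have "\<bar>R x $ 2 $ 1\<bar> < 1" by (simp add: abs_square_less_1)
    then have s: "- 1 < R x $ 2 $ 1" "R x $ 2 $ 1 < 1" by linarith+
    have "1 - (R x $ 2 $ 1)\<^sup>2 = (R x $ 2 $ 2)\<^sup>2" using norm1[OF x(1)] by simp
    then have c: "sqrt (1 - (R x $ 2 $ 1)\<^sup>2) = R x $ 2 $ 2" using x(2) by simp
    have "(arcsin has_derivative (\<lambda>h. inverse (R x $ 2 $ 2) * h)) (at (R x $ 2 $ 1))"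
      using DERIV_arcsin[OF s] by (simp add: c has_field_derivative_def)
    from has_derivative_compose[OF ds[OF x(1)] this]
    show ?thesis using x(2) by (simp add: f_def mult_ac)
  qed
  have "smooth_on N f"
  proof (rule smooth_on_bootstrap[OF N(1) df])
    show "Ck_on k N (\<lambda>x. \<alpha> x v)" for k v
      using smooth_on_subset[OF sm N(3), of v] by (simp add: smooth_on_def)
  qed
  then show thesis
    using that N df by blast
qed

section \<open>Coordinates from the closed coframe\<close>

context principal_directions
begin

lemma first_ff_T:
  assumes x: "x \<in> W"
  shows "first_ff X x u w = (\<Sum>i\<in>UNIV. (alpha i x u / rho i x) * (alpha i x w / rho i x))"
proof -
  have "dif X x u \<bullet> dif X x w = (\<Sum>i\<in>UNIV. (dif X x (s i x) \<bullet> dif X x u) * (dif X x (s i x) \<bullet> dif X x w))"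
    using E_dX[OF x] dX_X[OF x] by (intro tangent_parseval[OF x ortho_s[OF x]]) (simp_all add: inner_commute)
  moreover have "dif X x (s i x) \<bullet> dif X x u = alpha i x u / rho i x" for i u
    using rho_pos[OF x, of i] by (simp add: alpha_def first_ff_def)
  ultimately show ?thesis by (simp add: first_ff_def)
qed

lemma dX_dE_T:
  assumes x: "x \<in> W"
  shows "dif X x u \<bullet> dif (E k) x w = (\<Sum>i\<in>UNIV. (alpha i x u / rho i x) * (a k i x * alpha i x w))"
proof -
  have "dif X x (s i x) \<bullet> dif X x u = alpha i x u / rho i x" for i u
    using rho_pos[OF x, of i] by (simp add: alpha_def first_ff_def)
  then show ?thesis
    using T_dE[OF x, unfolded T_def] by (subst dE_parseval[OF x]) simp
qed

text \<open>Primitives of the closed forms \<open>alpha i\<close> are coordinates because these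
  forms are a coframe: a vector on which all of them vanish has length 0. The map \<tau> is the
  inverse of the coordinate map.\<close>

lemma curvature_coordinates:
  assumes x0: "x0 \<in> W" and inj: "inj (dif X x0)"
  obtains V \<tau> where "open V" "x0 \<in> \<tau> ` V" "\<tau> ` V \<subseteq> W" "smooth_on V \<tau>" "inj_on \<tau> V"
    "\<And>y u i. y \<in> V \<Longrightarrow> alpha i (\<tau> y) (dif \<tau> y u) = u $ i"
proof -
  have "\<exists>N f. open N \<and> x0 \<in> N \<and> N \<subseteq> W \<and> smooth_on N f \<and> (\<forall>x\<in>N. (f has_derivative alpha i x) (at x))" for i
    by (rule local_primitive[OF openW x0 linear_alpha smooth_alpha alpha_closed]) blast+
  then obtain N f where Nf: "\<And>i. open (N i)" "\<And>i. x0 \<in> N i" "\<And>i. N i \<subseteq> W" "\<And>i. smooth_on (N i) (f i)"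
    "\<And>i x. x \<in> N i \<Longrightarrow> (f i has_derivative alpha i x) (at x)"
    by metis
  define U where "U = (\<Inter>i. N i)"
  have U: "open U" "x0 \<in> U" "U \<subseteq> W"
  proof -
    show "open U" "x0 \<in> U" unfolding U_def using Nf(1,2) by (auto intro!: open_INT)
    show "U \<subseteq> W" unfolding U_def using Nf(3) by blast
  qed
  define \<Xi> where "\<Xi> = (\<lambda>x. \<chi> i. f i x)"
  have sm: "smooth_on U \<Xi>"
    unfolding \<Xi>_def using Nf(4) by (intro smooth_on_vec_lambda U) (auto intro: smooth_on_subset simp: U_def)
  have d\<Xi>: "dif \<Xi> x u $ i = alpha i x u" if x: "x \<in> U" for x u i
  proof -
    have "dif \<Xi> x u $ i = dif (\<lambda>y. \<Xi> y $ i) x u"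
      by (rule dif_vec_nth[symmetric]) (rule smooth_on_differentiable[OF sm x])
    then show ?thesis
      using x by (simp add: \<Xi>_def dif_eq[OF Nf(5)] U_def)
  qed
  have "inj (dif \<Xi> x0)"
    unfolding linear_injective_0[OF smooth_on_linear_dif[OF sm U(2)]]
  proof (intro allI impI)
    fix u assume "dif \<Xi> x0 u = 0"
    then have "alpha i x0 u = 0" for i
      using d\<Xi>[OF U(2), of u i] by simp
    then have "first_ff X x0 u u = 0"
      by (simp add: first_ff_T[OF x0])
    then have "dif X x0 u = 0" by (simp add: first_ff_def)
    then show "u = 0"
      using inj linear_injective_0[OF smooth_on_linear_dif[OF smX x0]] by blast
  qed
  then obtain U' V \<tau> where *: "open U'" "U' \<subseteq> U" "x0 \<in> U'" "open V" "homeomorphism U' V \<Xi> \<tau>" "smooth_on V \<tau>"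
    using smooth_inverse_function[OF U(1) sm U(2)] by metis
  have \<tau>: "\<tau> ` V = U'" "\<And>y. y \<in> V \<Longrightarrow> \<Xi> (\<tau> y) = y"
    using *(5) by (auto simp: homeomorphism_def)
  show thesis
  proof (rule that[of V \<tau>])
    show "open V" "smooth_on V \<tau>" by fact+
    show "x0 \<in> \<tau> ` V" using \<tau>(1) *(3) by simp
    show "\<tau> ` V \<subseteq> W" using \<tau>(1) *(2) U(3) by blast
    show "inj_on \<tau> V" using \<tau>(2) by (rule inj_on_inverseI)
    fix y u i assume y: "y \<in> V"
    have \<tau>y: "\<tau> y \<in> U" using y \<tau>(1) *(2) by blast
    have "dif (\<lambda>y. \<Xi> (\<tau> y)) y = dif (\<lambda>y. y) y"
      by (rule dif_cong_open[OF *(4) y \<tau>(2)])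
    also have "\<dots> = (\<lambda>u. u)" by (rule dif_eq) (rule has_derivative_ident)
    finally have "dif \<Xi> (\<tau> y) (dif \<tau> y u) = u"
      using dif_compose[OF smooth_on_differentiable[OF *(6) y] smooth_on_differentiable[OF sm \<tau>y], of u] by simp
    then show "alpha i (\<tau> y) (dif \<tau> y u) = u $ i"
      using d\<Xi>[OF \<tau>y] by metis
  qed
qed

lemma forms_in_curvature_coordinates:
  assumes V: "open V" "smooth_on V \<tau>" "\<tau> ` V \<subseteq> W" and y: "y \<in> V"
    and alpha: "\<And>u i. alpha i (\<tau> y) (dif \<tau> y u) = u $ i"
  shows "first_ff (\<lambda>y. X (\<tau> y)) y u w = (\<Sum>i\<in>UNIV. (1 / rho i (\<tau> y))\<^sup>2 * (u $ i * w $ i))"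
    and "second_ff (\<lambda>y. X (\<tau> y)) (\<lambda>k y. E k (\<tau> y)) y u w =
      (\<Sum>i\<in>UNIV. \<Sum>j\<in>UNIV. (a j i (\<tau> y) * (1 / rho i (\<tau> y)) * (u $ i * w $ i)) *\<^sub>R E j (\<tau> y))"
proof -
  have x: "\<tau> y \<in> W" using V(3) y by auto
  note d\<tau> = smooth_on_differentiable[OF V(2) y]
  show "first_ff (\<lambda>y. X (\<tau> y)) y u w = (\<Sum>i\<in>UNIV. (1 / rho i (\<tau> y))\<^sup>2 * (u $ i * w $ i))"
    by (simp add: first_ff_compose[OF d\<tau> diffX[OF x]] first_ff_T[OF x] alpha power2_eq_square)
  have "second_ff (\<lambda>y. X (\<tau> y)) (\<lambda>k y. E k (\<tau> y)) y u w =
    (\<Sum>k\<in>UNIV. (dif X (\<tau> y) (dif \<tau> y u) \<bullet> dif (E k) (\<tau> y) (dif \<tau> y w)) *\<^sub>R E k (\<tau> y))"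
    by (simp add: second_ff_def dif_compose[OF d\<tau> diffX[OF x]] dif_compose[OF d\<tau> diffE[OF x]])
  also have "\<dots> = (\<Sum>k\<in>UNIV. \<Sum>i\<in>UNIV. (a k i (\<tau> y) * (1 / rho i (\<tau> y)) * (u $ i * w $ i)) *\<^sub>R E k (\<tau> y))"
    by (simp add: dX_dE_T[OF x] alpha scaleR_sum_left mult_ac)
  finally show "second_ff (\<lambda>y. X (\<tau> y)) (\<lambda>k y. E k (\<tau> y)) y u w =
      (\<Sum>i\<in>UNIV. \<Sum>j\<in>UNIV. (a j i (\<tau> y) * (1 / rho i (\<tau> y)) * (u $ i * w $ i)) *\<^sub>R E j (\<tau> y))"
    by (subst sum.swap)
qed

end

lemma framed_immersion_subset:
  assumes "framed_immersion W X E" "open S" "S \<subseteq> W"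
  shows "framed_immersion S X E"
proof -
  interpret framed_immersion W X E by fact
  show ?thesis
  proof
    show "X ` S \<subseteq> sphere 0 1" using sphX assms(3) by blast
  qed (use assms(2,3) in \<open>auto intro: smooth_on_subset[OF smX] smooth_on_subset[OF smE] simp: normalE orthonormalE parallelE subset_iff\<close>)
qed

section \<open>Shape operators as matrices and their eigenvectors near a point\<close>

lemma bilinear_matrix:
  fixes B :: "real^'n \<Rightarrow> real^'n \<Rightarrow> real"
  assumes "\<And>u. linear (B u)" "\<And>w. linear (\<lambda>u. B u w)"
  shows "u \<bullet> ((\<chi> p q. B (axis p 1) (axis q 1)) *v w) = B u w"
proof -
  have *: "L y = (\<Sum>p\<in>UNIV. y $ p * L (axis p 1))" if "linear L" for L :: "real^'n \<Rightarrow> real" and y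
  proof -
    have "L y = L (\<Sum>p\<in>UNIV. y $ p *\<^sub>R axis p 1)"
      by (simp add: basis_expansion scalar_mult_eq_scaleR[symmetric])
    then show ?thesis by (simp add: linear_sum[OF that] linear_scale[OF that])
  qed
  have "B u w = (\<Sum>p\<in>UNIV. u $ p * B (axis p 1) w)"
    by (rule *[OF assms(2)])
  also have "\<dots> = (\<Sum>p\<in>UNIV. u $ p * (\<Sum>q\<in>UNIV. B (axis p 1) (axis q 1) * w $ q))"
    by (simp add: *[OF assms(1), of _ w] mult.commute)
  finally show ?thesis
    by (simp add: inner_vec_def matrix_vector_mult_def)
qed

context framed_immersion
begin

lemma linear_second: "x \<in> W \<Longrightarrow> linear (\<lambda>w. dif X x u \<bullet> dif (E k) x w)" "x \<in> W \<Longrightarrow> linear (\<lambda>u. dif X x u \<bullet> dif (E k) x w)"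
  using smooth_on_linear_dif[OF smX, of x] smooth_on_linear_dif[OF smE, of x k]
  by (auto simp: linear_iff inner_add_left inner_add_right)

lemma linear_first: "x \<in> W \<Longrightarrow> linear (first_ff X x u)" "x \<in> W \<Longrightarrow> linear (\<lambda>u. first_ff X x u w)"
  using smooth_on_linear_dif[OF smX, of x]
  by (auto simp: linear_iff first_ff_def inner_add_left inner_add_right)

definition second_matrix :: "('m \<Rightarrow> real) \<Rightarrow> real^'n \<Rightarrow> real^'n^'n"
  where "second_matrix v x = (\<chi> p q. \<Sum>k\<in>UNIV. v k * (dif X x (axis p 1) \<bullet> dif (E k) x (axis q 1)))"

definition first_matrix :: "real^'n \<Rightarrow> real^'n^'n"
  where "first_matrix x = (\<chi> p q. first_ff X x (axis p 1) (axis q 1))"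

lemma second_matrix: 
  assumes x: "x \<in> W"
  shows "u \<bullet> (second_matrix v x *v w) = (\<Sum>k\<in>UNIV. v k * (dif X x u \<bullet> dif (E k) x w))"
  unfolding second_matrix_def
proof (rule bilinear_matrix)
  show "linear (\<lambda>w. \<Sum>k\<in>UNIV. v k * (dif X x u \<bullet> dif (E k) x w))" for u
    using linear_second(1)[OF x] by (auto simp: linear_iff sum.distrib algebra_simps sum_distrib_left)
  show "linear (\<lambda>u. \<Sum>k\<in>UNIV. v k * (dif X x u \<bullet> dif (E k) x w))" for w
    using linear_second(2)[OF x] by (auto simp: linear_iff sum.distrib algebra_simps sum_distrib_left)
qed

lemma first_matrix: "x \<in> W \<Longrightarrow> u \<bullet> (first_matrix x *v w) = first_ff X x u w"
  unfolding first_matrix_def by (intro bilinear_matrix linear_first)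

lemma transpose_second_matrix: "x \<in> W \<Longrightarrow> transpose (second_matrix v x) = second_matrix v x"
  unfolding vec_eq_iff
proof (intro allI)
  fix p q assume x: "x \<in> W"
  show "transpose (second_matrix v x) $ p $ q = second_matrix v x $ p $ q"
    by (simp only: second_matrix_def transpose_def vec_lambda_beta dX_dE_commute[OF x, of "axis q 1" _ "axis p 1"])
qed

lemma smooth_second_matrix: "smooth_on W (second_matrix v)"
  unfolding second_matrix_def[abs_def] by (intro smooth_intros openW smX smE)

lemma smooth_first_matrix: "smooth_on W first_matrix"
  unfolding first_matrix_def[abs_def] first_ff_def by (intro smooth_intros openW smX smE)

text \<open>Where the metric is the standard one, the second forms are symmetric matrices, and the
  Ricci equation says that they commute.\<close>

lemma joint_principal_basis:
  assumes x: "x \<in> W" and G: "\<And>u w. first_ff X x u w = u \<bullet> w"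
  obtains w :: "'n \<Rightarrow> real^'n" and \<kappa> where "\<And>i j. w i \<bullet> w j = (if i = j then 1 else 0)"
    "\<And>k i u. dif X x u \<bullet> dif (E k) x (w i) = \<kappa> k i * (u \<bullet> w i)"
proof -
  define f where "f k u = (\<chi> i. dif X x (axis i 1) \<bullet> dif (E k) x u)" for k u
  have f: "f k u \<bullet> y = dif X x y \<bullet> dif (E k) x u" for k u y
  proof -
    have "dif X x y \<bullet> dif (E k) x u = (\<Sum>i\<in>UNIV. y $ i *\<^sub>R pd i X x) \<bullet> dif (E k) x u"
      by (simp add: dif_pd[OF diffX[OF x]])
    then show ?thesis
      unfolding inner_vec_def[of "f k u" y] by (simp add: f_def inner_sum_left pd_def mult.commute)
  qed
  have ax: "first_ff X x (axis i 1) (axis j 1) = (if i = j then 1 else 0)" for i j :: 'n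
    by (simp add: G inner_axis_axis)
  have pars: "p \<bullet> dif (E k) x u = (\<Sum>i\<in>UNIV. (dif X x (axis i 1) \<bullet> p) * (dif X x (axis i 1) \<bullet> dif (E k) x u))" for p k u
    using dE_E[OF x, of k u] dE_X[OF x, of k u]
    by (intro tangent_parseval[OF x ax]) (simp_all add: inner_commute)
  have lin: "linear (f k)" for k
    using linear_second(1)[OF x] by (auto simp: linear_iff f_def vec_eq_iff)
  have sym: "f k u \<bullet> y = u \<bullet> f k y" for k u y
    using f[of k u y] f[of k y u] dX_dE_commute[OF x, of y k u] by (simp add: inner_commute)
  \<comment> \<open>\<open>dE_dE_commute\<close> makes this expression symmetric under the exchange
    of \<open>k\<close> and \<open>l\<close>.\<close>
  have ff: "f k (f l u) \<bullet> y = dif (E l) x u \<bullet> dif (E k) x y" for k l u y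
  proof -
    have "f k (f l u) \<bullet> y = f l u \<bullet> f k y" by (rule sym)
    also have "\<dots> = (\<Sum>i\<in>UNIV. (dif X x (axis i 1) \<bullet> dif (E l) x u) * (dif X x (axis i 1) \<bullet> dif (E k) x y))"
      unfolding inner_vec_def[of "f l u" "f k y"] by (simp add: f_def)
    finally show ?thesis
      unfolding pars[of "dif (E l) x u" k y] .
  qed
  have comm: "f k (f l u) = f l (f k u)" for k l u
  proof -
    have "f k (f l u) \<bullet> y = f l (f k u) \<bullet> y" for y
      unfolding ff using dE_dE_commute[OF x, of l u k y] by (simp add: inner_commute)
    then show ?thesis
      using vector_eq_rdot[of "f k (f l u)" "f l (f k u)"] by blast
  qed
  have "\<exists>w :: 'n \<Rightarrow> real^'n. (\<forall>i j. w i \<bullet> w j = (if i = j then 1 else 0)) \<and> (\<forall>k i. \<exists>c. f k (w i) = c *\<^sub>R w i)"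
    by (rule joint_orthonormal_eigenbasis[where f = f, OF lin sym comm])
  then obtain w :: "'n \<Rightarrow> real^'n" where w: "\<And>i j. w i \<bullet> w j = (if i = j then 1 else 0)"
    "\<And>k i. \<exists>c. f k (w i) = c *\<^sub>R w i" by blast
  from w(2) obtain \<kappa> where \<kappa>: "\<And>k i. f k (w i) = \<kappa> k i *\<^sub>R w i" by metis
  have "dif X x u \<bullet> dif (E k) x (w i) = \<kappa> k i * (u \<bullet> w i)" for k i u
    using f[of k "w i" u] by (simp add: \<kappa> inner_commute)
  then show thesis using that w(1) by blast
qed

lemma shape_operator_orthonormal:
  assumes x: "x \<in> W" and G: "\<And>u w. first_ff X x u w = u \<bullet> w"
  shows "shape_operator X x v = (\<chi> i j. dif (\<lambda>y. dif X y (axis j 1)) x (axis i 1) \<bullet> v)"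
proof -
  have "(\<chi> i j. pd i X x \<bullet> pd j X x) = mat 1"
    using G by (simp add: vec_eq_iff mat_def pd_def first_ff_def inner_axis_axis)
  moreover have "matrix_inv (mat 1 :: real^'n^'n) = mat 1"
    by (simp add: matrix_inv_orthogonal orthogonal_matrix_id)
  ultimately show ?thesis
    by (simp add: shape_operator_def pd_def[abs_def])
qed

text \<open>All shape operators are diagonal in the basis \<open>w\<close>, so each is determined by
  its diagonal. By non-degeneracy the diagonals form a subspace of full dimension n, so every vector
  of eigenvalues occurs.\<close>

lemma principal_curvatures_prescribed:
  assumes x: "x \<in> W" and G: "\<And>u w. first_ff X x u w = u \<bullet> w"
    and nondeg: "dim (shape_operator X x ` normal_space X x) = CARD('n)"
    and w: "\<And>i j. w i \<bullet> w j = (if i = j then 1 else 0)"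
    and \<kappa>: "\<And>k i u. dif X x u \<bullet> dif (E k) x (w i) = \<kappa> k i * (u \<bullet> w i)"
  obtains v where "\<And>i. (\<Sum>k\<in>UNIV. v k * \<kappa> k i) = (c :: 'n \<Rightarrow> real) i"
proof -
  define S where "S v = (\<chi> i j. dif (\<lambda>y. dif X y (axis j 1)) x (axis i 1) \<bullet> v)" for v
  have S_eq: "shape_operator X x = S"
    unfolding S_def using shape_operator_orthonormal[OF x G] by blast
  have S: "u \<bullet> (S v *v y) = dif (\<lambda>z. dif X z y) x u \<bullet> v" for u v y
    unfolding S_def
  proof (rule bilinear_matrix)
    show "linear (\<lambda>u. dif (\<lambda>z. dif X z y) x u \<bullet> v)" for y
      using linear_dif[OF diffdX[OF x], of y] by (auto simp: linear_iff inner_add_left)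
    then show "linear (\<lambda>y. dif (\<lambda>z. dif X z y) x u \<bullet> v)" for u
      by (simp add: second_dif_commute[OF openW smX x, of _ u])
  qed
  have ax: "first_ff X x (axis i 1) (axis j 1) = (if i = j then 1 else 0)" for i j :: 'n
    by (simp add: G inner_axis_axis)
  have Sw: "u \<bullet> (S v *v w i) = - (\<Sum>k\<in>UNIV. (E k x \<bullet> v) * \<kappa> k i) * (u \<bullet> w i)" if v: "v \<in> normal_space X x" for u v i
  proof -
    have nv: "X x \<bullet> v = 0" "dif X x y \<bullet> v = 0" for y
      using v by (auto simp: normal_space_def inner_commute)
    have E: "E k x \<bullet> dif (\<lambda>z. dif X z (w i)) x u = - (\<kappa> k i * (u \<bullet> w i))" for k
      using ddX_E[OF x, of "w i" u k] dX_dE_commute[OF x, of "w i" k u] by (simp add: inner_commute \<kappa>)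
    have "dif (\<lambda>z. dif X z (w i)) x u \<bullet> v = (\<Sum>k\<in>UNIV. (E k x \<bullet> dif (\<lambda>z. dif X z (w i)) x u) * (E k x \<bullet> v))"
      by (subst frame_parseval[OF x ax]) (simp add: nv)
    then show ?thesis
      unfolding S by (simp add: E sum_negf sum_distrib_left sum_distrib_right mult_ac)
  qed
  define C where "C H = (\<chi> i. w i \<bullet> (H *v w i))" for H :: "real^'n^'n"
  have linC: "linear C"
    by (rule linearI) (simp_all add: C_def vec_eq_iff matrix_vector_mult_add_rdistrib inner_add_right
        scaleR_matrix_vector_assoc[symmetric])
  have "linear S"
    by (rule linearI) (simp_all add: S_def vec_eq_iff inner_add_right)
  then have sub: "subspace (S ` normal_space X x)"
    using subspace_normal_space by (rule linear_subspace_image)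
  have inj: "inj_on C (S ` normal_space X x)"
    unfolding linear_inj_on_iff_eq_0[OF linC sub]
  proof (intro ballI impI)
    fix H assume "H \<in> S ` normal_space X x" and C0: "C H = 0"
    then obtain v where v: "v \<in> normal_space X x" "H = S v" by blast
    have "(\<Sum>k\<in>UNIV. (E k x \<bullet> v) * \<kappa> k i) = 0" for i
    proof -
      have "w i \<bullet> (S v *v w i) = 0"
        using C0 unfolding C_def v(2) vec_eq_iff by simp
      then show ?thesis
        by (simp add: Sw[OF v(1)] w)
    qed
    then have Hw: "u \<bullet> (H *v w i) = 0" for u i
      unfolding v(2) Sw[OF v(1)] by simp
    have "u \<bullet> (H *v y) = 0" for u y
    proof -
      have "u \<bullet> (H *v y) = (transpose H *v u) \<bullet> y"
        by (simp add: dot_lmul_matrix)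
      also have "\<dots> = (\<Sum>i\<in>UNIV. (w i \<bullet> (transpose H *v u)) * (w i \<bullet> y))"
        by (rule orthonormal_parseval[OF w])
      also have "\<dots> = 0"
      proof -
        have "w i \<bullet> (transpose H *v u) = 0" for i
          using Hw[of u i] dot_lmul_matrix[of u H "w i"] inner_commute[of "w i" "u v* H"] by simp
        then show ?thesis by simp
      qed
      finally show ?thesis .
    qed
    from this[of "axis _ 1" "axis _ 1"] show "H = 0"
      by (simp add: vec_eq_iff inner_axis' matrix_vector_mul_component inner_axis)
  qed
  have "dim (C ` S ` normal_space X x) = CARD('n)"
  proof -
    have "inj_on C (span (S ` normal_space X x))"
      using inj sub by (simp only: span_eq_iff[THEN iffD2])
    then show ?thesis
      using dim_image_eq[OF linC, of "S ` normal_space X x"] nondeg unfolding S_eq by simp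
  qed
  moreover have subC: "subspace (C ` S ` normal_space X x)"
    by (rule linear_subspace_image[OF linC sub])
  ultimately have "C ` S ` normal_space X x = UNIV"
    using dim_eq_full[of "C ` S ` normal_space X x"] span_eq_iff[THEN iffD2, OF subC]
    by (simp only: DIM_cart DIM_real mult_1_right refl)
  \<comment> \<open>The sign accounts for \<open>shape_operator\<close> being built from the Hessian
    of \<open>X\<close>, but \<kappa> from the derivatives of the normal fields.\<close>
  then have "(\<chi> i. - c i) \<in> C ` S ` normal_space X x" by blast
  then obtain v where v: "v \<in> normal_space X x" "C (S v) = (\<chi> i. - c i)"
    by (elim imageE) simp
  have "(\<Sum>k\<in>UNIV. (E k x \<bullet> v) * \<kappa> k i) = c i" for i
  proof -
    have "w i \<bullet> (S v *v w i) = - c i"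
      using v(2) unfolding C_def vec_eq_iff by simp
    then show ?thesis by (simp add: Sw[OF v(1)] w)
  qed
  then show thesis by (rule that)
qed

text \<open>At \<open>x0\<close> this is an eigenvalue problem for symmetric matrices. Nearby, the
  eigenvectors relative to the metric are continued smoothly one at a time; distinct eigenvalues
  keep them orthogonal for the metric, so that rescaling alone makes them orthonormal.\<close>

lemma principal_directions_exist:
  fixes \<phi> :: "real^'n \<Rightarrow> real^('n + 1)"
  assumes x0: "x0 \<in> W" and G0: "\<And>u w. first_ff X x0 u w = u \<bullet> w"
    and immersion: "\<And>x. x \<in> W \<Longrightarrow> inj (dif X x)"
    and nondeg: "dim (shape_operator X x0 ` normal_space X x0) = CARD('n)"
    and \<phi>: "smooth_on W \<phi>" "\<phi> ` W \<subseteq> sphere 0 1"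
    and ff: "\<And>x u w. x \<in> W \<Longrightarrow> first_ff X x u w = first_ff \<phi> x u w"
  obtains S s v \<mu> where "x0 \<in> S" "S \<subseteq> W" "principal_directions S X E \<phi> s v \<mu>"
proof -
  obtain w :: "'n \<Rightarrow> real^'n" and \<kappa> where w: "\<And>i j. w i \<bullet> w j = (if i = j then 1 else 0)"
    and \<kappa>: "\<And>k i u. dif X x0 u \<bullet> dif (E k) x0 (w i) = \<kappa> k i * (u \<bullet> w i)"
    using joint_principal_basis[OF x0 G0] by metis
  obtain c0 :: "'n \<Rightarrow> nat" where c0: "inj c0"
    using finite_imp_inj_to_nat_seg[OF finite_class.finite_UNIV] by blast
  \<comment> \<open>The eigenvalues to be prescribed: distinct, so that each is simple; nonzero, for
    the normalization of the eigenvectors and of the curvature normals.\<close>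
  define c where "c i = real (c0 i) + 1" for i
  have c: "c i = c j \<longleftrightarrow> i = j" "c i \<noteq> 0" for i j
    using c0 by (auto simp: c_def inj_eq add_nonneg_eq_0_iff)
  obtain v where v: "\<And>i. (\<Sum>k\<in>UNIV. v k * \<kappa> k i) = c i"
    using principal_curvatures_prescribed[OF x0 G0 nondeg w \<kappa>] by metis
  define H where "H = second_matrix v"
  have H: "u \<bullet> (H x *v y) = (\<Sum>k\<in>UNIV. v k * (dif X x u \<bullet> dif (E k) x y))" if "x \<in> W" for x u y
    unfolding H_def by (rule second_matrix[OF that])
  have Hw: "H x0 *v w i = c i *\<^sub>R w i" for i
  proof -
    have "u \<bullet> (H x0 *v w i) = u \<bullet> (c i *\<^sub>R w i)" for u
      unfolding H[OF x0] \<kappa> by (simp add: v[symmetric] sum_distrib_right sum_distrib_left mult_ac)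
    then show ?thesis
      using vector_eq_ldot[of "H x0 *v w i" "c i *\<^sub>R w i"] by blast
  qed
  have Hsym: "u \<bullet> (H x *v y) = y \<bullet> (H x *v u)" if "x \<in> W" for x u y
    unfolding H[OF that] by (rule sum.cong[OF refl]) (simp only: dX_dE_commute[OF that, of u _ y])
  have simple: "\<exists>t. \<eta> = t *\<^sub>R w i" if \<eta>: "H x0 *v \<eta> = c i *\<^sub>R \<eta>" for i \<eta>
  proof -
    have 0: "w j \<bullet> \<eta> = 0" if "j \<noteq> i" for j
    proof -
      have "c i * (w j \<bullet> \<eta>) = w j \<bullet> (H x0 *v \<eta>)" by (simp add: \<eta>)
      also have "\<dots> = c j * (w j \<bullet> \<eta>)" unfolding Hsym[OF x0, of "w j"] Hw by (simp add: inner_commute)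
      finally show ?thesis using c(1)[of i j] that by simp
    qed
    have "\<eta> \<bullet> z = ((w i \<bullet> \<eta>) *\<^sub>R w i) \<bullet> z" for z
    proof -
      have "\<eta> \<bullet> z = (\<Sum>j\<in>UNIV. (w j \<bullet> \<eta>) * (w j \<bullet> z))" by (rule orthonormal_parseval[OF w])
      also have "\<dots> = (\<Sum>j\<in>UNIV. if j = i then (w j \<bullet> \<eta>) * (w j \<bullet> z) else 0)"
        by (rule sum.cong[OF refl]) (simp add: 0)
      finally show ?thesis by simp
    qed
    then have "\<eta> = (w i \<bullet> \<eta>) *\<^sub>R w i"
      using vector_eq_rdot[of \<eta> "(w i \<bullet> \<eta>) *\<^sub>R w i"] by blast
    then show ?thesis ..
  qed
  have "\<exists>N w'. open N \<and> x0 \<in> N \<and> N \<subseteq> W \<and> smooth_on N w' \<and> w' x0 = w i \<and>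
    (\<forall>x\<in>N. H x *v w' x = (w i \<bullet> (H x *v w' x)) *\<^sub>R (first_matrix x *v w' x))" for i
  proof (rule smooth_generalized_eigenvector[where H = H and c = "c i", OF openW x0])
    show "smooth_on W first_matrix" by (rule smooth_first_matrix)
    show "H x0 *v w i = c i *\<^sub>R w i" by (rule Hw)
    show "c i \<noteq> 0" by (rule c(2))
    show "\<exists>t. \<eta> = t *\<^sub>R w i" if "H x0 *v \<eta> = c i *\<^sub>R \<eta>" for \<eta> by (rule simple[OF that])
    show "smooth_on W H" unfolding H_def by (rule smooth_second_matrix)
    show "first_matrix x0 = mat 1"
      by (simp add: first_matrix_def G0 vec_eq_iff mat_def inner_axis_axis)
    show "transpose (H x0) = H x0" unfolding H_def by (rule transpose_second_matrix[OF x0])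
    show "norm (w i) = 1" using w[of i i] by (simp add: norm_eq_1)
  qed
  then obtain N w' where N: "\<And>i. open (N i)" "\<And>i. x0 \<in> N i" "\<And>i. N i \<subseteq> W"
    and w': "\<And>i. smooth_on (N i) (w' i)" "\<And>i. w' i x0 = w i"
    "\<And>i x. x \<in> N i \<Longrightarrow> H x *v w' i x = (w i \<bullet> (H x *v w' i x)) *\<^sub>R (first_matrix x *v w' i x)"
    by metis
  define N0 where "N0 = (\<Inter>i. N i)"
  have N0: "open N0" "x0 \<in> N0" "N0 \<subseteq> W" "\<And>i. N0 \<subseteq> N i"
  proof -
    show "open N0" "x0 \<in> N0" unfolding N0_def using N(1,2) by (auto intro!: open_INT)
    show "N0 \<subseteq> W" "N0 \<subseteq> N i" for i unfolding N0_def using N(3) by blast+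
  qed
  have smw: "smooth_on N0 (w' i)" for i by (rule smooth_on_subset[OF w'(1) N0(4)])
  have smH: "smooth_on N0 H" unfolding H_def by (rule smooth_on_subset[OF smooth_second_matrix N0(3)])
  define \<mu> where "\<mu> i x = w i \<bullet> (H x *v w' i x)" for i x
  have sm\<mu>: "smooth_on N0 (\<mu> i)" for i
    unfolding \<mu>_def by (intro smooth_intros smH smw N0)
  have \<mu>0: "\<mu> i x0 = c i" for i
    by (simp add: \<mu>_def w'(2) Hw w)
  \<comment> \<open>One smooth function whose nonvanishing says that all eigenvalues are distinct
    and nonzero and that no eigenvector vanishes.\<close>
  define q where "q x = (\<Prod>i\<in>UNIV. (\<Prod>j\<in>UNIV - {i}. \<mu> i x - \<mu> j x) * \<mu> i x * (w' i x \<bullet> w' i x))" for x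
  have smq: "smooth_on N0 q"
    unfolding q_def by (intro smooth_intros sm\<mu> smw N0)
  define S where "S = N0 \<inter> q -` (- {0})"
  have S: "open S" "x0 \<in> S" "S \<subseteq> N0"
  proof -
    show "open S"
      unfolding S_def by (rule continuous_open_preimage[OF smooth_on_continuous_on[OF smq] N0(1)]) (simp add: open_Compl)
    have "q x0 \<noteq> 0"
      unfolding q_def by (auto simp: \<mu>0 c w'(2) w)
    then show "x0 \<in> S" using N0(2) by (simp add: S_def)
  qed (auto simp: S_def)
  have SW: "S \<subseteq> W" using S(3) N0(3) by blast
  have nz: "\<mu> i x \<noteq> \<mu> j x" "\<mu> i x \<noteq> 0" "w' i x \<noteq> 0" if "x \<in> S" "i \<noteq> j" for i j x
  proof -
    have "(\<Prod>j\<in>UNIV - {i}. \<mu> i x - \<mu> j x) * \<mu> i x * (w' i x \<bullet> w' i x) \<noteq> 0"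
      using that(1) unfolding S_def q_def by simp
    then show "\<mu> i x \<noteq> 0" "w' i x \<noteq> 0" "\<mu> i x \<noteq> \<mu> j x"
      using that(2) by auto
  qed
  \<comment> \<open>Separate from \<open>nz\<close>, which presupposes an index other than
    \<open>i\<close>; there is none for n = 1.\<close>
  have nz': "\<mu> i x \<noteq> 0" "w' i x \<noteq> 0" if "x \<in> S" for i x
    using that unfolding S_def q_def by simp_all
  have Hw': "u \<bullet> (H x *v w' i x) = \<mu> i x * first_ff X x u (w' i x)" if "x \<in> S" for x u i
  proof -
    have x: "x \<in> N i" "x \<in> W" using that S(3) N0(3,4) by auto
    have "u \<bullet> (H x *v w' i x) = u \<bullet> (\<mu> i x *\<^sub>R (first_matrix x *v w' i x))"
      using w'(3)[OF x(1)] unfolding \<mu>_def by simp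
    then show ?thesis by (simp add: first_matrix[OF x(2)])
  qed
  define r where "r i x = sqrt (first_ff X x (w' i x) (w' i x))" for i x
  have ff_pos: "first_ff X x (w' i x) (w' i x) > 0" if "x \<in> S" for i x
  proof -
    have x: "x \<in> W" using that SW by auto
    have "dif X x (w' i x) \<noteq> 0"
      using immersion[OF x] linear_injective_0[OF smooth_on_linear_dif[OF smX x]] nz'(2)[OF that] by blast
    then show ?thesis by (simp add: first_ff_def)
  qed
  have r_pos: "r i x > 0" if "x \<in> S" for i x
    unfolding r_def using ff_pos[OF that] by simp
  define s where "s i x = (1 / r i x) *\<^sub>R w' i x" for i x
  have ff_s: "first_ff X x u (s i x) = first_ff X x u (w' i x) / r i x"
    "first_ff X x (s i x) u = first_ff X x (w' i x) u / r i x" if "x \<in> S" for x u i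
    using linear_scale[OF smooth_on_linear_dif[OF smX], of x] that SW
    by (auto simp: first_ff_def s_def)
  have ortho: "first_ff X x (w' i x) (w' j x) = 0" if x: "x \<in> S" and "i \<noteq> j" for i j x
  proof -
    have xW: "x \<in> W" using x SW by auto
    have "\<mu> j x * first_ff X x (w' i x) (w' j x) = \<mu> i x * first_ff X x (w' j x) (w' i x)"
      using Hw'[OF x, of "w' i x" j] Hw'[OF x, of "w' j x" i] Hsym[OF xW, of "w' i x" "w' j x"] by simp
    then show ?thesis
      using nz(1)[OF x \<open>i \<noteq> j\<close>] by (simp add: first_ff_def inner_commute)
  qed
  have "framed_immersion S X E"
    by (rule framed_immersion_subset[OF framed_immersion_axioms S(1) SW])
  moreover have "principal_directions_axioms S X E \<phi> s v \<mu>"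
  proof
    have smw': "smooth_on S (w' i)" for i by (rule smooth_on_subset[OF smw S(3)])
    have smr: "smooth_on S (r i)" for i
      unfolding r_def[abs_def]
    proof (rule smooth_on_sqrt)
      show "smooth_on S (\<lambda>x. first_ff X x (w' i x) (w' i x))"
        unfolding first_ff_def
        by (intro smooth_on_inner smooth_on_dif_apply S smw' smooth_on_subset[OF smX SW])
    qed (use S ff_pos in auto)
    show "smooth_on S (s i)" for i
      unfolding s_def[abs_def] using r_pos
      by (intro smooth_on_scaleR smooth_on_divide smooth_on_const smr smw' S) (simp add: less_imp_neq[symmetric])
    show "smooth_on S \<phi>" by (rule smooth_on_subset[OF \<phi>(1) SW])
    show "\<phi> ` S \<subseteq> sphere 0 1" using \<phi>(2) SW by blast
    show "first_ff X x u y = first_ff \<phi> x u y" if "x \<in> S" for x u y using ff that SW by blast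
    show "first_ff X x (s i x) (s j x) = (if i = j then 1 else 0)" if x: "x \<in> S" for x i j
    proof (cases "i = j")
      case True
      have "r i x * r i x = first_ff X x (w' i x) (w' i x)"
        unfolding r_def using ff_pos[OF x, of i] by simp
      then show ?thesis using True r_pos[OF x, of i] ff_pos[OF x, of j] by (simp add: ff_s[OF x])
    next
      case False
      then show ?thesis by (simp add: ff_s[OF x] ortho[OF x])
    qed
    show "(\<Sum>k\<in>UNIV. v k * (dif X x u \<bullet> dif (E k) x (s i x))) = \<mu> i x * first_ff X x (s i x) u" if x: "x \<in> S" for x i u
    proof -
      have xW: "x \<in> W" using x SW by auto
      have "(\<Sum>k\<in>UNIV. v k * (dif X x u \<bullet> dif (E k) x (s i x))) = u \<bullet> (H x *v s i x)"
        by (rule H[OF xW, symmetric])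
      also have "\<dots> = (u \<bullet> (H x *v w' i x)) / r i x"
        by (simp add: s_def matrix_vector_mult_scaleR)
      also have "\<dots> = \<mu> i x * first_ff X x u (s i x)"
        by (simp add: Hw'[OF x] ff_s[OF x])
      finally show ?thesis by (simp add: first_ff_def inner_commute)
    qed
    show "\<mu> i x \<noteq> \<mu> j x" if "x \<in> S" "i \<noteq> j" for x i j by (rule nz(1)[OF that])
    show "\<mu> i x \<noteq> 0" if "x \<in> S" for x i by (rule nz'(1)[OF that])
  qed
  ultimately have "principal_directions S X E \<phi> s v \<mu>"
    by (rule principal_directions.intro)
  then show thesis
    using that S(2) SW by blast
qed

end

section \<open>Central projection and the existence of curvature coordinates\<close>

lemma cone_point_inner: "cone_point 0 u \<bullet> cone_point 0 w = u \<bullet> w" "cone_point 0 u \<bullet> axis (Inr 1) 1 = 0"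
  unfolding inner_axis by (simp_all add: inner_vec_def sum_UNIV_Plus)

text \<open>Central projection of the tangent space at \<open>p\<close> to the sphere. Its metric at
  0 is the standard one, since the normalizing factor is stationary there.\<close>

lemma central_chart:
  fixes p :: "real^('n::finite + 1)"
  assumes "norm p = 1"
  obtains \<psi> :: "real^'n \<Rightarrow> real^('n + 1)"
    where "sphere_chart UNIV \<psi>" "\<psi> 0 = p" "\<And>u w. first_ff \<psi> 0 u w = u \<bullet> w"
proof -
  obtain f :: "real^('n + 1) \<Rightarrow> real^('n + 1)" where f: "orthogonal_transformation f" "f (axis (Inr 1) 1) = p"
    using orthogonal_transformation_exists_1[of "axis (Inr 1) 1 :: real^('n + 1)" p] assms by (auto simp: norm_axis_1)
  define L where "L = (\<lambda>u :: real^'n. f (cone_point 0 u))"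
  have L: "linear L"
    unfolding L_def using linear_compose[OF linear_cone_point_0 orthogonal_transformation_linear[OF f(1)]] by (simp add: o_def)
  then have bL: "bounded_linear L" by (simp add: linear_conv_bounded_linear)
  have LL: "L u \<bullet> L w = u \<bullet> w" and Lp: "L u \<bullet> p = 0" and pL: "p \<bullet> L u = 0" for u w
    using f cone_point_inner[of u] unfolding L_def orthogonal_transformation_def by (simp, metis, metis inner_commute)
  have pp: "p \<bullet> p = 1" using assms by (simp add: dot_square_norm)
  define \<sigma> where "\<sigma> = (\<lambda>u :: real^'n. 1 / sqrt (1 + u \<bullet> u))"
  have pos: "1 + u \<bullet> u > 0" for u :: "real^'n" using inner_ge_zero[of u] by linarith
  have \<sigma>_pos: "\<sigma> u > 0" for u using pos[of u] by (simp add: \<sigma>_def)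
  define \<psi> where "\<psi> = (\<lambda>u. \<sigma> u *\<^sub>R (L u + p))"
  have smL: "smooth_on UNIV L" by (rule smooth_on_bounded_linear[OF bL smooth_on_id]) simp_all
  have sm\<sigma>: "smooth_on UNIV \<sigma>"
    unfolding \<sigma>_def using pos by (intro smooth_intros open_UNIV) (auto simp: less_imp_neq[symmetric])
  have smLp: "smooth_on UNIV (\<lambda>u. L u + p)" by (intro smooth_intros smL open_UNIV)
  have sm: "smooth_on UNIV \<psi>"
    unfolding \<psi>_def by (intro smooth_intros sm\<sigma> smLp open_UNIV)
  \<comment> \<open>The normalizing factor can be recovered from the image, which gives injectivity;
    the same inner product with \<open>p\<close>, taken of derivatives, gives the immersion
    property.\<close>
  have \<psi>p: "\<psi> u \<bullet> p = \<sigma> u" for u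
    by (simp add: \<psi>_def inner_add_left Lp pp)
  have "\<psi> u \<bullet> \<psi> u = 1" for u
  proof -
    have "\<psi> u \<bullet> \<psi> u = (\<sigma> u * \<sigma> u) * (1 + u \<bullet> u)"
      by (simp add: \<psi>_def inner_add_left inner_add_right LL Lp pL pp algebra_simps)
    then show ?thesis using pos[of u] by (simp add: \<sigma>_def)
  qed
  then have sph: "\<psi> ` UNIV \<subseteq> sphere 0 1"
    by (auto simp: norm_eq_1)
  have d\<psi>: "dif \<psi> u h = \<sigma> u *\<^sub>R L h + dif \<sigma> u h *\<^sub>R (L u + p)" for u h
  proof -
    have "dif (\<lambda>u. L u + p) u h = L h"
      using dif_add[OF smooth_on_differentiable[OF smL] smooth_on_differentiable[OF smooth_on_const[of UNIV p]], of u h]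
      by (simp add: dif_bounded_linear_self[OF bL] dif_const)
    then show ?thesis
      unfolding \<psi>_def
      using dif_scaleR[OF smooth_on_differentiable[OF sm\<sigma>] smooth_on_differentiable[OF smLp], of u h] by simp
  qed
  have L0: "u = 0" if "L u = 0" for u
    using LL[of u u] that by simp
  have "inj (dif \<psi> u)" for u
    unfolding linear_injective_0[OF smooth_on_linear_dif[OF sm UNIV_I]]
  proof (intro allI impI)
    fix h assume 0: "dif \<psi> u h = 0"
    then have "dif \<psi> u h \<bullet> p = 0" by simp
    then have "dif \<sigma> u h = 0" by (simp add: d\<psi> inner_add_left Lp pp)
    with 0 have "L h = 0" using \<sigma>_pos[of u] by (simp add: d\<psi>)
    then show "h = 0" by (rule L0)
  qed
  moreover have "inj \<psi>"
  proof (rule injI)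
    fix u u' assume eq: "\<psi> u = \<psi> u'"
    then have "\<sigma> u = \<sigma> u'" using \<psi>p by metis
    with eq have "L (u - u') = 0" using \<sigma>_pos[of u'] by (simp add: \<psi>_def linear_diff[OF L])
    from L0[OF this] show "u = u'" by simp
  qed
  ultimately have "sphere_chart UNIV \<psi>"
    unfolding sphere_chart_def using sm sph by simp
  moreover have \<psi>0: "\<psi> 0 = p"
    by (simp add: \<psi>_def \<sigma>_def linear_0[OF L])
  moreover have "first_ff \<psi> 0 u w = u \<bullet> w" for u w
  proof -
    have "dif \<psi> 0 h = L h" for h
    proof -
      have "dif \<psi> 0 h \<bullet> p = 0"
        using sphere_valued_dif_orthogonal[OF open_UNIV sm sph UNIV_I, of 0 h] by (simp add: \<psi>0)
      then have "dif \<sigma> 0 h = 0" by (simp add: d\<psi> inner_add_left Lp pp)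
      then show ?thesis by (simp add: d\<psi> \<sigma>_def)
    qed
    then show ?thesis by (simp add: first_ff_def LL)
  qed
  ultimately show thesis by (rule that)
qed

text \<open>The chart centred at \<open>p\<close> supplies the standard metric at the one point
  where the linear algebra is done; the final chart is its composition with the curvature
  coordinates.\<close>

lemma forms_in_coordinates_exist:
  fixes X :: "real^('n::finite + 1) \<Rightarrow> real^('m::finite + 'n + 1)"
  assumes iso: "isometric_immersion M X" and nondeg: "nondegenerate_normal_bundle M X"
    and par: "parallel_normal_frame M X e" and p: "p \<in> M"
  shows "\<exists>W \<phi> A b. p \<in> \<phi> ` W \<and> forms_in_coordinates M X e W \<phi> A b"
proof -
  obtain Q where Q: "open Q" "M = sphere 0 1 \<inter> Q"
    using iso unfolding isometric_immersion_def openin_open by auto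
  then have "norm p = 1" using p by auto
  then obtain \<psi> :: "real^'n \<Rightarrow> real^('n + 1)"
    where \<psi>: "sphere_chart UNIV \<psi>" "\<psi> 0 = p" "\<And>u w. first_ff \<psi> 0 u w = u \<bullet> w"
    using central_chart by metis
  have \<psi>': "smooth_on UNIV \<psi>" "range \<psi> \<subseteq> sphere 0 1" "inj \<psi>" "\<And>x. inj (dif \<psi> x)"
    using \<psi>(1) by (auto simp: sphere_chart_def)
  define W where "W = \<psi> -` Q"
  have W: "open W" "0 \<in> W" "\<psi> ` W \<subseteq> M"
    unfolding W_def using open_vimage[OF Q(1) smooth_on_continuous_on[OF \<psi>'(1)]] Q(2) p \<psi>(2) \<psi>'(2) by auto
  have sm\<psi>: "smooth_on W \<psi>" by (rule smooth_on_subset[OF \<psi>'(1)]) simp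
  have sph\<psi>: "\<psi> ` W \<subseteq> sphere 0 1" using \<psi>'(2) by blast
  have chart: "chart_in M W \<psi>"
    unfolding chart_in_def sphere_chart_def using W sm\<psi> sph\<psi> \<psi>'(3,4) inj_on_subset[OF \<psi>'(3)] by blast
  interpret framed_immersion W "X \<circ> \<psi>" "\<lambda>k. e k \<circ> \<psi>"
    by (rule framed_immersion_chart[OF iso par chart])
  have ff: "first_ff (X \<circ> \<psi>) x u w = first_ff \<psi> x u w" if "x \<in> W" for x u w
    using iso chart that unfolding isometric_immersion_def by blast
  have imm: "inj (dif (X \<circ> \<psi>) x)" if x: "x \<in> W" for x
  proof (rule inj_dif_of_first_ff[OF diffX[OF x]])
    fix u assume "first_ff (X \<circ> \<psi>) x u u = 0"
    then have "first_ff \<psi> x u u = 0" by (simp only: ff[OF x])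
    then have "dif \<psi> x u = 0" by (simp add: first_ff_def)
    then show "u = 0"
      using \<psi>'(4)[of x] linear_injective_0[OF smooth_on_linear_dif[OF sm\<psi> x]] by blast
  qed
  have nd: "dim (shape_operator (X \<circ> \<psi>) 0 ` normal_space (X \<circ> \<psi>) 0) = CARD('n)"
    using nondeg chart W(2) unfolding nondegenerate_normal_bundle_def by blast
  obtain S s v \<mu> where S: "0 \<in> S" "S \<subseteq> W"
    and pd: "principal_directions S (X \<circ> \<psi>) (\<lambda>k. e k \<circ> \<psi>) \<psi> s v \<mu>"
    using principal_directions_exist[OF W(2) _ imm nd sm\<psi> sph\<psi> ff] \<psi>(3) ff[OF W(2)] by metis
  interpret pd: principal_directions S "X \<circ> \<psi>" "\<lambda>k. e k \<circ> \<psi>" \<psi> s v \<mu>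
    by (rule pd)
  obtain V \<tau> where V: "open V" "0 \<in> \<tau> ` V" "\<tau> ` V \<subseteq> S" "smooth_on V \<tau>" "inj_on \<tau> V"
    "\<And>y u i. y \<in> V \<Longrightarrow> pd.alpha i (\<tau> y) (dif \<tau> y u) = u $ i"
    using pd.curvature_coordinates[OF S(1) imm[OF W(2)]] by metis
  define A where "A = (\<lambda>y. \<chi> k i. pd.a k i (\<tau> y))"
  \<comment> \<open>The principal coframe is \<open>pd.alpha i\<close> divided by
    \<open>pd.rho i\<close>, and \<open>pd.alpha i\<close> has become dx_i.\<close>
  define b where "b = (\<lambda>y. \<chi> i. 1 / pd.rho i (\<tau> y))"
  have \<tau>W: "\<tau> y \<in> S" if "y \<in> V" for y using V(3) that by blast
  have rho_nz: "pd.rho i (\<tau> y) \<noteq> 0" if "y \<in> V" for i y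
    using pd.rho_pos[OF \<tau>W[OF that], of i] by simp
  have "chart_in M V (\<psi> \<circ> \<tau>)"
    unfolding chart_in_def sphere_chart_def
  proof (intro conjI ballI)
    show "open V" by fact
    show "smooth_on V (\<psi> \<circ> \<tau>)"
      unfolding o_def by (rule smooth_on_compose[OF \<psi>'(1) V(4,1)]) simp_all
    show "(\<psi> \<circ> \<tau>) ` V \<subseteq> sphere 0 1" using \<psi>'(2) by (auto simp: subset_iff)
    show "(\<psi> \<circ> \<tau>) ` V \<subseteq> M" using V(3) S(2) W(3) by (auto simp: subset_iff)
    show "inj_on (\<psi> \<circ> \<tau>) V"
      by (rule comp_inj_on[OF V(5)]) (rule inj_on_subset[OF \<psi>'(3)], simp)
    fix y assume y: "y \<in> V"
    have "inj (dif \<tau> y)"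
    proof (rule injI)
      fix u u' assume "dif \<tau> y u = dif \<tau> y u'"
      then have "u $ i = u' $ i" for i using V(6)[OF y, of i u] V(6)[OF y, of i u'] by simp
      then show "u = u'" by (simp add: vec_eq_iff)
    qed
    moreover have "dif (\<psi> \<circ> \<tau>) y = dif \<psi> (\<tau> y) \<circ> dif \<tau> y"
      using dif_compose[OF smooth_on_differentiable[OF V(4) y] smooth_on_differentiable[OF \<psi>'(1) UNIV_I]]
      by (simp add: o_def fun_eq_iff)
    ultimately show "inj (dif (\<psi> \<circ> \<tau>) y)"
      using inj_compose[OF \<psi>'(4)] by simp
  qed
  moreover have "smooth_on V A"
  proof -
    have "smooth_on V (\<lambda>y. pd.a k i (\<tau> y))" for k i
      by (rule smooth_on_compose[OF pd.smooth_a V(4,1) pd.openW V(3)])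
    then show ?thesis unfolding A_def by (intro smooth_on_vec_lambda V(1))
  qed
  moreover have "A ` V \<subseteq> stiefel"
  proof
    fix B assume "B \<in> A ` V"
    then obtain y where y: "y \<in> V" "B = A y" by blast
    show "B \<in> stiefel"
      unfolding y(2) stiefel_def
      by (simp add: vec_eq_iff matrix_matrix_mult_def transpose_def A_def mat_def pd.a_orthonormal[OF \<tau>W[OF y(1)]])
  qed
  moreover have "smooth_on V b"
  proof -
    have "smooth_on V (\<lambda>y. pd.rho i (\<tau> y))" for i
      by (rule smooth_on_compose[OF pd.smooth_rho V(4,1) pd.openW V(3)])
    then show ?thesis
      unfolding b_def using rho_nz
      by (intro smooth_on_vec_lambda[where f = "\<lambda>y i. 1 / pd.rho i (\<tau> y)"] smooth_on_divide smooth_on_const V(1)) auto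
  qed
  moreover have "first_ff (X \<circ> (\<psi> \<circ> \<tau>)) y u w = (\<Sum>i\<in>UNIV. (b y $ i)\<^sup>2 * (u $ i * w $ i))"
    "second_ff (X \<circ> (\<psi> \<circ> \<tau>)) (\<lambda>k. e k \<circ> (\<psi> \<circ> \<tau>)) y u w =
         (\<Sum>i\<in>UNIV. \<Sum>j\<in>UNIV. (A y $ j $ i * b y $ i * (u $ i * w $ i)) *\<^sub>R e j ((\<psi> \<circ> \<tau>) y))"
    if y: "y \<in> V" for y u w
    using pd.forms_in_curvature_coordinates[OF V(1,4,3) y V(6)[OF y], of u w]
    by (simp_all add: o_def A_def b_def)
  moreover have "p \<in> (\<psi> \<circ> \<tau>) ` V"
    unfolding image_comp[symmetric] using V(2) \<psi>(2) by blast
  ultimately show ?thesis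
    unfolding forms_in_coordinates_def
    by (intro exI[of _ V] exI[of _ "\<psi> \<circ> \<tau>"] exI[of _ A] exI[of _ b]) blast
qed

theorem theorem6p5:
  "(\<forall>(M :: (real^('n::finite + 1)) set) (X :: real^('n + 1) \<Rightarrow> real^('m::finite + 'n + 1)) e.
      isometric_immersion M X \<and> flat_normal_bundle M X \<and> nondegenerate_normal_bundle M X \<and>
      parallel_normal_frame M X e \<longrightarrow>
      \<comment> \<open>(i)\<close>
      (\<forall>p\<in>M. \<exists>W \<phi> A b. p \<in> \<phi> ` W \<and> forms_in_coordinates M X e W \<phi> A b) \<and>
      (\<forall>W \<phi> A b. forms_in_coordinates M X e W \<phi> A b \<longrightarrow>
         \<comment> \<open>(ii)\<close>
         partial_G_system_I W A (F_of b) b \<and>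
         \<comment> \<open>(iii)\<close>
         solves_star W A (F_of b) b (adapted_frame (X \<circ> \<phi>) (\<lambda>k. e k \<circ> \<phi>) b) \<and>
         (\<forall>x\<in>W. \<forall>i. map_matrix complex_of_real (star_coeff (A x) (F_of b x) (b x) i)
                      = lax_coeff 1 (A x) (F_of b x) (b x) i)))
   \<and>
   \<comment> \<open>(iv); starlike V includes small balls and, if W is the whole space, V = W.
        X is an immersion only where no \<open>b\<^sub>i\<close> vanishes.\<close>
   (\<forall>(W :: (real^'n) set) (A :: real^'n \<Rightarrow> real^'n^'m) F b.
      open W \<and> partial_G_system_I W A F b \<longrightarrow>
      (\<forall>V. open V \<and> V \<subseteq> W \<and> starlike V \<longrightarrow> (\<exists>g. solves_star V A F b g)) \<and>
      (\<forall>V g. open V \<and> V \<subseteq> W \<and> solves_star V A F b g \<longrightarrow>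
         (\<forall>x\<in>V. last_column (g x) \<in> sphere 0 1) \<and>
         local_isometric_immersion_of_sphere {x \<in> V. \<forall>i. b x $ i \<noteq> 0} (\<lambda>x. last_column (g x))))"
proof (intro conjI allI impI; (elim conjE)?)
  fix M :: "(real^('n + 1)) set" and X :: "real^('n + 1) \<Rightarrow> real^('m + 'n + 1)" and e
  assume iso: "isometric_immersion M X" and nondeg: "nondegenerate_normal_bundle M X"
    and par: "parallel_normal_frame M X e"
  show "\<forall>p\<in>M. \<exists>W \<phi> A b. p \<in> \<phi> ` W \<and> forms_in_coordinates M X e W \<phi> A b"
    using forms_in_coordinates_exist[OF iso nondeg par] by blast
  fix W \<phi> A b assume "forms_in_coordinates M X e W \<phi> A b"
  then interpret principal_coordinates W "X \<circ> \<phi>" "\<lambda>k. e k \<circ> \<phi>" A b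
    by (rule principal_coordinates_of_forms[OF iso par])
  show "partial_G_system_I W A (F_of b) b" by (rule system_solution)
  show "solves_star W A (F_of b) b (adapted_frame (X \<circ> \<phi>) (\<lambda>k. e k \<circ> \<phi>) b)" by (rule frame_solves_star)
  show "\<forall>x\<in>W. \<forall>i. map_matrix complex_of_real (star_coeff (A x) (F_of b x) (b x) i)
      = lax_coeff 1 (A x) (F_of b x) (b x) i"
    by (simp add: map_matrix_star_coeff_eq_lax_coeff)
next
  fix W :: "(real^'n) set" and A :: "real^'n \<Rightarrow> real^'n^'m" and F b V
  assume W: "open W" "partial_G_system_I W A F b" and V: "open V" "V \<subseteq> W"
  show "\<exists>g. solves_star V A F b g" if "starlike V"
    by (rule solves_star_exists[OF W V that])
  fix g assume g: "solves_star V A F b g"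
  show "\<forall>x\<in>V. last_column (g x) \<in> sphere 0 1"
    by (rule local_isometric_immersion_of_solution(1)[OF W V g])
  show "local_isometric_immersion_of_sphere {x \<in> V. \<forall>i. b x $ i \<noteq> 0} (\<lambda>x. last_column (g x))"
    by (rule local_isometric_immersion_of_solution(2)[OF W V g])
qed

end
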